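(* Let $\mathbb{K}$ be any field, let $R=\mathbb{K}[x_1,\ldots,x_n]$, and let $J\subseteq R$ be any $C$-matroidal ideal. Then for every integer $\ell\geq 1$ and every squarefree monomial $N\in R$, the ideal $J^{(\ell)}:N$ is Cohen--Macaulay.
   Context: A matroid $\mathcal{M}$ on a ground set $V$ is a non-empty collection $\mathcal{B}$ of subsets of $V$ (the bases) such that for all $F,G\in\mathcal{B}$ and all $v\in F\setminus G$ there is $w\in G\setminus F$ with $(F\setminus\{v\})\cup\{w\}\in\mathcal{B}$. A matroid is identified with its independence complex, i.e. the simplicial complex whose facets are the bases. For a simplicial complex $\Delta$ on $[n]=\{1,\ldots,n\}$ with set of facets $\mathcal{F}(\Delta)$, and for $F\subseteq[n]$, put $\mathfrak{p}_F=(x_i : i\in F)\subset R$ (with $\mathfrak{p}_\emptyset=(0)$). The Stanley--Reisner ideal of $\Delta$ is $I_\Delta=\bigcap_{[n]\setminus F\in\mathcal{F}(\Delta)}\mathfrak{p}_F$ and the cover ideal of $\Delta$ is $J(\Delta)=\bigcap_{F\in\mathcal{F}(\Delta)}\mathfrak{p}_F$. An ideal $J\subseteq R$ is called $C$-matroidal if it is the Stanley--Reisner ideal or the cover ideal of a matroid on $[n]$. For a squarefree monomial ideal $J$ and $\ell\ge 1$, the $\ell$-th symbolic power is $J^{(\ell)}=\bigcap_{\mathfrak{p}\in\mathrm{Ass}(R/J)}\mathfrak{p}^{\ell}$. The monomial $N=1$ is squarefree. An ideal $I\subseteq R$ is called Cohen--Macaulay if $R/I$ is Cohen--Macaulay;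 the unit ideal (zero quotient) is regarded as trivially Cohen--Macaulay. *)

theory Defs
  imports "HOL-Algebra.Algebra" "HOL-Library.Poly_Mapping" "HOL-Library.Extended_Nat"
begin

section \<open>Matroids and simplicial complexes\<close>

definition matroid_bases :: "'a set \<Rightarrow> 'a set set \<Rightarrow> bool" where
  "matroid_bases V \<B> \<longleftrightarrow> \<B> \<subseteq> Pow V \<and> \<B> \<noteq> {} \<and>
     (\<forall>F\<in>\<B>. \<forall>G\<in>\<B>. \<forall>v\<in>F - G. \<exists>w\<in>G - F. (F - {v}) \<union> {w} \<in> \<B>)"

text \<open>A simplicial complex is represented by its set of faces.\<close>

definition facets :: "'a set set \<Rightarrow> 'a set set" where
  "facets \<Delta> = {F \<in> \<Delta>. \<forall>G\<in>\<Delta>. F \<subseteq> G \<longrightarrow> G = F}"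

definition independence_complex :: "'a set set \<Rightarrow> 'a set set" where
  "independence_complex \<B> = {F. \<exists>B\<in>\<B>. F \<subseteq> B}"


section \<open>The polynomial ring in \<open>n\<close> variables\<close>

text \<open>A monomial is a finitely supported exponent vector, a polynomial a finitely supported
  function from monomials to coefficients. The type has countably many variables; the ring
  \<open>K[x\<^sub>1,\<dots>,x\<^sub>n]\<close> consists of the polynomials that involve only variables with index in \<open>{1..n}\<close>.\<close>

type_synonym monom_exp = "nat \<Rightarrow>\<^sub>0 nat"
type_synonym 'k mvpoly = "monom_exp \<Rightarrow>\<^sub>0 'k"

definition mvpoly_ring :: "nat \<Rightarrow> ('k::field) mvpoly ring" where
  "mvpoly_ring n = \<lparr>carrier = {p. \<forall>m\<in>Poly_Mapping.keys p. Poly_Mapping.keys m \<subseteq> {1..n}},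
                    monoid.mult = (*), monoid.one = 1, ring.zero = 0, ring.add = (+)\<rparr>"

definition var :: "nat \<Rightarrow> ('k::field) mvpoly" where
  "var i = Poly_Mapping.single (Poly_Mapping.single i 1) 1"

definition squarefree_monomial :: "nat \<Rightarrow> ('k::field) mvpoly \<Rightarrow> bool" where
  "squarefree_monomial n N \<longleftrightarrow>
     (\<exists>m. Poly_Mapping.keys m \<subseteq> {1..n} \<and> (\<forall>i. Poly_Mapping.lookup m i \<le> 1) \<and>
        N = Poly_Mapping.single m 1)"


section \<open>Stanley--Reisner ideals and cover ideals\<close>

definition var_ideal :: "nat \<Rightarrow> nat set \<Rightarrow> ('k::field) mvpoly set" where
  "var_ideal n F = genideal (mvpoly_ring n) (var ` F)"

text \<open>In this section and the next, intersecting with the carrier makes the intersection of an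
  empty family the unit ideal.\<close>

definition stanley_reisner_ideal :: "nat \<Rightarrow> nat set set \<Rightarrow> ('k::field) mvpoly set" where
  "stanley_reisner_ideal n \<Delta> =
     carrier (mvpoly_ring n) \<inter> \<Inter> {var_ideal n F | F. F \<subseteq> {1..n} \<and> {1..n} - F \<in> facets \<Delta>}"

definition cover_ideal :: "nat \<Rightarrow> nat set set \<Rightarrow> ('k::field) mvpoly set" where
  "cover_ideal n \<Delta> = carrier (mvpoly_ring n) \<inter> \<Inter> {var_ideal n F | F. F \<in> facets \<Delta>}"

definition C_matroidal :: "nat \<Rightarrow> ('k::field) mvpoly set \<Rightarrow> bool" where
  "C_matroidal n J \<longleftrightarrow> (\<exists>\<B>. matroid_bases {1..n} \<B> \<and>
     (J = stanley_reisner_ideal n (independence_complex \<B>) \<or>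
      J = cover_ideal n (independence_complex \<B>)))"


section \<open>Colon ideals and symbolic powers\<close>

definition colon_ideal :: "('a, 'b) ring_scheme \<Rightarrow> 'a set \<Rightarrow> 'a \<Rightarrow> 'a set" where
  "colon_ideal R J f = {r \<in> carrier R. r \<otimes>\<^bsub>R\<^esub> f \<in> J}"

text \<open>The annihilator in \<open>R\<close> of the residue class of \<open>f\<close> in \<open>R/J\<close> is \<open>colon_ideal R J f\<close>.\<close>

definition Ass_quotient :: "('a, 'b) ring_scheme \<Rightarrow> 'a set \<Rightarrow> 'a set set" where
  "Ass_quotient R J = {P. primeideal P R \<and> (\<exists>f\<in>carrier R. P = colon_ideal R J f)}"

primrec ideal_power :: "('a, 'b) ring_scheme \<Rightarrow> 'a set \<Rightarrow> nat \<Rightarrow> 'a set" where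
  "ideal_power R I 0 = carrier R"
| "ideal_power R I (Suc k) = ideal_prod R I (ideal_power R I k)"

text \<open>The following formula is the definition of the symbolic power for squarefree monomial ideals
  \<open>J\<close> only; for general ideals one has to contract powers of \<open>J\<close> from localizations instead.\<close>

definition symbolic_power :: "('a, 'b) ring_scheme \<Rightarrow> 'a set \<Rightarrow> nat \<Rightarrow> 'a set" where
  "symbolic_power R J l = carrier R \<inter> \<Inter> {ideal_power R P l | P. P \<in> Ass_quotient R J}"


section \<open>Localization at a prime\<close>

text \<open>Fractions \<open>a/s\<close> with \<open>s \<notin> P\<close> are classes of pairs \<open>(a, s)\<close>. The factor \<open>u\<close> is needed
  since the ring may have zero divisors.\<close>

definition frac_rel :: "('a, 'b) ring_scheme \<Rightarrow> 'a set \<Rightarrow> (('a \<times> 'a) \<times> ('a \<times> 'a)) set" where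
  "frac_rel A P = {((a, s), (b, t)). a \<in> carrier A \<and> s \<in> carrier A - P \<and>
      b \<in> carrier A \<and> t \<in> carrier A - P \<and>
      (\<exists>u\<in>carrier A - P. u \<otimes>\<^bsub>A\<^esub> (a \<otimes>\<^bsub>A\<^esub> t) = u \<otimes>\<^bsub>A\<^esub> (b \<otimes>\<^bsub>A\<^esub> s))}"

definition loc_frac :: "('a, 'b) ring_scheme \<Rightarrow> 'a set \<Rightarrow> 'a \<Rightarrow> 'a \<Rightarrow> ('a \<times> 'a) set" where
  "loc_frac A P a s = frac_rel A P `` {(a, s)}"

text \<open>The unions in sum and product are over equal sets, as the operations do not depend on the
  chosen representatives.\<close>

definition localization :: "('a, 'b) ring_scheme \<Rightarrow> 'a set \<Rightarrow> ('a \<times> 'a) set ring" where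
  "localization A P = \<lparr>
     carrier = {loc_frac A P a s | a s. a \<in> carrier A \<and> s \<in> carrier A - P},
     monoid.mult = (\<lambda>U V. \<Union>(a, s)\<in>U. \<Union>(b, t)\<in>V. loc_frac A P (a \<otimes>\<^bsub>A\<^esub> b) (s \<otimes>\<^bsub>A\<^esub> t)),
     monoid.one = loc_frac A P \<one>\<^bsub>A\<^esub> \<one>\<^bsub>A\<^esub>,
     ring.zero = loc_frac A P \<zero>\<^bsub>A\<^esub> \<one>\<^bsub>A\<^esub>,
     ring.add = (\<lambda>U V. \<Union>(a, s)\<in>U. \<Union>(b, t)\<in>V.
              loc_frac A P ((a \<otimes>\<^bsub>A\<^esub> t) \<oplus>\<^bsub>A\<^esub> (b \<otimes>\<^bsub>A\<^esub> s)) (s \<otimes>\<^bsub>A\<^esub> t))\<rparr>"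


section \<open>Cohen--Macaulay rings\<close>

definition krull_dim :: "('a, 'b) ring_scheme \<Rightarrow> enat" where
  "krull_dim A = Sup {enat k | k. \<exists>Q :: nat \<Rightarrow> 'a set.
      (\<forall>i\<le>k. primeideal (Q i) A) \<and> (\<forall>i<k. Q i \<subset> Q (Suc i))}"

definition regular_sequence :: "('a, 'b) ring_scheme \<Rightarrow> 'a list \<Rightarrow> bool" where
  "regular_sequence A xs \<longleftrightarrow> set xs \<subseteq> carrier A \<and> genideal A (set xs) \<noteq> carrier A \<and>
     (\<forall>i<length xs. \<forall>a\<in>carrier A.
        a \<otimes>\<^bsub>A\<^esub> xs ! i \<in> genideal A (set (take i xs)) \<longrightarrow> a \<in> genideal A (set (take i xs)))"

definition depth :: "('a, 'b) ring_scheme \<Rightarrow> 'a set \<Rightarrow> enat" where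
  "depth A I = Sup {enat (length xs) | xs. regular_sequence A xs \<and> set xs \<subseteq> I}"

definition cohen_macaulay_local :: "('a, 'b) ring_scheme \<Rightarrow> bool" where
  "cohen_macaulay_local A \<longleftrightarrow> cring A \<and> noetherian_ring A \<and> (\<exists>!M. maximalideal M A) \<and>
     (\<forall>M. maximalideal M A \<longrightarrow> depth A M = krull_dim A)"

text \<open>The zero ring has no maximal ideals, so it is Cohen--Macaulay in the following sense.\<close>

definition cohen_macaulay :: "('a, 'b) ring_scheme \<Rightarrow> bool" where
  "cohen_macaulay A \<longleftrightarrow> cring A \<and> noetherian_ring A \<and>
     (\<forall>M. maximalideal M A \<longrightarrow> cohen_macaulay_local (localization A M))"

definition cohen_macaulay_ideal :: "('a, 'b) ring_scheme \<Rightarrow> 'a set \<Rightarrow> bool" where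
  "cohen_macaulay_ideal R I \<longleftrightarrow> ideal I R \<and> cohen_macaulay (R Quot I)"

end

theory Submission
  imports Defs
begin

text \<open>After dualizing if necessary, \<open>J\<close> is the intersection of the primes \<open>p\<^sub>B\<close> over the bases \<open>B\<close> of a
  matroid of rank \<open>r\<close>, and a monomial \<open>x\<^sup>m\<close> lies in \<open>I = J\<^sup>(\<^sup>l\<^sup>) : N\<close> iff \<open>m(B) + |B \<inter> supp N| \<ge> l\<close> for all \<open>B\<close>.
  If \<open>x\<close> is a variable outside \<open>supp N\<close> that is not a loop, then \<open>I : x\<close> is of the same form with \<open>N\<close> replaced
  by \<open>N x\<close>, and by basis exchange \<open>I + (x)\<close> comes from the contraction of the matroid by \<open>x\<close>. If no such
  variable is left, \<open>I\<close> is the symbolic power of exponent \<open>l - r\<close>. So \<open>R/I\<close> has a filtration with quotients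
  \<open>R/p\<^sub>B\<close>, and a sequence that is weakly regular on every \<open>R/p\<^sub>B\<close> is weakly regular on \<open>R/I\<close>.

  For a maximal ideal \<open>M\<close>, Zariski's lemma gives nonzero polynomials \<open>z\<^sub>j \<in> M\<close> in the single variable \<open>x\<^sub>j\<close> without
  constant term. The elementary symmetric polynomials of degrees \<open>n - r, \<dots>, 1\<close> in the \<open>z\<^sub>j\<close> then form a
  sequence in \<open>M\<close> that is weakly regular on every \<open>R/p\<^sub>B\<close>; hence the depth of \<open>(R/I)\<^sub>M\<close> is at least \<open>n - r\<close>.
  Counting monomials outside \<open>I\<close> bounds the length of prime chains above \<open>I\<close> by \<open>n - r\<close>. Since the depth never
  exceeds the dimension, all these numbers agree.\<close>

section \<open>Localization\<close>

text \<open>Cohen-Macaulayness is demanded at every maximal ideal M, not only at the one generated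
  by the variables, and K need not be algebraically closed, so M need not consist of the polynomials
  vanishing at a point of K^n. At the origin one could take z_j = x_j; elsewhere polynomials in x_j
  alone replace the variables. Three properties of z_j count: it lies in M; its leading coefficient
  is a nonzero constant, which lets it be cancelled modulo ideals generated without x_j; and it is
  divisible by x_j, which puts it into p_B for j in B. The symmetric combinations treat all indices
  alike, so one sequence serves all bases B at once, as the filtration requires.

  Regularity is kept weak, without properness, because unit ideals occur in the filtration;
  properness returns only in the local ring. Quotient and localization are handled as one
  homomorphism with denominators, so that all calculations with sequences and chains take place in
  R.\<close>

context primeideal
begin

lemma compl_one: "\<one> \<in> carrier R - I"
  using I_notcarr one_imp_carrier by auto

lemma compl_mult: "s \<in> carrier R - I \<Longrightarrow> t \<in> carrier R - I \<Longrightarrow> s \<otimes> t \<in> carrier R - I"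
  using I_prime by auto

lemma frac_rel_trans:
  assumes "((a, s), (b, t)) \<in> frac_rel R I" "((b, t), (c, v)) \<in> frac_rel R I"
  shows "((a, s), (c, v)) \<in> frac_rel R I"
proof -
  from assms obtain u w where u: "u \<in> carrier R - I" "u \<otimes> (a \<otimes> t) = u \<otimes> (b \<otimes> s)"
    and w: "w \<in> carrier R - I" "w \<otimes> (b \<otimes> v) = w \<otimes> (c \<otimes> t)"
    and c: "a \<in> carrier R" "b \<in> carrier R" "c \<in> carrier R"
      "s \<in> carrier R - I" "t \<in> carrier R - I" "v \<in> carrier R - I"
    unfolding frac_rel_def by auto
  have uc: "u \<in> carrier R" "w \<in> carrier R" "s \<in> carrier R" "t \<in> carrier R" "v \<in> carrier R"
    using u w c by auto
  \<comment> \<open>The middle denominator t joins the witness: it cannot be cancelled from an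
    equation, but it lies outside the prime, as u and w do.\<close>
  have "(u \<otimes> w \<otimes> t) \<otimes> (a \<otimes> v) = (u \<otimes> (a \<otimes> t)) \<otimes> (w \<otimes> v)"
    using uc c by algebra
  also have "\<dots> = (w \<otimes> (b \<otimes> v)) \<otimes> (u \<otimes> s)"
    unfolding u using uc c by algebra
  also have "\<dots> = (u \<otimes> w \<otimes> t) \<otimes> (c \<otimes> s)"
    unfolding w using uc c by algebra
  finally have "(u \<otimes> w \<otimes> t) \<otimes> (a \<otimes> v) = (u \<otimes> w \<otimes> t) \<otimes> (c \<otimes> s)" .
  moreover have "u \<otimes> w \<otimes> t \<in> carrier R - I"
    using u w c compl_mult by blast
  ultimately show ?thesis
    unfolding frac_rel_def using c by auto
qed

lemma equiv_frac_rel: "equiv (carrier R \<times> (carrier R - I)) (frac_rel R I)"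
proof (rule equivI)
  show "frac_rel R I \<subseteq> (carrier R \<times> (carrier R - I)) \<times> (carrier R \<times> (carrier R - I))"
    unfolding frac_rel_def by auto
  show "refl_on (carrier R \<times> (carrier R - I)) (frac_rel R I)"
    unfolding refl_on_def frac_rel_def using compl_one by auto
  show "sym (frac_rel R I)"
    unfolding sym_def frac_rel_def by (auto intro: sym)
  show "trans (frac_rel R I)"
    unfolding trans_def using frac_rel_trans by auto
qed

lemma loc_frac_eq_iff:
  assumes "a \<in> carrier R" "b \<in> carrier R" "s \<in> carrier R - I" "t \<in> carrier R - I"
  shows "loc_frac R I a s = loc_frac R I b t \<longleftrightarrow>
    (\<exists>u\<in>carrier R - I. u \<otimes> (a \<otimes> t) = u \<otimes> (b \<otimes> s))"
proof -
  have "loc_frac R I a s = loc_frac R I b t \<longleftrightarrow> ((a, s), (b, t)) \<in> frac_rel R I"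
    unfolding loc_frac_def using equiv_frac_rel assms by (intro eq_equiv_class_iff) auto
  then show ?thesis
    unfolding frac_rel_def using assms by auto
qed

lemma mem_loc_frac:
  "(b, t) \<in> loc_frac R I a s \<longleftrightarrow> a \<in> carrier R \<and> b \<in> carrier R \<and> s \<in> carrier R - I \<and>
     t \<in> carrier R - I \<and> (\<exists>u\<in>carrier R - I. u \<otimes> (a \<otimes> t) = u \<otimes> (b \<otimes> s))"
  unfolding loc_frac_def frac_rel_def by auto

text \<open>Sum and product in \<open>localization\<close> are unions over all representatives. Once
  the value does not depend on them, all members of the union are the same class, and the union is
  not empty because (a, s) lies in its own class.\<close>

lemma loc_frac_union:
  assumes ab: "a \<in> carrier R" "b \<in> carrier R" "s \<in> carrier R - I" "t \<in> carrier R - I"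
    and G: "\<And>a' s' b' t'. (a', s') \<in> loc_frac R I a s \<Longrightarrow> (b', t') \<in> loc_frac R I b t \<Longrightarrow>
      G a' s' b' t' = G a s b t"
  shows "(\<Union>(a, s)\<in>loc_frac R I a s. \<Union>(b, t)\<in>loc_frac R I b t. G a s b t) = G a s b t"
proof -
  have "(a, s) \<in> loc_frac R I a s" "(b, t) \<in> loc_frac R I b t"
    unfolding mem_loc_frac using ab compl_one by auto
  then show ?thesis
    using G by fast
qed

lemma localization_carrier:
  "carrier (localization R I) = {loc_frac R I a s | a s. a \<in> carrier R \<and> s \<in> carrier R - I}"
  and localization_one: "\<one>\<^bsub>localization R I\<^esub> = loc_frac R I \<one> \<one>"
  and localization_zero: "\<zero>\<^bsub>localization R I\<^esub> = loc_frac R I \<zero> \<one>"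
  unfolding localization_def by auto

lemma localization_mult:
  assumes ab: "a \<in> carrier R" "b \<in> carrier R" "s \<in> carrier R - I" "t \<in> carrier R - I"
  shows "loc_frac R I a s \<otimes>\<^bsub>localization R I\<^esub> loc_frac R I b t = loc_frac R I (a \<otimes> b) (s \<otimes> t)"
proof -
  have "loc_frac R I (a' \<otimes> b') (s' \<otimes> t') = loc_frac R I (a \<otimes> b) (s \<otimes> t)"
    if as': "(a', s') \<in> loc_frac R I a s" and bt': "(b', t') \<in> loc_frac R I b t" for a' s' b' t'
  proof -
    from as' obtain u where u: "u \<in> carrier R - I" "u \<otimes> (a \<otimes> s') = u \<otimes> (a' \<otimes> s)"
      and c1: "a' \<in> carrier R" "s' \<in> carrier R - I"
      unfolding mem_loc_frac by auto
    from bt' obtain w where w: "w \<in> carrier R - I" "w \<otimes> (b \<otimes> t') = w \<otimes> (b' \<otimes> t)"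
      and c2: "b' \<in> carrier R" "t' \<in> carrier R - I"
      unfolding mem_loc_frac by auto
    have c: "u \<in> carrier R" "w \<in> carrier R" "s \<in> carrier R" "t \<in> carrier R" "s' \<in> carrier R" "t' \<in> carrier R"
      using u w ab c1 c2 by auto
    have "(u \<otimes> w) \<otimes> ((a' \<otimes> b') \<otimes> (s \<otimes> t)) = (u \<otimes> (a' \<otimes> s)) \<otimes> (w \<otimes> (b' \<otimes> t))"
      using c ab c1 c2 by algebra
    also have "\<dots> = (u \<otimes> w) \<otimes> ((a \<otimes> b) \<otimes> (s' \<otimes> t'))"
      unfolding u(2)[symmetric] w(2)[symmetric] using c ab c1 c2 by algebra
    finally show ?thesis
      using compl_mult ab c1 c2 u w by (subst loc_frac_eq_iff) auto
  qed
  then show ?thesis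
    unfolding localization_def using loc_frac_union[OF ab, of "\<lambda>a s b t. loc_frac R I (a \<otimes> b) (s \<otimes> t)"] by simp
qed

lemma localization_add:
  assumes ab: "a \<in> carrier R" "b \<in> carrier R" "s \<in> carrier R - I" "t \<in> carrier R - I"
  shows "loc_frac R I a s \<oplus>\<^bsub>localization R I\<^esub> loc_frac R I b t =
    loc_frac R I ((a \<otimes> t) \<oplus> (b \<otimes> s)) (s \<otimes> t)"
proof -
  have "loc_frac R I ((a' \<otimes> t') \<oplus> (b' \<otimes> s')) (s' \<otimes> t') = loc_frac R I ((a \<otimes> t) \<oplus> (b \<otimes> s)) (s \<otimes> t)"
    if as': "(a', s') \<in> loc_frac R I a s" and bt': "(b', t') \<in> loc_frac R I b t" for a' s' b' t'
  proof -
    from as' obtain u where u: "u \<in> carrier R - I" "u \<otimes> (a \<otimes> s') = u \<otimes> (a' \<otimes> s)"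
      and c1: "a' \<in> carrier R" "s' \<in> carrier R - I"
      unfolding mem_loc_frac by auto
    from bt' obtain w where w: "w \<in> carrier R - I" "w \<otimes> (b \<otimes> t') = w \<otimes> (b' \<otimes> t)"
      and c2: "b' \<in> carrier R" "t' \<in> carrier R - I"
      unfolding mem_loc_frac by auto
    have c: "u \<in> carrier R" "w \<in> carrier R" "s \<in> carrier R" "t \<in> carrier R" "s' \<in> carrier R" "t' \<in> carrier R"
      using u w ab c1 c2 by auto
    have "(u \<otimes> w) \<otimes> (((a' \<otimes> t') \<oplus> (b' \<otimes> s')) \<otimes> (s \<otimes> t)) =
        (u \<otimes> (a' \<otimes> s)) \<otimes> (w \<otimes> t \<otimes> t') \<oplus> (w \<otimes> (b' \<otimes> t)) \<otimes> (u \<otimes> s \<otimes> s')"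
      using c ab c1 c2 by algebra
    also have "\<dots> = (u \<otimes> w) \<otimes> (((a \<otimes> t) \<oplus> (b \<otimes> s)) \<otimes> (s' \<otimes> t'))"
      unfolding u(2)[symmetric] w(2)[symmetric] using c ab c1 c2 by algebra
    finally show ?thesis
      using compl_mult ab c1 c2 c u w by (subst loc_frac_eq_iff) auto
  qed
  then show ?thesis
    unfolding localization_def using loc_frac_union[OF ab, of "\<lambda>a s b t. loc_frac R I ((a \<otimes> t) \<oplus> (b \<otimes> s)) (s \<otimes> t)"] by simp
qed

lemma loc_frac_eqI:
  assumes "a \<in> carrier R" "b \<in> carrier R" "s \<in> carrier R - I" "t \<in> carrier R - I"
    and "a \<otimes> t = b \<otimes> s"
  shows "loc_frac R I a s = loc_frac R I b t"
  using assms compl_one by (subst loc_frac_eq_iff) auto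

lemma loc_frac_closed:
  assumes "a \<in> carrier R" "s \<in> carrier R - I"
  shows "loc_frac R I a s \<in> carrier (localization R I)"
  using assms unfolding localization_carrier by auto

lemma localization_cring: "cring (localization R I)"
proof -
  let ?L = "localization R I"
  note D = compl_mult compl_one
  show ?thesis
  proof (rule cringI)
    show "abelian_group ?L"
    proof (rule abelian_groupI)
      fix x y assume "x \<in> carrier ?L" "y \<in> carrier ?L"
      then obtain a s b t where xy: "x = loc_frac R I a s" "y = loc_frac R I b t"
        and c: "a \<in> carrier R" "b \<in> carrier R" "s \<in> carrier R - I" "t \<in> carrier R - I"
        unfolding localization_carrier by blast
      have c': "s \<in> carrier R" "t \<in> carrier R" using c by auto
      show "x \<oplus>\<^bsub>?L\<^esub> y \<in> carrier ?L"
        unfolding xy localization_add[OF c] using c c' D by (intro loc_frac_closed) auto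
      show "x \<oplus>\<^bsub>?L\<^esub> y = y \<oplus>\<^bsub>?L\<^esub> x"
        unfolding xy localization_add[OF c] localization_add[OF c(2,1,4,3)]
        using c c' D by (intro loc_frac_eqI) (auto simp: a_comm m_comm)
    next
      show "\<zero>\<^bsub>?L\<^esub> \<in> carrier ?L"
        unfolding localization_zero using D by (intro loc_frac_closed) auto
    next
      fix x y z assume "x \<in> carrier ?L" "y \<in> carrier ?L" "z \<in> carrier ?L"
      then obtain a s b t e v where xy: "x = loc_frac R I a s" "y = loc_frac R I b t" "z = loc_frac R I e v"
        and c: "a \<in> carrier R" "b \<in> carrier R" "e \<in> carrier R" "s \<in> carrier R - I" "t \<in> carrier R - I"
          "v \<in> carrier R - I"
        unfolding localization_carrier by blast
      have c': "s \<in> carrier R" "t \<in> carrier R" "v \<in> carrier R" using c by auto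
      have "x \<oplus>\<^bsub>?L\<^esub> y \<oplus>\<^bsub>?L\<^esub> z = loc_frac R I ((a \<otimes> t \<oplus> b \<otimes> s) \<otimes> v \<oplus> e \<otimes> (s \<otimes> t)) (s \<otimes> t \<otimes> v)"
        unfolding xy using c c' by (simp add: localization_add D del: Diff_iff)
      moreover have "x \<oplus>\<^bsub>?L\<^esub> (y \<oplus>\<^bsub>?L\<^esub> z) = loc_frac R I (a \<otimes> (t \<otimes> v) \<oplus> (b \<otimes> v \<oplus> e \<otimes> t) \<otimes> s) (s \<otimes> (t \<otimes> v))"
        unfolding xy using c c' by (simp add: localization_add D del: Diff_iff)
      moreover have "(a \<otimes> t \<oplus> b \<otimes> s) \<otimes> v \<oplus> e \<otimes> (s \<otimes> t) = a \<otimes> (t \<otimes> v) \<oplus> (b \<otimes> v \<oplus> e \<otimes> t) \<otimes> s"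
        using c c' by algebra
      moreover have "s \<otimes> t \<otimes> v = s \<otimes> (t \<otimes> v)"
        using c c' by algebra
      ultimately show "x \<oplus>\<^bsub>?L\<^esub> y \<oplus>\<^bsub>?L\<^esub> z = x \<oplus>\<^bsub>?L\<^esub> (y \<oplus>\<^bsub>?L\<^esub> z)"
        by simp
    next
      fix x assume "x \<in> carrier ?L"
      then obtain a s where x: "x = loc_frac R I a s" and c: "a \<in> carrier R" "s \<in> carrier R - I"
        unfolding localization_carrier by blast
      have c': "s \<in> carrier R" using c by auto
      show "\<zero>\<^bsub>?L\<^esub> \<oplus>\<^bsub>?L\<^esub> x = x"
        unfolding x localization_zero using c c' D by (subst localization_add) auto
      show "\<exists>y\<in>carrier ?L. y \<oplus>\<^bsub>?L\<^esub> x = \<zero>\<^bsub>?L\<^esub>"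
      proof (rule bexI)
        show "loc_frac R I (\<ominus> a) s \<in> carrier ?L"
          using c by (intro loc_frac_closed) auto
        have "loc_frac R I (\<ominus> a) s \<oplus>\<^bsub>?L\<^esub> x = loc_frac R I \<zero> (s \<otimes> s)"
          unfolding x using c c' by (simp add: localization_add l_minus l_neg)
        also have "\<dots> = \<zero>\<^bsub>?L\<^esub>"
          unfolding localization_zero using c c' D by (intro loc_frac_eqI) auto
        finally show "loc_frac R I (\<ominus> a) s \<oplus>\<^bsub>?L\<^esub> x = \<zero>\<^bsub>?L\<^esub>" .
      qed
    qed
    show "comm_monoid ?L"
    proof (rule comm_monoidI)
      fix x y assume "x \<in> carrier ?L" "y \<in> carrier ?L"
      then obtain a s b t where xy: "x = loc_frac R I a s" "y = loc_frac R I b t"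
        and c: "a \<in> carrier R" "b \<in> carrier R" "s \<in> carrier R - I" "t \<in> carrier R - I"
        unfolding localization_carrier by blast
      have c': "s \<in> carrier R" "t \<in> carrier R" using c by auto
      show "x \<otimes>\<^bsub>?L\<^esub> y \<in> carrier ?L"
        unfolding xy localization_mult[OF c] using c c' D by (intro loc_frac_closed) auto
      show "x \<otimes>\<^bsub>?L\<^esub> y = y \<otimes>\<^bsub>?L\<^esub> x"
        unfolding xy localization_mult[OF c] localization_mult[OF c(2,1,4,3)]
        using c c' by (simp add: m_comm)
    next
      show "\<one>\<^bsub>?L\<^esub> \<in> carrier ?L"
        unfolding localization_one using D by (intro loc_frac_closed) auto
    next
      fix x y z assume "x \<in> carrier ?L" "y \<in> carrier ?L" "z \<in> carrier ?L"
      then obtain a s b t e v where xy: "x = loc_frac R I a s" "y = loc_frac R I b t" "z = loc_frac R I e v"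
        and c: "a \<in> carrier R" "b \<in> carrier R" "e \<in> carrier R" "s \<in> carrier R - I" "t \<in> carrier R - I"
          "v \<in> carrier R - I"
        unfolding localization_carrier by blast
      have c': "s \<in> carrier R" "t \<in> carrier R" "v \<in> carrier R" using c by auto
      show "x \<otimes>\<^bsub>?L\<^esub> y \<otimes>\<^bsub>?L\<^esub> z = x \<otimes>\<^bsub>?L\<^esub> (y \<otimes>\<^bsub>?L\<^esub> z)"
        unfolding xy using c c' by (simp add: localization_mult D m_assoc del: Diff_iff)
    next
      fix x assume "x \<in> carrier ?L"
      then obtain a s where x: "x = loc_frac R I a s" and c: "a \<in> carrier R" "s \<in> carrier R - I"
        unfolding localization_carrier by blast
      then show "\<one>\<^bsub>?L\<^esub> \<otimes>\<^bsub>?L\<^esub> x = x"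
        unfolding localization_one by (simp add: localization_mult D compl_one del: Diff_iff) simp
    qed
    fix x y z assume "x \<in> carrier ?L" "y \<in> carrier ?L" "z \<in> carrier ?L"
    then obtain a s b t e v where xy: "x = loc_frac R I a s" "y = loc_frac R I b t" "z = loc_frac R I e v"
      and c: "a \<in> carrier R" "b \<in> carrier R" "e \<in> carrier R" "s \<in> carrier R - I" "t \<in> carrier R - I"
        "v \<in> carrier R - I"
      unfolding localization_carrier by blast
    have c': "s \<in> carrier R" "t \<in> carrier R" "v \<in> carrier R" using c by auto
    have "(x \<oplus>\<^bsub>?L\<^esub> y) \<otimes>\<^bsub>?L\<^esub> z = loc_frac R I ((a \<otimes> t \<oplus> b \<otimes> s) \<otimes> e) (s \<otimes> t \<otimes> v)"
      unfolding xy using c c' by (simp add: localization_add localization_mult D del: Diff_iff)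
    moreover have "x \<otimes>\<^bsub>?L\<^esub> z \<oplus>\<^bsub>?L\<^esub> y \<otimes>\<^bsub>?L\<^esub> z =
        loc_frac R I ((a \<otimes> e) \<otimes> (t \<otimes> v) \<oplus> (b \<otimes> e) \<otimes> (s \<otimes> v)) (s \<otimes> v \<otimes> (t \<otimes> v))"
      unfolding xy using c c' by (simp add: localization_add localization_mult D del: Diff_iff)
    moreover have "((a \<otimes> t \<oplus> b \<otimes> s) \<otimes> e) \<otimes> (s \<otimes> v \<otimes> (t \<otimes> v)) =
        ((a \<otimes> e) \<otimes> (t \<otimes> v) \<oplus> (b \<otimes> e) \<otimes> (s \<otimes> v)) \<otimes> (s \<otimes> t \<otimes> v)"
      using c c' by algebra
    then have "loc_frac R I ((a \<otimes> t \<oplus> b \<otimes> s) \<otimes> e) (s \<otimes> t \<otimes> v) =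
        loc_frac R I ((a \<otimes> e) \<otimes> (t \<otimes> v) \<oplus> (b \<otimes> e) \<otimes> (s \<otimes> v)) (s \<otimes> v \<otimes> (t \<otimes> v))"
      using c c' by (intro loc_frac_eqI compl_mult) auto
    ultimately show "(x \<oplus>\<^bsub>?L\<^esub> y) \<otimes>\<^bsub>?L\<^esub> z = x \<otimes>\<^bsub>?L\<^esub> z \<oplus>\<^bsub>?L\<^esub> y \<otimes>\<^bsub>?L\<^esub> z"
      by simp
  qed
qed

lemma localization_hom: "ring_hom_cring R (localization R I) (\<lambda>a. loc_frac R I a \<one>)"
proof -
  interpret L: cring "localization R I" by (rule localization_cring)
  have "(\<lambda>a. loc_frac R I a \<one>) \<in> ring_hom R (localization R I)"
    using compl_one
    by (intro ring_hom_memI) (auto simp: loc_frac_closed localization_mult localization_add localization_one)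
  then show ?thesis
    by (intro ring_hom_cringI ring_hom_ringI2 is_cring localization_cring ring_axioms L.ring_axioms)
qed

end

section \<open>Regular sequences, depth and dimension\<close>

text \<open>The ideal I + xR in explicit form: membership hands out the decomposition on which the
  colon computations run.\<close>

definition adjoin :: "('a, 'b) ring_scheme \<Rightarrow> 'a set \<Rightarrow> 'a \<Rightarrow> 'a set" where
  "adjoin R I x = {i \<oplus>\<^bsub>R\<^esub> c \<otimes>\<^bsub>R\<^esub> x | i c. i \<in> I \<and> c \<in> carrier R}"

definition nonzerodiv_mod :: "('a, 'b) ring_scheme \<Rightarrow> 'a set \<Rightarrow> 'a \<Rightarrow> bool" where
  "nonzerodiv_mod R I x \<longleftrightarrow> (\<forall>a\<in>carrier R. a \<otimes>\<^bsub>R\<^esub> x \<in> I \<longrightarrow> a \<in> I)"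

text \<open>Regularity on R/I without the demand that the last quotient be nonzero. Unit ideals
  occur in the filtration and must count as harmless; properness reappears in
  \<open>cohen_macaulay_localI\<close>.\<close>

fun weakly_regular :: "('a, 'b) ring_scheme \<Rightarrow> 'a set \<Rightarrow> 'a list \<Rightarrow> bool" where
  "weakly_regular R I [] \<longleftrightarrow> True"
| "weakly_regular R I (x # xs) \<longleftrightarrow> nonzerodiv_mod R I x \<and> weakly_regular R (adjoin R I x) xs"

lemma adjoinI: "i \<in> I \<Longrightarrow> c \<in> carrier R \<Longrightarrow> i \<oplus>\<^bsub>R\<^esub> c \<otimes>\<^bsub>R\<^esub> x \<in> adjoin R I x"
  unfolding adjoin_def by auto

lemma adjoinE:
  assumes "y \<in> adjoin R I x"
  obtains i c where "i \<in> I" "c \<in> carrier R" "y = i \<oplus>\<^bsub>R\<^esub> c \<otimes>\<^bsub>R\<^esub> x"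
  using assms unfolding adjoin_def by auto

text \<open>Bridges the recursion, which absorbs each entry into I, and the prefix form of
  \<open>regular_sequence\<close>.\<close>

lemma weakly_regular_nth:
  "weakly_regular R I xs \<Longrightarrow> i < length xs \<Longrightarrow>
    nonzerodiv_mod R (foldl (adjoin R) I (take i xs)) (xs ! i)"
proof (induction xs arbitrary: I i)
  case (Cons x xs)
  then show ?case by (cases i) auto
qed simp

context cring
begin

lemma ideal_of_closed:
  assumes "I \<subseteq> carrier R" "\<zero> \<in> I" "\<And>a b. a \<in> I \<Longrightarrow> b \<in> I \<Longrightarrow> a \<oplus> b \<in> I"
    and "\<And>a c. a \<in> I \<Longrightarrow> c \<in> carrier R \<Longrightarrow> c \<otimes> a \<in> I"
  shows "ideal I R"
proof (rule idealI)
  show "subgroup I (add_monoid R)"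
  proof (rule add.subgroupI)
    fix a assume a: "a \<in> I"
    then have "\<ominus> a = (\<ominus> \<one>) \<otimes> a" using assms(1) by (auto simp: l_minus)
    then show "\<ominus> a \<in> I" using assms(4)[OF a, of "\<ominus> \<one>"] by simp
  qed (use assms in auto)
qed (use assms m_comm in \<open>auto simp: ring_axioms subset_iff\<close>)

lemma adjoin_ideal:
  assumes "ideal I R" and x: "x \<in> carrier R"
  shows "ideal (adjoin R I x) R"
proof -
  interpret I: ideal I R by fact
  show ?thesis
  proof (rule ideal_of_closed)
    show "adjoin R I x \<subseteq> carrier R"
      unfolding adjoin_def using x by auto
    show "\<zero> \<in> adjoin R I x"
      using adjoinI[OF I.zero_closed zero_closed, of x] x by simp
  next
    fix a b assume "a \<in> adjoin R I x" "b \<in> adjoin R I x"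
    then obtain i c j e where "i \<in> I" "c \<in> carrier R" "a = i \<oplus> c \<otimes> x" "j \<in> I" "e \<in> carrier R" "b = j \<oplus> e \<otimes> x"
      by (elim adjoinE) blast
    moreover from this have "a \<oplus> b = (i \<oplus> j) \<oplus> (c \<oplus> e) \<otimes> x"
      using x I.Icarr by algebra
    ultimately show "a \<oplus> b \<in> adjoin R I x"
      by (auto intro!: adjoinI)
  next
    fix a b assume "a \<in> adjoin R I x" and b: "b \<in> carrier R"
    then obtain i c where "i \<in> I" "c \<in> carrier R" "a = i \<oplus> c \<otimes> x"
      by (elim adjoinE)
    moreover from this have "b \<otimes> a = b \<otimes> i \<oplus> (b \<otimes> c) \<otimes> x"
      using x b I.Icarr by algebra
    ultimately show "b \<otimes> a \<in> adjoin R I x"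
      using b I.I_l_closed by (auto intro!: adjoinI)
  qed
qed

lemma adjoin_superset:
  assumes "ideal I R" and x: "x \<in> carrier R"
  shows "I \<subseteq> adjoin R I x" "x \<in> adjoin R I x"
proof -
  interpret I: ideal I R by fact
  show "I \<subseteq> adjoin R I x"
  proof
    fix i assume "i \<in> I"
    then show "i \<in> adjoin R I x"
      using adjoinI[of i I \<zero> R x] x I.Icarr by simp
  qed
  show "x \<in> adjoin R I x"
    using adjoinI[of \<zero> I \<one> R x] x I.zero_closed by simp
qed

lemma adjoin_minimal:
  assumes "ideal J R" "I \<subseteq> J" "x \<in> J"
  shows "adjoin R I x \<subseteq> J"
proof -
  interpret J: ideal J R by fact
  show ?thesis unfolding adjoin_def using assms J.I_l_closed by auto
qed

lemma foldl_adjoin_ideal: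
  assumes "ideal I R" "set xs \<subseteq> carrier R"
  shows "ideal (foldl (adjoin R) I xs) R \<and> I \<union> set xs \<subseteq> foldl (adjoin R) I xs"
  using assms(2)
proof (induction xs rule: rev_induct)
  case Nil
  then show ?case using assms(1) by simp
next
  case (snoc x xs)
  then have "ideal (foldl (adjoin R) I xs) R" "I \<union> set xs \<subseteq> foldl (adjoin R) I xs" "x \<in> carrier R" by auto
  then show ?case
    using adjoin_ideal adjoin_superset by simp blast
qed

text \<open>Among the ideals above I that miss T, a maximal one Q is prime: for a, b outside Q, both
  Q + aR and Q + bR meet T, and the product of the two common elements lies in T. If ab were in Q,
  that product would lie in Q as well.\<close>

lemma exists_prime_avoiding:
  assumes "noetherian_ring R" and I: "ideal I R"
    and T: "T \<subseteq> carrier R" "\<one> \<in> T" "\<And>s t. s \<in> T \<Longrightarrow> t \<in> T \<Longrightarrow> s \<otimes> t \<in> T" and "I \<inter> T = {}"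
  shows "\<exists>Q. primeideal Q R \<and> I \<subseteq> Q \<and> Q \<inter> T = {}"
proof -
  let ?A = "{J. ideal J R \<and> I \<subseteq> J \<and> J \<inter> T = {}}"
  have "\<exists>Q\<in>?A. \<forall>J\<in>?A. Q \<subseteq> J \<longrightarrow> J = Q"
  proof (rule subset_Zorn_nonempty)
    show "?A \<noteq> {}" using assms by auto
  next
    fix C assume C: "C \<noteq> {}" "subset.chain ?A C"
    then have "subset.chain {J. ideal J R} C"
      unfolding subset.chain_def by auto
    \<comment> \<open>Over a noetherian ring a nonempty chain of ideals contains its own union,
      which therefore misses T like every member.\<close>
    with noetherian_ring.ideal_chain_is_trivial[OF assms(1) C(1)] have "\<Union>C \<in> C" by simp
    with C show "\<Union>C \<in> ?A"
      unfolding subset.chain_def by auto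
  qed
  then obtain Q where Q: "ideal Q R" "I \<subseteq> Q" "Q \<inter> T = {}"
    and max: "\<And>J. ideal J R \<Longrightarrow> I \<subseteq> J \<Longrightarrow> J \<inter> T = {} \<Longrightarrow> Q \<subseteq> J \<Longrightarrow> J = Q"
    by auto
  interpret Q: ideal Q R by fact
  have *: "\<exists>t\<in>T. \<exists>q\<in>Q. \<exists>c\<in>carrier R. t = q \<oplus> c \<otimes> a" if a: "a \<in> carrier R" "a \<notin> Q" for a
  proof -
    have "adjoin R Q a \<inter> T \<noteq> {}"
      using max[of "adjoin R Q a"] adjoin_ideal[OF Q(1) a(1)] adjoin_superset[OF Q(1) a(1)] Q a by blast
    then show ?thesis unfolding adjoin_def by blast
  qed
  have "primeideal Q R"
  proof (rule primeidealI[OF Q(1) is_cring])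
    show "carrier R \<noteq> Q" using T Q by blast
  next
    fix a b assume ab: "a \<in> carrier R" "b \<in> carrier R" "a \<otimes> b \<in> Q"
    show "a \<in> Q \<or> b \<in> Q"
    proof (rule ccontr)
      assume "\<not> (a \<in> Q \<or> b \<in> Q)"
      then obtain t q c t' q' c' where t: "t \<in> T" "q \<in> Q" "c \<in> carrier R" "t = q \<oplus> c \<otimes> a"
        and t': "t' \<in> T" "q' \<in> Q" "c' \<in> carrier R" "t' = q' \<oplus> c' \<otimes> b"
        using *[of a] *[of b] ab by blast
      have "t \<otimes> t' = (q' \<oplus> c' \<otimes> b) \<otimes> q \<oplus> (c \<otimes> a) \<otimes> q' \<oplus> (c \<otimes> c') \<otimes> (a \<otimes> b)"
        unfolding t t' using t(2,3) t'(2,3) ab Q.Icarr by algebra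
      also have "\<dots> \<in> Q"
        using t(2,3) t'(2,3) ab by (intro Q.a_closed) (auto intro: Q.I_l_closed)
      finally show False using T(3)[OF t(1) t'(1)] Q by blast
    qed
  qed
  then show ?thesis using Q by blast
qed

text \<open>The set of all s x^k with s outside P is multiplicative and misses I, since x can be
  cancelled modulo I and I lies in P. A prime above I that misses this set lies in P (take k = 0)
  and omits x (take s = 1, k = 1).\<close>

lemma smaller_prime:
  assumes "noetherian_ring R" and I: "ideal I R" and P: "primeideal P R" "I \<subseteq> P"
    and x: "x \<in> P" "nonzerodiv_mod R I x"
  shows "\<exists>Q. primeideal Q R \<and> I \<subseteq> Q \<and> Q \<subset> P"
proof -
  interpret P: primeideal P R by fact
  have xc: "x \<in> carrier R" using x(1) by (rule P.Icarr)
  let ?T = "{s \<otimes> x [^] k | s k. s \<in> carrier R - P \<and> (k::nat) \<in> UNIV}"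
  have notin: "s \<otimes> x [^] k \<notin> I" if "s \<in> carrier R - P" for s and k :: nat
  proof (induction k)
    case 0
    then show ?case using that P by auto
  next
    case (Suc k)
    have "s \<otimes> x [^] Suc k = (s \<otimes> x [^] k) \<otimes> x" using that xc by (simp add: m_assoc)
    moreover have "s \<otimes> x [^] k \<in> carrier R" using that xc by simp
    ultimately show ?case using Suc x(2) unfolding nonzerodiv_mod_def by auto
  qed
  have "\<exists>Q. primeideal Q R \<and> I \<subseteq> Q \<and> Q \<inter> ?T = {}"
  proof (rule exists_prime_avoiding[OF assms(1) I])
    show "?T \<subseteq> carrier R" using xc by auto
    show "\<one> \<in> ?T" using P.compl_one by (auto intro!: exI[of _ \<one>] exI[of _ "0::nat"])
    show "I \<inter> ?T = {}" using notin by auto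
    fix s t assume "s \<in> ?T" "t \<in> ?T"
    then obtain a k b l where "s = a \<otimes> x [^] (k::nat)" "t = b \<otimes> x [^] (l::nat)"
      and ab: "a \<in> carrier R - P" "b \<in> carrier R - P" by auto
    moreover have "(a \<otimes> x [^] k) \<otimes> (b \<otimes> x [^] l) = (a \<otimes> b) \<otimes> (x [^] k \<otimes> x [^] l)"
      using ab xc by (simp add: m_ac)
    ultimately have "s \<otimes> t = (a \<otimes> b) \<otimes> x [^] (k + l)"
      using xc by (simp add: nat_pow_mult)
    then show "s \<otimes> t \<in> ?T" using P.compl_mult[OF ab] by blast
  qed
  then obtain Q where Q: "primeideal Q R" "I \<subseteq> Q" "Q \<inter> ?T = {}" by blast
  interpret Q: primeideal Q R by fact
  have "s \<notin> Q" if "s \<in> carrier R - P" for s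
  proof -
    have "s \<otimes> x [^] (0::nat) \<in> ?T" using that by blast
    then show ?thesis using Q that by auto
  qed
  then have "Q \<subseteq> P" using Q.Icarr by blast
  moreover have "x \<notin> Q"
  proof -
    have "\<one> \<otimes> x [^] (1::nat) \<in> ?T" using P.compl_one by blast
    then show ?thesis using Q xc by auto
  qed
  ultimately show ?thesis using Q x by blast
qed

text \<open>Built downwards from P: the last entry is a nonzerodivisor modulo its predecessors, so a
  strictly smaller prime still contains those, and the remaining entries give a chain that ends
  there.\<close>

lemma prime_chain_of_regular:
  assumes "noetherian_ring R" "primeideal P R" "set xs \<subseteq> P"
    and "\<And>i. i < length xs \<Longrightarrow> nonzerodiv_mod R (Idl (set (take i xs))) (xs ! i)"
  shows "\<exists>Q. (\<forall>i\<le>length xs. primeideal (Q i) R) \<and> (\<forall>i<length xs. Q i \<subset> Q (Suc i)) \<and> Q (length xs) = P"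
  using assms(2-)
proof (induction xs arbitrary: P rule: rev_induct)
  case Nil
  then show ?case by (intro exI[of _ "\<lambda>_. P"]) simp
next
  case (snoc x xs)
  interpret P: primeideal P R by fact
  have xs: "set xs \<subseteq> carrier R" using snoc.prems P.Icarr by auto
  have "nonzerodiv_mod R (Idl (set xs)) x"
    using snoc.prems(3)[of "length xs"] by simp
  moreover have "Idl (set xs) \<subseteq> P"
    using snoc.prems by (intro genideal_minimal P.is_ideal) auto
  ultimately obtain P' where P': "primeideal P' R" "Idl (set xs) \<subseteq> P'" "P' \<subset> P"
    using smaller_prime[OF assms(1) genideal_ideal[OF xs] snoc.prems(1), of x] snoc.prems(2) that by auto
  have "nonzerodiv_mod R (Idl (set (take i xs))) (xs ! i)" if "i < length xs" for i
    using snoc.prems(3)[of i] that by (simp add: nth_append)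
  then obtain Q where Q: "\<And>i. i \<le> length xs \<Longrightarrow> primeideal (Q i) R" "\<And>i. i < length xs \<Longrightarrow> Q i \<subset> Q (Suc i)"
    "Q (length xs) = P'"
    using snoc.IH[OF P'(1)] P'(2) genideal_self[OF xs] by blast
  let ?Q = "Q(Suc (length xs) := P)"
  have "primeideal (?Q i) R" if "i \<le> length (xs @ [x])" for i
    using that Q(1) snoc.prems(1) by auto
  moreover have "?Q i \<subset> ?Q (Suc i)" if "i < length (xs @ [x])" for i
    using that Q(2)[of i] Q(3) P'(3) by (cases "i = length xs") auto
  ultimately show ?case by (intro exI[of _ ?Q]) simp
qed

lemma depth_le_krull_dim:
  assumes "noetherian_ring R" "primeideal P R"
  shows "depth R P \<le> krull_dim R"
  unfolding depth_def
proof (rule Sup_least)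
  fix y assume "y \<in> {enat (length xs) | xs. regular_sequence R xs \<and> set xs \<subseteq> P}"
  then obtain xs where y: "y = enat (length xs)" and xs: "regular_sequence R xs" "set xs \<subseteq> P" by blast
  have "\<exists>Q. (\<forall>i\<le>length xs. primeideal (Q i) R) \<and> (\<forall>i<length xs. Q i \<subset> Q (Suc i)) \<and> Q (length xs) = P"
    using xs by (intro prime_chain_of_regular assms) (auto simp: regular_sequence_def nonzerodiv_mod_def)
  then show "y \<le> krull_dim R"
    unfolding krull_dim_def y by (intro Sup_upper) blast
qed

end

text \<open>This covers both \<open>R \<rightarrow> R/I\<close>, where \<open>U = {1}\<close>, and \<open>R \<rightarrow> (R/I)\<^sub>M\<close>.\<close>

locale fraction_hom = ring_hom_cring R S h for R (structure) and S (structure) and h +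
  fixes U and I
  assumes I_ideal: "ideal I R"
    and h_I: "a \<in> I \<Longrightarrow> h a = \<zero>\<^bsub>S\<^esub>"
    and U_carrier: "U \<subseteq> carrier R"
    and U_one: "\<one>\<^bsub>R\<^esub> \<in> U"
    and U_mult: "s \<in> U \<Longrightarrow> t \<in> U \<Longrightarrow> s \<otimes>\<^bsub>R\<^esub> t \<in> U"
    and h_unit: "s \<in> U \<Longrightarrow> h s \<in> Units S"
    and h_frac: "b \<in> carrier S \<Longrightarrow> \<exists>a\<in>carrier R. \<exists>s\<in>U. b \<otimes>\<^bsub>S\<^esub> h s = h a"
    and h_ker: "a \<in> carrier R \<Longrightarrow> h a = \<zero>\<^bsub>S\<^esub> \<Longrightarrow> \<exists>u\<in>U. u \<otimes>\<^bsub>R\<^esub> a \<in> I"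
begin

lemma hom_ring: "ring_hom_ring R S h"
  by (intro ring_hom_ringI2 R.ring_axioms S.ring_axioms homh)

lemma hom_diff_zero:
  assumes "a \<in> carrier R" "e \<in> carrier R" "h a = h e"
  shows "h (a \<ominus> e) = \<zero>\<^bsub>S\<^esub>"
proof -
  have "h (a \<ominus> e) = h a \<oplus>\<^bsub>S\<^esub> \<ominus>\<^bsub>S\<^esub> h e"
    unfolding a_minus_def using assms(1,2) by simp
  then show ?thesis unfolding assms(3) using S.r_neg[of "h e"] assms(2) by simp
qed

lemma unit_cancel:
  assumes "ideal K S" "x \<in> carrier S" "s \<in> U" "x \<otimes>\<^bsub>S\<^esub> h s \<in> K"
  shows "x \<in> K"
proof -
  interpret K: ideal K S by fact
  have u: "h s \<in> Units S" using h_unit assms by blast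
  have "x = inv\<^bsub>S\<^esub> (h s) \<otimes>\<^bsub>S\<^esub> (x \<otimes>\<^bsub>S\<^esub> h s)"
    using u assms(2) by (metis S.Units_closed S.Units_inv_closed S.Units_l_inv S.l_one S.m_assoc S.m_comm)
  then show ?thesis using K.I_l_closed[OF assms(4), of "inv\<^bsub>S\<^esub> (h s)"] u by simp
qed

lemma contraction_ideal: "ideal K S \<Longrightarrow> ideal {r \<in> carrier R. h r \<in> K} R"
  by (rule ring_hom_ring.ideal_vimage[OF hom_ring])

text \<open>Every b in S is some h a up to a unit h s, so an ideal of S is determined by its
  contraction. Hence strict chains in S contract to strict chains, and generators of the contraction
  generate the ideal.\<close>

lemma contraction_subset_cancel:
  assumes "ideal K S" "ideal L S" "{r \<in> carrier R. h r \<in> L} \<subseteq> {r \<in> carrier R. h r \<in> K}"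
  shows "L \<subseteq> K"
proof
  interpret L: ideal L S by fact
  fix b assume b: "b \<in> L"
  then obtain a s where as: "a \<in> carrier R" "s \<in> U" "b \<otimes>\<^bsub>S\<^esub> h s = h a"
    using h_frac L.Icarr by blast
  then have "h a \<in> L" using b L.I_r_closed U_carrier by (metis hom_closed subsetD)
  then have "b \<otimes>\<^bsub>S\<^esub> h s \<in> K" using assms(3) as by auto
  then show "b \<in> K" using unit_cancel[OF assms(1)] b L.Icarr as by blast
qed

lemma noetherian_image:
  assumes "noetherian_ring R"
  shows "noetherian_ring S"
proof (rule S.noetherian_ringI)
  fix K assume K: "ideal K S"
  interpret K: ideal K S by fact
  let ?K = "{r \<in> carrier R. h r \<in> K}"
  obtain A where A: "A \<subseteq> carrier R" "finite A" "?K = Idl\<^bsub>R\<^esub> A"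
    using noetherian_ring.finetely_gen[OF assms contraction_ideal[OF K]] by blast
  have hA: "h ` A \<subseteq> carrier S" using A by auto
  have "A \<subseteq> ?K" using A R.genideal_self by blast
  then have "Idl\<^bsub>S\<^esub> (h ` A) \<subseteq> K"
    by (intro S.genideal_minimal[OF K]) auto
  moreover have "K \<subseteq> Idl\<^bsub>S\<^esub> (h ` A)"
  proof (rule contraction_subset_cancel[OF S.genideal_ideal[OF hA] K])
    have "ideal {r \<in> carrier R. h r \<in> Idl\<^bsub>S\<^esub> (h ` A)} R"
      by (rule contraction_ideal[OF S.genideal_ideal[OF hA]])
    then have "Idl\<^bsub>R\<^esub> A \<subseteq> {r \<in> carrier R. h r \<in> Idl\<^bsub>S\<^esub> (h ` A)}"
      using A S.genideal_self[OF hA] by (intro R.genideal_minimal) auto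
    then show "?K \<subseteq> {r \<in> carrier R. h r \<in> Idl\<^bsub>S\<^esub> (h ` A)}" using A(3) by simp
  qed
  ultimately show "\<exists>A\<subseteq>carrier S. finite A \<and> K = Idl\<^bsub>S\<^esub> A"
    using A hA by (intro exI[of _ "h ` A"]) auto
qed

lemma krull_dim_le:
  assumes "\<And>k Q. (\<forall>i\<le>k. primeideal (Q i) R) \<Longrightarrow> (\<forall>i<k. Q i \<subset> Q (Suc i)) \<Longrightarrow> I \<subseteq> Q 0 \<Longrightarrow> k \<le> d"
  shows "krull_dim S \<le> enat d"
  unfolding krull_dim_def
proof (rule Sup_least)
  fix y assume "y \<in> {enat k | k. \<exists>Q :: nat \<Rightarrow> _. (\<forall>i\<le>k. primeideal (Q i) S) \<and> (\<forall>i<k. Q i \<subset> Q (Suc i))}"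
  then obtain k Q where y: "y = enat k" and Q: "\<And>i. i \<le> k \<Longrightarrow> primeideal (Q i) S" "\<And>i. i < k \<Longrightarrow> Q i \<subset> Q (Suc i)"
    by blast
  let ?Q = "\<lambda>i. {r \<in> carrier R. h r \<in> Q i}"
  have "k \<le> d"
  proof (rule assms[of k ?Q])
    show "\<forall>i\<le>k. primeideal (?Q i) R"
      using Q ring_hom_ring.primeideal_vimage[OF hom_ring R.is_cring] by blast
    show "\<forall>i<k. ?Q i \<subset> ?Q (Suc i)"
    proof (intro allI impI)
      fix i assume i: "i < k"
      then have "ideal (Q i) S" "ideal (Q (Suc i)) S"
        using Q(1)[of i] Q(1)[of "Suc i"] by (auto intro: primeideal.axioms)
      then have "\<not> ?Q (Suc i) \<subseteq> ?Q i" using Q(2)[OF i] contraction_subset_cancel[of "Q i" "Q (Suc i)"] by blast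
      moreover have "?Q i \<subseteq> ?Q (Suc i)" using Q(2)[OF i] by auto
      ultimately show "?Q i \<subset> ?Q (Suc i)" by blast
    qed
    have "ideal (Q 0) S" using Q(1)[of 0] by (auto intro: primeideal.axioms)
    then have "\<zero>\<^bsub>S\<^esub> \<in> Q 0" by (simp add: ideal_def additive_subgroup.zero_closed)
    then show "I \<subseteq> ?Q 0"
      using h_I ideal.Icarr[OF I_ideal] by auto
  qed
  then show "y \<le> enat d" unfolding y by simp
qed

text \<open>For an ideal Q this is the ideal generated by its image, with denominators cleared at
  once: membership yields a single equation instead of a linear combination.\<close>

definition "extension Q = {b \<in> carrier S. \<exists>s\<in>U. \<exists>a\<in>Q. b \<otimes>\<^bsub>S\<^esub> h s = h a}"

lemma extensionI:
  "b \<in> carrier S \<Longrightarrow> s \<in> U \<Longrightarrow> a \<in> Q \<Longrightarrow> b \<otimes>\<^bsub>S\<^esub> h s = h a \<Longrightarrow> b \<in> extension Q"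
  unfolding extension_def by blast

lemma extensionE:
  assumes "b \<in> extension Q"
  obtains s a where "b \<in> carrier S" "s \<in> U" "a \<in> Q" "b \<otimes>\<^bsub>S\<^esub> h s = h a"
  using assms unfolding extension_def by blast

lemma image_extension:
  assumes "ideal Q R" "x \<in> Q"
  shows "h x \<in> extension Q"
proof -
  have x: "x \<in> carrier R" using ideal.Icarr[OF assms(1)] assms(2) by blast
  show ?thesis
  proof (rule extensionI[OF hom_closed[OF x] U_one assms(2)])
    show "h x \<otimes>\<^bsub>S\<^esub> h \<one> = h x" using x by simp
  qed
qed

lemma extension_ideal:
  assumes Q: "ideal Q R"
  shows "ideal (extension Q) S"
proof -
  interpret Q: ideal Q R by fact
  show ?thesis
  proof (rule S.ideal_of_closed)
    show "extension Q \<subseteq> carrier S" unfolding extension_def by blast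
    show "\<zero>\<^bsub>S\<^esub> \<in> extension Q"
      using image_extension[OF Q Q.zero_closed] by simp
  next
    fix b c assume "b \<in> extension Q" "c \<in> extension Q"
    then obtain s a t e where *: "b \<in> carrier S" "s \<in> U" "a \<in> Q" "b \<otimes>\<^bsub>S\<^esub> h s = h a"
      "c \<in> carrier S" "t \<in> U" "e \<in> Q" "c \<otimes>\<^bsub>S\<^esub> h t = h e" by (elim extensionE) blast
    have c: "s \<in> carrier R" "t \<in> carrier R" "a \<in> carrier R" "e \<in> carrier R"
      using * U_carrier Q.Icarr by auto
    then have c': "h s \<in> carrier S" "h t \<in> carrier S" by auto
    have "(b \<oplus>\<^bsub>S\<^esub> c) \<otimes>\<^bsub>S\<^esub> (h s \<otimes>\<^bsub>S\<^esub> h t) = (b \<otimes>\<^bsub>S\<^esub> h s) \<otimes>\<^bsub>S\<^esub> h t \<oplus>\<^bsub>S\<^esub> (c \<otimes>\<^bsub>S\<^esub> h t) \<otimes>\<^bsub>S\<^esub> h s"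
      using *(1,5) c' by algebra
    then have eq: "(b \<oplus>\<^bsub>S\<^esub> c) \<otimes>\<^bsub>S\<^esub> h (s \<otimes> t) = h (a \<otimes> t \<oplus> e \<otimes> s)"
      using * c by simp
    show "b \<oplus>\<^bsub>S\<^esub> c \<in> extension Q"
    proof (rule extensionI[OF _ U_mult _ eq])
      show "a \<otimes> t \<oplus> e \<otimes> s \<in> Q"
        using * c by (intro Q.a_closed Q.I_r_closed)
    qed (use * in auto)
  next
    fix b c assume "b \<in> extension Q" and cS: "c \<in> carrier S"
    then obtain s a where *: "b \<in> carrier S" "s \<in> U" "a \<in> Q" "b \<otimes>\<^bsub>S\<^esub> h s = h a" by (elim extensionE)
    obtain e t where **: "e \<in> carrier R" "t \<in> U" "c \<otimes>\<^bsub>S\<^esub> h t = h e" using h_frac cS by blast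
    have c: "s \<in> carrier R" "t \<in> carrier R" "a \<in> carrier R"
      using * ** U_carrier Q.Icarr by auto
    then have c': "h s \<in> carrier S" "h t \<in> carrier S" by auto
    have "(c \<otimes>\<^bsub>S\<^esub> b) \<otimes>\<^bsub>S\<^esub> (h s \<otimes>\<^bsub>S\<^esub> h t) = (c \<otimes>\<^bsub>S\<^esub> h t) \<otimes>\<^bsub>S\<^esub> (b \<otimes>\<^bsub>S\<^esub> h s)"
      using *(1) cS c' by algebra
    then have eq: "(c \<otimes>\<^bsub>S\<^esub> b) \<otimes>\<^bsub>S\<^esub> h (s \<otimes> t) = h (e \<otimes> a)"
      using * ** c by simp
    show "c \<otimes>\<^bsub>S\<^esub> b \<in> extension Q"
      using * ** cS by (intro extensionI[OF _ U_mult _ eq] Q.I_l_closed) auto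
  qed
qed

text \<open>An equation in S lifts to R only modulo I and up to a factor from U, whence the u. With
  it, regularity of the images in S can be checked in R.\<close>

lemma genideal_image_iff:
  assumes xs: "set xs \<subseteq> carrier R" and a: "a \<in> carrier R"
  shows "h a \<in> Idl\<^bsub>S\<^esub> (h ` set xs) \<longleftrightarrow> (\<exists>u\<in>U. u \<otimes> a \<in> foldl (adjoin R) I xs)"
proof -
  let ?Q = "foldl (adjoin R) I xs" and ?G = "Idl\<^bsub>S\<^esub> (h ` set xs)"
  have Q: "ideal ?Q R" "I \<subseteq> ?Q" "set xs \<subseteq> ?Q"
    using R.foldl_adjoin_ideal[OF I_ideal xs] by auto
  interpret Q: ideal ?Q R by fact
  have hxs: "h ` set xs \<subseteq> carrier S" using xs by auto
  interpret G: ideal ?G S by (rule S.genideal_ideal[OF hxs])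
  show ?thesis
  proof
    let ?K = "extension ?Q"
    have "ideal ?K S" by (rule extension_ideal[OF Q(1)])
    moreover have "h ` set xs \<subseteq> ?K"
      using xs Q image_extension by blast
    ultimately have GK: "?G \<subseteq> ?K" by (rule S.genideal_minimal)
    assume "h a \<in> ?G"
    then obtain s e where se: "s \<in> U" "e \<in> ?Q" "h a \<otimes>\<^bsub>S\<^esub> h s = h e" using GK unfolding extension_def by blast
    have c: "s \<in> carrier R" "e \<in> carrier R" using se U_carrier Q.Icarr by auto
    have "h (a \<otimes> s \<ominus> e) = \<zero>\<^bsub>S\<^esub>"
      using se c a by (intro hom_diff_zero) auto
    then obtain u where u: "u \<in> U" "u \<otimes> (a \<otimes> s \<ominus> e) \<in> I"
      using h_ker[of "a \<otimes> s \<ominus> e"] c a by auto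
    have uc: "u \<in> carrier R" using u U_carrier by auto
    have "(u \<otimes> s) \<otimes> a = u \<otimes> (a \<otimes> s \<ominus> e) \<oplus> u \<otimes> e"
      using uc c a by algebra
    also have "\<dots> \<in> ?Q"
      using u Q uc se by (intro Q.a_closed Q.I_l_closed[OF se(2)]) auto
    finally show "\<exists>u\<in>U. u \<otimes> a \<in> ?Q" using u se U_mult by blast
  next
    assume "\<exists>u\<in>U. u \<otimes> a \<in> ?Q"
    then obtain u where u: "u \<in> U" "u \<otimes> a \<in> ?Q" by blast
    have "foldl (adjoin R) I ys \<subseteq> {r \<in> carrier R. h r \<in> ?G}" if "set ys \<subseteq> set xs" for ys
      using that
    proof (induction ys rule: rev_induct)
      case Nil
      then show ?case using h_I ideal.Icarr[OF I_ideal] G.zero_closed by auto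
    next
      case (snoc y ys)
      have "y \<in> {r \<in> carrier R. h r \<in> ?G}"
        using snoc.prems xs S.genideal_self[OF hxs] by auto
      then show ?case
        using snoc R.adjoin_minimal[OF contraction_ideal[OF G.is_ideal]] by simp
    qed
    then have "h (u \<otimes> a) \<in> ?G" using u by auto
    moreover have "u \<in> carrier R" using u U_carrier by auto
    then have "h (u \<otimes> a) = h a \<otimes>\<^bsub>S\<^esub> h u" using a S.m_comm[of "h a" "h u"] by simp
    ultimately have "h a \<otimes>\<^bsub>S\<^esub> h u \<in> ?G" by simp
    then show "h a \<in> ?G" by (rule unit_cancel[OF G.is_ideal hom_closed[OF a] u(1)])
  qed
qed

text \<open>Elements outside the extension of P are units, so S is local. The images of xs lie in
  the maximal ideal and therefore generate a proper ideal, which is what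
  \<open>weakly_regular\<close> leaves open.\<close>

lemma cohen_macaulay_localI:
  assumes noeth: "noetherian_ring R"
    and chains: "\<And>k Q. (\<forall>i\<le>k. primeideal (Q i) R) \<Longrightarrow> (\<forall>i<k. Q i \<subset> Q (Suc i)) \<Longrightarrow> I \<subseteq> Q 0 \<Longrightarrow> k \<le> d"
    and P: "primeideal P R" "I \<subseteq> P" and U: "U = carrier R - P"
    and xs: "set xs \<subseteq> P" "length xs = d" "weakly_regular R I xs"
  shows "cohen_macaulay_local S"
proof -
  interpret P: primeideal P R by fact
  let ?M = "extension P"
  have M_unit: "b \<in> Units S" if b: "b \<in> carrier S" "b \<notin> ?M" for b
  proof -
    obtain a s where as: "a \<in> carrier R" "s \<in> U" "b \<otimes>\<^bsub>S\<^esub> h s = h a" using h_frac[OF b(1)] by blast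
    then have "a \<in> U" using b U unfolding extension_def by blast
    then have "b \<otimes>\<^bsub>S\<^esub> h s \<in> Units S" using as h_unit by simp
    then show ?thesis
      using S.unit_factor[OF _ b(1), of "h s"] as(2) U_carrier by blast
  qed
  interpret M: ideal ?M S by (rule extension_ideal[OF P.is_ideal])
  \<comment> \<open>If 1 were a fraction a/s with a in P, then u (s - a) would lie in I for some u
    in U, hence in P, and s would lie in P.\<close>
  have one: "\<one>\<^bsub>S\<^esub> \<notin> ?M"
  proof
    assume "\<one>\<^bsub>S\<^esub> \<in> ?M"
    then obtain s a where *: "s \<in> U" "a \<in> P" "h s = h a" using U_carrier unfolding extension_def by auto
    then have c: "s \<in> carrier R" "a \<in> carrier R" using U_carrier P.Icarr by auto
    then have "h (s \<ominus> a) = \<zero>\<^bsub>S\<^esub>" using * by (intro hom_diff_zero)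
    moreover have sa: "s \<ominus> a \<in> carrier R" using c by simp
    ultimately obtain u where u: "u \<in> U" "u \<otimes> (s \<ominus> a) \<in> P" using h_ker[OF sa] P(2) by blast
    then have "s \<ominus> a \<in> P" using P.I_prime[OF _ sa u(2)] U by blast
    then have "(s \<ominus> a) \<oplus> a \<in> P" using * by (intro P.a_closed)
    moreover have "(s \<ominus> a) \<oplus> a = s" using c by algebra
    ultimately show False using * U by simp
  qed
  have proper: "K \<subseteq> ?M" if K: "ideal K S" "K \<noteq> carrier S" for K
  proof
    fix b assume b: "b \<in> K"
    then have bc: "b \<in> carrier S" using ideal.Icarr[OF K(1)] by blast
    show "b \<in> ?M"
    proof (rule ccontr)
      assume "b \<notin> ?M"
      then have "b \<in> Units S" by (rule M_unit[OF bc])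
      then have "\<one>\<^bsub>S\<^esub> \<in> K"
        using ideal.I_l_closed[OF K(1) b, of "inv\<^bsub>S\<^esub> b"] by simp
      then show False using K ideal.one_imp_carrier by blast
    qed
  qed
  have M_proper: "?M \<subseteq> carrier S" "?M \<noteq> carrier S"
    using one M.a_subset by auto
  have maxM: "maximalideal ?M S"
  proof (rule maximalidealI[OF M.is_ideal])
    show "carrier S \<noteq> ?M" using M_proper by simp
    fix J assume "ideal J S" "?M \<subseteq> J" "J \<subseteq> carrier S"
    then show "J = ?M \<or> J = carrier S" using proper[of J] by blast
  qed
  have uniq: "K = ?M" if "maximalideal K S" for K
  proof -
    have K: "ideal K S" "K \<noteq> carrier S"
      using that by (auto simp: maximalideal_def maximalideal_axioms_def)
    then show ?thesis
      using maximalideal.I_maximal[OF that M.is_ideal proper[OF K] M_proper(1)] M_proper(2) by blast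
  qed
  have noethS: "noetherian_ring S" by (rule noetherian_image[OF noeth])
  have xsc: "set xs \<subseteq> carrier R" using xs P.Icarr by auto
  have hM: "h x \<in> ?M" if "x \<in> P" for x
    by (rule image_extension[OF P.is_ideal that])
  have reg: "regular_sequence S (map h xs)"
    unfolding regular_sequence_def
  proof (intro conjI allI impI ballI)
    show "set (map h xs) \<subseteq> carrier S" using xsc by auto
    have "Idl\<^bsub>S\<^esub> (set (map h xs)) \<subseteq> ?M"
      using hM xs by (intro S.genideal_minimal M.is_ideal) auto
    then show "Idl\<^bsub>S\<^esub> (set (map h xs)) \<noteq> carrier S" using one by auto
  next
    fix i b assume i: "i < length (map h xs)" and b: "b \<in> carrier S"
      and bx: "b \<otimes>\<^bsub>S\<^esub> map h xs ! i \<in> Idl\<^bsub>S\<^esub> (set (take i (map h xs)))"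
    let ?ys = "take i xs"
    have i': "i < length xs" using i by simp
    have ys: "set ?ys \<subseteq> carrier R" using xsc by (meson order_trans set_take_subset)
    have x: "xs ! i \<in> carrier R" using i xsc by auto
    interpret Q: ideal "foldl (adjoin R) I ?ys" R using R.foldl_adjoin_ideal[OF I_ideal ys] by blast
    have e: "set (take i (map h xs)) = h ` set ?ys" by (simp add: take_map)
    have hys: "h ` set ?ys \<subseteq> carrier S" using ys by auto
    interpret G: ideal "Idl\<^bsub>S\<^esub> (h ` set ?ys)" S by (rule S.genideal_ideal[OF hys])
    obtain a s where as: "a \<in> carrier R" "s \<in> U" "b \<otimes>\<^bsub>S\<^esub> h s = h a" using h_frac[OF b] by blast
    have sc: "s \<in> carrier R" using as U_carrier by auto
    have bx': "b \<otimes>\<^bsub>S\<^esub> h (xs ! i) \<in> Idl\<^bsub>S\<^esub> (h ` set ?ys)"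
      using bx i' e by simp
    have hc: "h s \<in> carrier S" "h (xs ! i) \<in> carrier S" using sc x by simp_all
    \<comment> \<open>Clearing the denominator replaces b by h a. The factor u that arises on the
      way back to R does no harm: weak regularity is applied to u a.\<close>
    have "h s \<otimes>\<^bsub>S\<^esub> (b \<otimes>\<^bsub>S\<^esub> h (xs ! i)) = (b \<otimes>\<^bsub>S\<^esub> h s) \<otimes>\<^bsub>S\<^esub> h (xs ! i)"
      using b hc by algebra
    also have "\<dots> = h (a \<otimes> xs ! i)" unfolding as(3) using as(1) x by simp
    finally have "h (a \<otimes> xs ! i) \<in> Idl\<^bsub>S\<^esub> (h ` set ?ys)"
      using G.I_l_closed[OF bx' hc(1)] by simp
    moreover have ax: "a \<otimes> xs ! i \<in> carrier R" using as(1) x by simp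
    ultimately obtain u where u: "u \<in> U" "u \<otimes> (a \<otimes> xs ! i) \<in> foldl (adjoin R) I ?ys"
      using genideal_image_iff[OF ys ax] by blast
    have uc: "u \<in> carrier R" using u U_carrier by blast
    have "(u \<otimes> a) \<otimes> xs ! i \<in> foldl (adjoin R) I ?ys"
      using u(2) R.m_assoc[OF uc as(1) x] by simp
    moreover have "u \<otimes> a \<in> carrier R" using uc as(1) by simp
    ultimately have "u \<otimes> a \<in> foldl (adjoin R) I ?ys"
      using weakly_regular_nth[OF xs(3) i'] unfolding nonzerodiv_mod_def by blast
    then have "h a \<in> Idl\<^bsub>S\<^esub> (h ` set ?ys)"
      using genideal_image_iff[OF ys as(1)] u by blast
    then show "b \<in> Idl\<^bsub>S\<^esub> (set (take i (map h xs)))"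
      unfolding e using unit_cancel[OF G.is_ideal b as(2)] as by simp
  qed
  have "enat d \<le> depth S ?M"
    unfolding depth_def
  proof (rule Sup_upper)
    have "set (map h xs) \<subseteq> ?M" using hM xs by auto
    then show "enat d \<in> {enat (length ys) | ys. regular_sequence S ys \<and> set ys \<subseteq> ?M}"
      using reg xs(2) by (intro CollectI exI[of _ "map h xs"]) simp
  qed
  moreover have "depth S ?M \<le> krull_dim S"
    by (rule S.depth_le_krull_dim[OF noethS S.maximalideal_prime[OF maxM]])
  moreover have "krull_dim S \<le> enat d" by (rule krull_dim_le[OF chains])
  ultimately have eq: "depth S ?M = krull_dim S" by (meson antisym order_trans)
  show ?thesis
    unfolding cohen_macaulay_local_def
  proof (intro conjI S.is_cring noethS ex1I allI impI)
    show "maximalideal ?M S" by (rule maxM)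
    show "K = ?M" if "maximalideal K S" for K by (rule uniq[OF that])
    show "depth S K = krull_dim S" if "maximalideal K S" for K
      unfolding uniq[OF that] by (rule eq)
  qed
qed

end

section \<open>From R to the localized quotient\<close>

lemma zero_FactRing: "\<zero>\<^bsub>R Quot I\<^esub> = I"
  unfolding FactRing_def by simp

lemma carrier_FactRing: "carrier (R Quot I) = (\<lambda>a. I +>\<^bsub>R\<^esub> a) ` carrier R"
  unfolding FactRing_def A_RCOSETS_def' by auto

text \<open>The composite R -> R/I -> (R/I)_M in one step, with U the preimage of the complement of
  M. A fraction of residue classes is thus represented directly by two elements of R.\<close>

lemma fraction_hom_localization:
  assumes I: "ideal I R" and R: "cring R" and M: "primeideal M (R Quot I)"
  shows "fraction_hom R (localization (R Quot I) M) (\<lambda>a. loc_frac (R Quot I) M (I +>\<^bsub>R\<^esub> a) \<one>\<^bsub>R Quot I\<^esub>)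
    (carrier R - {r \<in> carrier R. I +>\<^bsub>R\<^esub> r \<in> M}) I"
proof -
  let ?A = "R Quot I" and ?S = "localization (R Quot I) M" 
  let ?q = "\<lambda>r. I +>\<^bsub>R\<^esub> r" and ?h = "\<lambda>a. loc_frac (R Quot I) M (I +>\<^bsub>R\<^esub> a) \<one>\<^bsub>R Quot I\<^esub>"
  let ?U = "carrier R - {r \<in> carrier R. I +>\<^bsub>R\<^esub> r \<in> M}"
  interpret R: cring R by fact
  interpret I: ideal I R by fact
  interpret M: primeideal M ?A by fact
  interpret S: cring ?S by (rule M.localization_cring)
  interpret q: ring_hom_cring R ?A ?q by (rule I.rcos_ring_hom_cring[OF R])
  interpret l: ring_hom_cring ?A ?S "\<lambda>a. loc_frac ?A M a \<one>\<^bsub>?A\<^esub>" by (rule M.localization_hom)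
  have hom: "?h \<in> ring_hom R ?S"
    using ring_hom_trans[OF q.homh l.homh] by (simp add: comp_def)
  have surj: "\<exists>a\<in>carrier R. x = ?q a" if "x \<in> carrier ?A" for x
    using that unfolding carrier_FactRing by blast
  have q_zero: "a \<in> I" if "a \<in> carrier R" "?q a = \<zero>\<^bsub>?A\<^esub>" for a
    using that I.a_rcos_self[of a] unfolding zero_FactRing by metis
  have U: "s \<in> ?U \<longleftrightarrow> s \<in> carrier R \<and> ?q s \<in> carrier ?A - M" for s
    by auto
  show ?thesis
  proof (unfold_locales)
    show "?h \<in> ring_hom R ?S" by (rule hom)
  next
    fix a assume a: "a \<in> I"
    then have "?q a = \<zero>\<^bsub>?A\<^esub>"
      using R.a_rcos_zero[OF I a] unfolding zero_FactRing by blast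
    then show "?h a = \<zero>\<^bsub>?S\<^esub>" by (simp only: M.localization_zero)
  next
    show "\<one>\<^bsub>R\<^esub> \<in> ?U" unfolding U using M.compl_one by simp
  next
    fix s t assume "s \<in> ?U" "t \<in> ?U"
    then show "s \<otimes>\<^bsub>R\<^esub> t \<in> ?U" unfolding U using M.compl_mult[of "?q s" "?q t"] by simp
  next
    fix s assume "s \<in> ?U"
    then have s: "s \<in> carrier R" "?q s \<in> carrier ?A - M" unfolding U by auto
    have c: "loc_frac ?A M \<one>\<^bsub>?A\<^esub> (?q s) \<in> carrier ?S" "?h s \<in> carrier ?S"
      using s M.compl_one by (auto intro!: M.loc_frac_closed)
    have "loc_frac ?A M \<one>\<^bsub>?A\<^esub> (?q s) \<otimes>\<^bsub>?S\<^esub> ?h s = \<one>\<^bsub>?S\<^esub>"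
    proof -
      have "loc_frac ?A M \<one>\<^bsub>?A\<^esub> (?q s) \<otimes>\<^bsub>?S\<^esub> ?h s = loc_frac ?A M (\<one>\<^bsub>?A\<^esub> \<otimes>\<^bsub>?A\<^esub> ?q s) (?q s \<otimes>\<^bsub>?A\<^esub> \<one>\<^bsub>?A\<^esub>)"
        by (rule M.localization_mult) (use s M.compl_one in auto)
      also have "\<dots> = loc_frac ?A M \<one>\<^bsub>?A\<^esub> \<one>\<^bsub>?A\<^esub>"
        by (rule M.loc_frac_eqI) (use s M.compl_one in auto)
      finally show ?thesis unfolding M.localization_one .
    qed
    then show "?h s \<in> Units ?S"
      using c S.m_comm[OF c] unfolding Units_def by blast
  next
    fix b assume "b \<in> carrier ?S"
    then obtain x y where b: "b = loc_frac ?A M x y" "x \<in> carrier ?A" "y \<in> carrier ?A - M"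
      unfolding M.localization_carrier by blast
    moreover obtain a where "a \<in> carrier R" "x = ?q a" using surj[OF b(2)] by blast
    moreover obtain s where "s \<in> carrier R" "y = ?q s" using surj[of y] b(3) by blast
    ultimately have as: "a \<in> carrier R" "s \<in> carrier R" "x = ?q a" "y = ?q s" by blast+
    have "b \<otimes>\<^bsub>?S\<^esub> ?h s = ?h a"
    proof -
      have "b \<otimes>\<^bsub>?S\<^esub> ?h s = loc_frac ?A M (x \<otimes>\<^bsub>?A\<^esub> ?q s) (y \<otimes>\<^bsub>?A\<^esub> \<one>\<^bsub>?A\<^esub>)"
        unfolding b(1) by (rule M.localization_mult) (use as b(2,3) M.compl_one in auto)
      also have "\<dots> = ?h a"
        by (rule M.loc_frac_eqI) (use as b(2,3) M.compl_one in auto)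
      finally show ?thesis .
    qed
    moreover have "s \<in> ?U" unfolding U using as b by auto
    ultimately show "\<exists>a\<in>carrier R. \<exists>s\<in>?U. b \<otimes>\<^bsub>?S\<^esub> ?h s = ?h a" using as by blast
  next
    fix a assume a: "a \<in> carrier R" "?h a = \<zero>\<^bsub>?S\<^esub>"
    then obtain x where x: "x \<in> carrier ?A - M" "x \<otimes>\<^bsub>?A\<^esub> (?q a \<otimes>\<^bsub>?A\<^esub> \<one>\<^bsub>?A\<^esub>) = x \<otimes>\<^bsub>?A\<^esub> (\<zero>\<^bsub>?A\<^esub> \<otimes>\<^bsub>?A\<^esub> \<one>\<^bsub>?A\<^esub>)"
      unfolding M.localization_zero using M.loc_frac_eq_iff[of "?q a" "\<zero>\<^bsub>?A\<^esub>" "\<one>\<^bsub>?A\<^esub>" "\<one>\<^bsub>?A\<^esub>"] M.compl_one by auto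
    moreover obtain u where u: "u \<in> carrier R" "x = ?q u" using surj[of x] x(1) by blast
    ultimately have "?q (u \<otimes>\<^bsub>R\<^esub> a) = \<zero>\<^bsub>?A\<^esub>" using a by simp
    then have "u \<otimes>\<^bsub>R\<^esub> a \<in> I" using q_zero[of "u \<otimes>\<^bsub>R\<^esub> a"] u a by simp
    moreover have "u \<in> ?U" unfolding U using u x by auto
    ultimately show "\<exists>u\<in>?U. u \<otimes>\<^bsub>R\<^esub> a \<in> I" by blast
  qed auto
qed

lemma noetherian_quotient:
  assumes I: "ideal I R" and R: "cring R" and noeth: "noetherian_ring R"
  shows "noetherian_ring (R Quot I)"
proof -
  interpret R: cring R by fact
  interpret I: ideal I R by fact
  interpret q: ring_hom_cring R "R Quot I" "\<lambda>r. I +>\<^bsub>R\<^esub> r" by (rule I.rcos_ring_hom_cring[OF R])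
  have "fraction_hom R (R Quot I) (\<lambda>r. I +>\<^bsub>R\<^esub> r) {\<one>\<^bsub>R\<^esub>} I"
  proof (unfold_locales)
    fix b assume "b \<in> carrier (R Quot I)"
    then obtain a where "a \<in> carrier R" "b = I +>\<^bsub>R\<^esub> a"
      unfolding carrier_FactRing by blast
    then show "\<exists>a\<in>carrier R. \<exists>s\<in>{\<one>\<^bsub>R\<^esub>}. b \<otimes>\<^bsub>R Quot I\<^esub> (I +>\<^bsub>R\<^esub> s) = I +>\<^bsub>R\<^esub> a" by auto
  next
    fix a assume "a \<in> carrier R" "I +>\<^bsub>R\<^esub> a = \<zero>\<^bsub>R Quot I\<^esub>"
    then show "\<exists>u\<in>{\<one>\<^bsub>R\<^esub>}. u \<otimes>\<^bsub>R\<^esub> a \<in> I"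
      unfolding zero_FactRing using I.a_rcos_self[of a] by simp
  next
    fix a assume "a \<in> I"
    then show "I +>\<^bsub>R\<^esub> a = \<zero>\<^bsub>R Quot I\<^esub>"
      using R.a_rcos_zero[OF I] unfolding zero_FactRing by blast
  qed auto
  then show ?thesis by (rule fraction_hom.noetherian_image[OF _ noeth])
qed

lemma maximalideal_quotient_vimage:
  assumes I: "ideal I R" and R: "cring R" and M: "maximalideal M (R Quot I)"
  shows "maximalideal {r \<in> carrier R. I +>\<^bsub>R\<^esub> r \<in> M} R \<and> I \<subseteq> {r \<in> carrier R. I +>\<^bsub>R\<^esub> r \<in> M}"
proof -
  interpret R: cring R by fact
  interpret I: ideal I R by fact
  interpret M: maximalideal M "R Quot I" by fact
  interpret q: ring_hom_cring R "R Quot I" "\<lambda>r. I +>\<^bsub>R\<^esub> r" by (rule I.rcos_ring_hom_cring[OF R])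
  let ?P = "{r \<in> carrier R. I +>\<^bsub>R\<^esub> r \<in> M}"
  have surj: "\<exists>a\<in>carrier R. x = I +>\<^bsub>R\<^esub> a" if "x \<in> carrier (R Quot I)" for x
    using that unfolding carrier_FactRing by blast
  have P: "ideal ?P R"
    by (rule ring_hom_ring.ideal_vimage[OF I.rcos_ring_hom_ring M.is_ideal])
  have IP: "I \<subseteq> ?P"
  proof
    fix a assume a: "a \<in> I"
    then have "I +>\<^bsub>R\<^esub> a = \<zero>\<^bsub>R Quot I\<^esub>" using R.a_rcos_zero[OF I a] unfolding zero_FactRing by blast
    then show "a \<in> ?P" using a I.Icarr M.zero_closed by simp
  qed
  have "maximalideal ?P R"
  proof (rule maximalidealI[OF P])
    show "carrier R \<noteq> ?P"
    proof
      assume "carrier R = ?P"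
      then have "carrier (R Quot I) \<subseteq> M" using surj by blast
      then show False using M.I_notcarr M.a_subset by auto
    qed
  next
    fix J assume J: "ideal J R" "?P \<subseteq> J" "J \<subseteq> carrier R"
    let ?J = "(\<lambda>r. I +>\<^bsub>R\<^esub> r) ` J"
    have id: "ideal ?J (R Quot I)"
      using IP J by (intro R.ring_ideal_imp_quot_ideal I) auto
    have "M \<subseteq> ?J"
    proof
      fix x assume x: "x \<in> M"
      then obtain a where "a \<in> carrier R" "x = I +>\<^bsub>R\<^esub> a" using surj M.Icarr by blast
      then show "x \<in> ?J" using x J(2) by auto
    qed
    moreover have "?J \<subseteq> carrier (R Quot I)" using J(3) by auto
    ultimately consider "?J = M" | "?J = carrier (R Quot I)" using M.I_maximal[OF id] by blast
    then show "J = ?P \<or> J = carrier R"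
    proof cases
      case 1
      then have "J \<subseteq> ?P" using J by auto
      then show ?thesis using J by auto
    next
      case 2
      have "a \<in> J" if a: "a \<in> carrier R" for a
      proof -
        have "I +>\<^bsub>R\<^esub> a \<in> ?J" using a unfolding 2 by simp
        then obtain j where j: "j \<in> J" "I +>\<^bsub>R\<^esub> a = I +>\<^bsub>R\<^esub> j" by blast
        then have "a \<ominus>\<^bsub>R\<^esub> j \<in> J"
          using R.quotient_eq_iff_same_a_r_cos[OF I a, of j] J IP by auto
        then have "(a \<ominus>\<^bsub>R\<^esub> j) \<oplus>\<^bsub>R\<^esub> j \<in> J"
          using j J(1) by (simp add: ideal_def additive_subgroup.a_closed)
        moreover have "(a \<ominus>\<^bsub>R\<^esub> j) \<oplus>\<^bsub>R\<^esub> j = a" using a j J(3) by (simp add: R.minus_eq R.a_assoc R.l_neg subset_iff)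
        ultimately show ?thesis by simp
      qed
      then show ?thesis using J by auto
    qed
  qed
  then show ?thesis using IP by simp
qed

text \<open>Both conditions are stated in R alone. The sequence may depend on M, but d may not: it
  bounds all prime chains from above and the depth at every M from below.\<close>

theorem cohen_macaulay_idealI:
  assumes R: "cring R" and noeth: "noetherian_ring R" and I: "ideal I R"
    and chains: "\<And>k Q. (\<forall>i\<le>k. primeideal (Q i) R) \<Longrightarrow> (\<forall>i<k. Q i \<subset> Q (Suc i)) \<Longrightarrow> I \<subseteq> Q 0 \<Longrightarrow> k \<le> d"
    and regular: "\<And>M. maximalideal M R \<Longrightarrow> I \<subseteq> M \<Longrightarrow>
      \<exists>xs. set xs \<subseteq> M \<and> length xs = d \<and> weakly_regular R I xs"
  shows "cohen_macaulay_ideal R I"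
  unfolding cohen_macaulay_ideal_def cohen_macaulay_def
proof (intro conjI allI impI I)
  interpret R: cring R by fact
  interpret I: ideal I R by fact
  interpret Q: cring "R Quot I" by (rule I.quotient_is_cring[OF R])
  show "cring (R Quot I)" by (rule Q.is_cring)
  show "noetherian_ring (R Quot I)" by (rule noetherian_quotient[OF I R noeth])
  fix M assume M: "maximalideal M (R Quot I)"
  let ?P = "{r \<in> carrier R. I +>\<^bsub>R\<^esub> r \<in> M}"
  have P: "maximalideal ?P R" "I \<subseteq> ?P" using maximalideal_quotient_vimage[OF I R M] by blast+
  obtain xs where "set xs \<subseteq> ?P" "length xs = d" "weakly_regular R I xs" using regular[OF P] by blast
  then show "cohen_macaulay_local (localization (R Quot I) M)"
    using fraction_hom.cohen_macaulay_localI[OF fraction_hom_localization[OF I R Q.maximalideal_prime[OF M]]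
      noeth _ R.maximalideal_prime[OF P(1)] P(2) refl, of d xs] chains by presburger
qed

section \<open>Weak regularity along short exact sequences\<close>

context cring
begin

lemma colon_ideal_ideal:
  assumes "ideal I R" "x \<in> carrier R"
  shows "ideal (colon_ideal R I x) R"
proof -
  interpret I: ideal I R by fact
  show ?thesis
  proof (rule ideal_of_closed)
    fix a b assume "a \<in> colon_ideal R I x" "b \<in> colon_ideal R I x"
    then show "a \<oplus> b \<in> colon_ideal R I x"
      using assms(2) I.a_closed[of "a \<otimes> x" "b \<otimes> x"] by (simp add: colon_ideal_def l_distr)
  next
    fix a c assume "a \<in> colon_ideal R I x" "c \<in> carrier R"
    then show "c \<otimes> a \<in> colon_ideal R I x"
      using assms(2) I.I_l_closed[of "a \<otimes> x" c] by (simp add: colon_ideal_def m_assoc)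
  qed (use assms(2) I.zero_closed in \<open>auto simp: colon_ideal_def\<close>)
qed

lemma adjoin_commute:
  assumes "ideal I R" "x \<in> carrier R" "y \<in> carrier R"
  shows "adjoin R (adjoin R I x) y = adjoin R (adjoin R I y) x"
proof -
  have *: "adjoin R (adjoin R I x) y \<subseteq> adjoin R (adjoin R I y) x" if "x \<in> carrier R" "y \<in> carrier R" for x y
  proof -
    note J = adjoin_ideal[OF adjoin_ideal[OF assms(1) that(2)] that(1)]
    note sup = adjoin_superset[OF adjoin_ideal[OF assms(1) that(2)] that(1)] adjoin_superset[OF assms(1) that(2)]
    show ?thesis
      by (intro adjoin_minimal[OF J] adjoin_minimal[OF J]) (use sup in blast)+
  qed
  show ?thesis using *[OF assms(2,3)] *[OF assms(3,2)] by blast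
qed

lemma adjoin_mem:
  assumes "ideal I R" "x \<in> I"
  shows "adjoin R I x = I"
  using adjoin_minimal[OF assms(1) order_refl assms(2)] adjoin_superset[OF assms(1), of x]
    ideal.Icarr[OF assms] by blast

text \<open>Modulo I only the class of x counts; in \<open>esym_regular\<close> this replaces a
  symmetric polynomial by a product.\<close>

lemma adjoin_cong:
  assumes I: "ideal I R" and xy: "x \<in> carrier R" "y \<in> carrier R" "q \<in> I" "x = y \<oplus> q"
  shows "adjoin R I x = adjoin R I y"
proof -
  interpret I: ideal I R by fact
  have "q \<in> carrier R" using xy I.Icarr by blast
  then have y: "y = x \<oplus> (\<ominus> \<one>) \<otimes> q" using xy by algebra
  show ?thesis
  proof
    interpret J: ideal "adjoin R I y" R by (rule adjoin_ideal[OF I xy(2)])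
    have "x \<in> adjoin R I y"
      unfolding xy(4) using adjoin_superset[OF I xy(2)] xy(3) by (intro J.a_closed) auto
    then show "adjoin R I x \<subseteq> adjoin R I y"
      using adjoin_superset[OF I xy(2)] by (intro adjoin_minimal J.is_ideal) auto
  next
    interpret J: ideal "adjoin R I x" R by (rule adjoin_ideal[OF I xy(1)])
    have "x \<oplus> (\<ominus> \<one>) \<otimes> q \<in> adjoin R I x"
      using adjoin_superset[OF I xy(1)] xy(3) by (intro J.a_closed J.I_l_closed) auto
    then show "adjoin R I y \<subseteq> adjoin R I x"
      using adjoin_superset[OF I xy(1)] y by (intro adjoin_minimal J.is_ideal) auto
  qed
qed

lemma nonzerodiv_mod_cong:
  assumes I: "ideal I R" and xy: "x \<in> carrier R" "y \<in> carrier R" "q \<in> I" "x = y \<oplus> q"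
    and "nonzerodiv_mod R I y"
  shows "nonzerodiv_mod R I x"
  unfolding nonzerodiv_mod_def
proof (intro ballI impI)
  interpret I: ideal I R by fact
  fix a assume a: "a \<in> carrier R" "a \<otimes> x \<in> I"
  have q: "q \<in> carrier R" using xy I.Icarr by blast
  have "a \<otimes> y = a \<otimes> x \<oplus> (\<ominus> a) \<otimes> q" unfolding xy(4) using a(1) q xy(2) by algebra
  also have "\<dots> \<in> I" using a by (intro I.a_closed I.I_l_closed[OF xy(3)]) auto
  finally show "a \<in> I" using a(1) assms(6) unfolding nonzerodiv_mod_def by blast
qed

lemma nonzerodiv_mod_mult:
  assumes "x \<in> carrier R" "y \<in> carrier R" "nonzerodiv_mod R I x" "nonzerodiv_mod R I y"
  shows "nonzerodiv_mod R I (x \<otimes> y)"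
  unfolding nonzerodiv_mod_def
proof (intro ballI impI)
  fix a assume a: "a \<in> carrier R" "a \<otimes> (x \<otimes> y) \<in> I"
  then have "(a \<otimes> x) \<otimes> y \<in> I" using assms(1,2) by (simp add: m_assoc)
  then have "a \<otimes> x \<in> I" using assms(1,4) a(1) unfolding nonzerodiv_mod_def by simp
  then show "a \<in> I" using assms(3) a(1) unfolding nonzerodiv_mod_def by simp
qed

text \<open>A base case of the filtration: modulo the unit ideal every element can be
  cancelled.\<close>

lemma weakly_regular_unit: "set xs \<subseteq> carrier R \<Longrightarrow> weakly_regular R (carrier R) xs"
  by (induction xs) (auto simp: nonzerodiv_mod_def adjoin_mem[OF oneideal])

text \<open>Multiplication by x embeds R/(I : x) into R/I with cokernel R/(I + xR); t acts
  injectively on both ends, hence in the middle.\<close>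

lemma nonzerodiv_mod_filtration:
  assumes I: "ideal I R" and x: "x \<in> carrier R" and t: "t \<in> carrier R"
    and nz: "nonzerodiv_mod R (colon_ideal R I x) t" "nonzerodiv_mod R (adjoin R I x) t"
  shows "nonzerodiv_mod R I t"
  unfolding nonzerodiv_mod_def
proof (intro ballI impI)
  interpret I: ideal I R by fact
  fix a assume a: "a \<in> carrier R" "a \<otimes> t \<in> I"
  then have "a \<in> adjoin R I x"
    using adjoin_superset[OF I x] nz(2) unfolding nonzerodiv_mod_def by blast
  then obtain i c where ic: "i \<in> I" "c \<in> carrier R" "a = i \<oplus> c \<otimes> x" by (elim adjoinE)
  have i: "i \<in> carrier R" using ic I.Icarr by blast
  have "(c \<otimes> t) \<otimes> x = a \<otimes> t \<oplus> (\<ominus> t) \<otimes> i" unfolding ic(3) using ic(2) i x t by algebra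
  also have "\<dots> \<in> I" using a(2) t by (intro I.a_closed I.I_l_closed[OF ic(1)]) auto
  finally have "c \<otimes> t \<in> colon_ideal R I x" using ic(2) t by (simp add: colon_ideal_def)
  then have "c \<in> colon_ideal R I x" using nz(1) ic(2) unfolding nonzerodiv_mod_def by blast
  then have "c \<otimes> x \<in> I" by (simp add: colon_ideal_def)
  then show "a \<in> I" unfolding ic(3) using ic(1) by (intro I.a_closed)
qed

text \<open>If b x = i + c t with i in I, then c t lies in I + xR, so c = j + e x with j in I by the
  assumption on t, and b - e t multiplies x into I.\<close>

lemma colon_adjoin:
  assumes I: "ideal I R" and x: "x \<in> carrier R" and t: "t \<in> carrier R"
    and nz: "nonzerodiv_mod R (adjoin R I x) t"
  shows "colon_ideal R (adjoin R I t) x = adjoin R (colon_ideal R I x) t"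
proof
  interpret I: ideal I R by fact
  show "colon_ideal R (adjoin R I t) x \<subseteq> adjoin R (colon_ideal R I x) t"
  proof
    fix b assume "b \<in> colon_ideal R (adjoin R I t) x"
    then have b: "b \<in> carrier R" "b \<otimes> x \<in> adjoin R I t" by (auto simp: colon_ideal_def)
    then obtain i c where ic: "i \<in> I" "c \<in> carrier R" "b \<otimes> x = i \<oplus> c \<otimes> t" by (elim adjoinE)
    have i: "i \<in> carrier R" using ic I.Icarr by blast
    have "c \<otimes> t = (i \<oplus> c \<otimes> t) \<oplus> (\<ominus> \<one>) \<otimes> i" using ic(2) i t by algebra
    also have "\<dots> = (\<ominus> \<one>) \<otimes> i \<oplus> b \<otimes> x" unfolding ic(3)[symmetric] using b(1) x i by algebra
    also have "\<dots> \<in> adjoin R I x" using ic(1) b(1) by (intro adjoinI I.I_l_closed) auto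
    finally have "c \<in> adjoin R I x" using nz ic(2) unfolding nonzerodiv_mod_def by blast
    then obtain j e where je: "j \<in> I" "e \<in> carrier R" "c = j \<oplus> e \<otimes> x" by (elim adjoinE)
    have j: "j \<in> carrier R" using je I.Icarr by blast
    have "(b \<oplus> (\<ominus> e) \<otimes> t) \<otimes> x = b \<otimes> x \<oplus> (\<ominus> (e \<otimes> x)) \<otimes> t" using b(1) je(2) x t by algebra
    also have "\<dots> = i \<oplus> t \<otimes> j" unfolding ic(3) je(3) using i j je(2) t x by algebra
    also have "\<dots> \<in> I" using ic(1) t by (intro I.a_closed I.I_l_closed[OF je(1)]) auto
    finally have "b \<oplus> (\<ominus> e) \<otimes> t \<in> colon_ideal R I x" using b(1) je(2) t by (simp add: colon_ideal_def)
    then have "(b \<oplus> (\<ominus> e) \<otimes> t) \<oplus> e \<otimes> t \<in> adjoin R (colon_ideal R I x) t"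
      using je(2) by (intro adjoinI)
    moreover have "(b \<oplus> (\<ominus> e) \<otimes> t) \<oplus> e \<otimes> t = b" using b(1) je(2) t by algebra
    ultimately show "b \<in> adjoin R (colon_ideal R I x) t" by simp
  qed
  interpret J: ideal "adjoin R I t" R by (rule adjoin_ideal[OF I t])
  have "colon_ideal R I x \<subseteq> colon_ideal R (adjoin R I t) x"
    using adjoin_superset[OF I t] by (auto simp: colon_ideal_def)
  moreover have "t \<in> colon_ideal R (adjoin R I t) x"
    using adjoin_superset(2)[OF I t] J.I_r_closed[of t x] t x by (simp add: colon_ideal_def)
  ultimately show "adjoin R (colon_ideal R I x) t \<subseteq> colon_ideal R (adjoin R I t) x"
    by (rule adjoin_minimal[OF colon_ideal_ideal[OF J.is_ideal x]])
qed

text \<open>The exact sequence \<open>0 \<rightarrow> R/(I : x) \<rightarrow> R/I \<rightarrow> R/(I + xR) \<rightarrow> 0\<close> stays exact modulo each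
  \<open>t\<close>, since \<open>t\<close> is a nonzerodivisor on the right.\<close>

lemma weakly_regular_filtration:
  assumes "ideal I R" "x \<in> carrier R" "set ts \<subseteq> carrier R"
    and "weakly_regular R (colon_ideal R I x) ts" "weakly_regular R (adjoin R I x) ts"
  shows "weakly_regular R I ts"
  using assms
proof (induction ts arbitrary: I)
  case (Cons t ts)
  have t: "t \<in> carrier R" using Cons.prems(3) by simp
  have nz: "nonzerodiv_mod R (colon_ideal R I x) t" "nonzerodiv_mod R (adjoin R I x) t"
    using Cons.prems by auto
  have "weakly_regular R (adjoin R I t) ts"
  proof (rule Cons.IH)
    show "weakly_regular R (colon_ideal R (adjoin R I t) x) ts"
      using Cons.prems(4) colon_adjoin[OF Cons.prems(1,2) t nz(2)] by simp
    show "weakly_regular R (adjoin R (adjoin R I t) x) ts"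
      using Cons.prems(5) adjoin_commute[OF Cons.prems(1) t Cons.prems(2)] by simp
  qed (use Cons.prems adjoin_ideal t in auto)
  then show ?case
    using nonzerodiv_mod_filtration[OF Cons.prems(1,2) t nz] by simp
qed simp

text \<open>The filtration of R/I for I = Q + xyR by means of x: the quotient is R/(Q + xR), and
  cancelling x modulo Q gives I : x = Q + yR. Regularity modulo a product thus follows from
  regularity modulo its factors.\<close>

lemma weakly_regular_adjoin_mult:
  assumes Q: "ideal Q R" and xy: "x \<in> carrier R" "y \<in> carrier R" and ts: "set ts \<subseteq> carrier R"
    and nz: "nonzerodiv_mod R Q x"
    and reg: "weakly_regular R (adjoin R Q x) ts" "weakly_regular R (adjoin R Q y) ts"
  shows "weakly_regular R (adjoin R Q (x \<otimes> y)) ts"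
proof -
  let ?I = "adjoin R Q (x \<otimes> y)"
  have xyc: "x \<otimes> y \<in> carrier R" using xy by simp
  interpret Q: ideal Q R by fact
  interpret I: ideal ?I R by (rule adjoin_ideal[OF Q xyc])
  have "colon_ideal R ?I x = adjoin R Q y"
  proof
    show "colon_ideal R ?I x \<subseteq> adjoin R Q y"
    proof
      fix b assume "b \<in> colon_ideal R ?I x"
      then have b: "b \<in> carrier R" "b \<otimes> x \<in> ?I" by (auto simp: colon_ideal_def)
      then obtain q c where qc: "q \<in> Q" "c \<in> carrier R" "b \<otimes> x = q \<oplus> c \<otimes> (x \<otimes> y)" by (elim adjoinE)
      have q: "q \<in> carrier R" using qc Q.Icarr by blast
      have "(b \<oplus> (\<ominus> c) \<otimes> y) \<otimes> x = b \<otimes> x \<oplus> (\<ominus> c) \<otimes> (x \<otimes> y)" using b(1) qc(2) xy by algebra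
      also have "\<dots> = q" unfolding qc(3) using q qc(2) xy by algebra
      finally have "b \<oplus> (\<ominus> c) \<otimes> y \<in> Q"
        using nz b(1) qc xy unfolding nonzerodiv_mod_def by simp
      then have "(b \<oplus> (\<ominus> c) \<otimes> y) \<oplus> c \<otimes> y \<in> adjoin R Q y" using qc(2) by (intro adjoinI)
      moreover have "(b \<oplus> (\<ominus> c) \<otimes> y) \<oplus> c \<otimes> y = b" using b(1) qc(2) xy by algebra
      ultimately show "b \<in> adjoin R Q y" by simp
    qed
    have "Q \<subseteq> colon_ideal R ?I x"
      using adjoin_superset[OF Q xyc] Q.Icarr I.I_r_closed xy by (auto simp: colon_ideal_def)
    moreover have "y \<in> colon_ideal R ?I x"
      using adjoin_superset(2)[OF Q xyc] xy m_comm[OF xy] by (simp add: colon_ideal_def)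
    ultimately show "adjoin R Q y \<subseteq> colon_ideal R ?I x"
      by (rule adjoin_minimal[OF colon_ideal_ideal[OF I.is_ideal xy(1)]])
  qed
  moreover have "adjoin R ?I x = adjoin R Q x"
  proof
    interpret J: ideal "adjoin R Q x" R by (rule adjoin_ideal[OF Q xy(1)])
    show "adjoin R ?I x \<subseteq> adjoin R Q x"
      using adjoin_superset[OF Q xy(1)] J.I_r_closed[of x y] xy
      by (intro adjoin_minimal[OF J.is_ideal] adjoin_minimal[OF J.is_ideal]) auto
    show "adjoin R Q x \<subseteq> adjoin R ?I x"
      using adjoin_superset[OF I.is_ideal xy(1)] adjoin_superset[OF Q xyc]
      by (intro adjoin_minimal adjoin_ideal I.is_ideal xy(1)) auto
  qed
  ultimately show ?thesis
    using weakly_regular_filtration[OF I.is_ideal xy(1) ts] reg by simp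
qed

end

section \<open>Polynomial rings\<close>

abbreviation (input) keys :: "('a \<Rightarrow>\<^sub>0 'b::zero) \<Rightarrow> 'a set" where "keys \<equiv> Poly_Mapping.keys"
abbreviation (input) lookup :: "('a \<Rightarrow>\<^sub>0 'b::zero) \<Rightarrow> 'a \<Rightarrow> 'b" where "lookup \<equiv> Poly_Mapping.lookup"
abbreviation (input) single :: "'a \<Rightarrow> 'b \<Rightarrow> 'a \<Rightarrow>\<^sub>0 'b::zero" where "single \<equiv> Poly_Mapping.single"

lemma mvpoly_ring_simps [simp]:
  "x \<otimes>\<^bsub>mvpoly_ring n\<^esub> y = x * y" "x \<oplus>\<^bsub>mvpoly_ring n\<^esub> y = x + y"
  "\<one>\<^bsub>mvpoly_ring n\<^esub> = 1" "\<zero>\<^bsub>mvpoly_ring n\<^esub> = 0"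
  unfolding mvpoly_ring_def by auto

lemma mem_mvpoly_ring:
  "p \<in> carrier (mvpoly_ring n) \<longleftrightarrow> (\<forall>m\<in>keys p. keys m \<subseteq> {1..n})"
  unfolding mvpoly_ring_def by simp

lemma keys_uminus_eq: "keys (- p) = keys (p :: 'a \<Rightarrow>\<^sub>0 'b::ab_group_add)"
  by (auto simp: in_keys_iff)

lemma keys_plus_nat: "keys (a + b :: 'a \<Rightarrow>\<^sub>0 nat) = keys a \<union> keys b"
  by (auto simp: in_keys_iff lookup_add)

lemma mvpoly_closed [simp, intro]:
  fixes p q :: "('k::field) mvpoly"
  shows "0 \<in> carrier (mvpoly_ring n)" "1 \<in> carrier (mvpoly_ring n)"
    "p \<in> carrier (mvpoly_ring n) \<Longrightarrow> q \<in> carrier (mvpoly_ring n) \<Longrightarrow> p + q \<in> carrier (mvpoly_ring n)"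
    "p \<in> carrier (mvpoly_ring n) \<Longrightarrow> q \<in> carrier (mvpoly_ring n) \<Longrightarrow> p * q \<in> carrier (mvpoly_ring n)"
    "p \<in> carrier (mvpoly_ring n) \<Longrightarrow> - p \<in> carrier (mvpoly_ring n)"
    "p \<in> carrier (mvpoly_ring n) \<Longrightarrow> q \<in> carrier (mvpoly_ring n) \<Longrightarrow> p - q \<in> carrier (mvpoly_ring n)"
    "p \<in> carrier (mvpoly_ring n) \<Longrightarrow> p ^ k \<in> carrier (mvpoly_ring n)"
proof -
  have add: "p + q \<in> carrier (mvpoly_ring n)" if "p \<in> carrier (mvpoly_ring n)" "q \<in> carrier (mvpoly_ring n)" for p q :: "'k mvpoly"
    using that keys_add[of p q] unfolding mem_mvpoly_ring by blast
  have minus: "- p \<in> carrier (mvpoly_ring n)" if "p \<in> carrier (mvpoly_ring n)" for p :: "'k mvpoly"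
    using that unfolding mem_mvpoly_ring keys_uminus_eq .
  have mult: "p * q \<in> carrier (mvpoly_ring n)" if "p \<in> carrier (mvpoly_ring n)" "q \<in> carrier (mvpoly_ring n)" for p q :: "'k mvpoly"
    using that keys_mult[of p q] unfolding mem_mvpoly_ring by (fastforce simp: keys_plus_nat)
  show "0 \<in> carrier (mvpoly_ring n)" and one: "1 \<in> carrier (mvpoly_ring n)"
    unfolding mem_mvpoly_ring by auto
  assume p: "p \<in> carrier (mvpoly_ring n)"
  show "- p \<in> carrier (mvpoly_ring n)" by (rule minus[OF p])
  show "p ^ k \<in> carrier (mvpoly_ring n)" by (induction k) (use one mult p in auto)
  assume q: "q \<in> carrier (mvpoly_ring n)"
  show "p + q \<in> carrier (mvpoly_ring n)" "p * q \<in> carrier (mvpoly_ring n)" by (rule add[OF p q] mult[OF p q])+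
  show "p - q \<in> carrier (mvpoly_ring n)" using add[OF p minus[OF q]] by simp
qed

lemma mvpoly_single_closed [simp]:
  "keys m \<subseteq> {1..n} \<Longrightarrow> single m c \<in> carrier (mvpoly_ring n)"
  unfolding mem_mvpoly_ring by auto

lemma mvpoly_sum_closed [intro]:
  "(\<And>i. i \<in> A \<Longrightarrow> f i \<in> carrier (mvpoly_ring n)) \<Longrightarrow> sum f A \<in> carrier (mvpoly_ring n)"
  by (induction A rule: infinite_finite_induct) auto

lemma mvpoly_prod_closed [intro]:
  "(\<And>i. i \<in> A \<Longrightarrow> f i \<in> carrier (mvpoly_ring n)) \<Longrightarrow> prod f A \<in> carrier (mvpoly_ring n)"
  by (induction A rule: infinite_finite_induct) auto

lemma var_closed [simp]: "i \<in> {1..n} \<Longrightarrow> var i \<in> carrier (mvpoly_ring n)"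
  unfolding var_def by (rule mvpoly_single_closed) auto

lemma cring_mvpoly: "cring (mvpoly_ring n :: ('k::field) mvpoly ring)"
proof (rule cringI)
  show "abelian_group (mvpoly_ring n :: 'k mvpoly ring)"
    by (rule abelian_groupI) (auto simp: ac_simps intro: bexI[of _ "- x" for x])
  show "comm_monoid (mvpoly_ring n :: 'k mvpoly ring)"
    by (rule comm_monoidI) (auto simp: ac_simps)
qed (auto simp: algebra_simps)

lemma mvpoly_ideal_closed:
  fixes J :: "('k::field) mvpoly set"
  assumes "ideal J (mvpoly_ring n)"
  shows "0 \<in> J" "\<And>a b. a \<in> J \<Longrightarrow> b \<in> J \<Longrightarrow> a + b \<in> J"
    "\<And>a c. a \<in> J \<Longrightarrow> c \<in> carrier (mvpoly_ring n) \<Longrightarrow> c * a \<in> J"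
    "\<And>a c. a \<in> J \<Longrightarrow> c \<in> carrier (mvpoly_ring n) \<Longrightarrow> a * c \<in> J"
    "\<And>a. a \<in> J \<Longrightarrow> a \<in> carrier (mvpoly_ring n)"
    "\<And>a. a \<in> J \<Longrightarrow> - a \<in> J" "\<And>a b. a \<in> J \<Longrightarrow> b \<in> J \<Longrightarrow> a - b \<in> J"
    "\<And>f (A::'b set). (\<And>i. i \<in> A \<Longrightarrow> f i \<in> J) \<Longrightarrow> sum f A \<in> J"
proof -
  interpret ideal J "mvpoly_ring n" by fact
  show z: "0 \<in> J" using additive_subgroup.zero_closed[OF additive_subgroup_axioms] by simp
  show add: "a + b \<in> J" if "a \<in> J" "b \<in> J" for a b using additive_subgroup.a_closed[OF additive_subgroup_axioms that] by simp
  show mult: "c * a \<in> J" if "a \<in> J" "c \<in> carrier (mvpoly_ring n)" for a c using I_l_closed[OF that] by simp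
  show "a * c \<in> J" if "a \<in> J" "c \<in> carrier (mvpoly_ring n)" for a c using I_r_closed[OF that] by simp
  show "a \<in> carrier (mvpoly_ring n)" if "a \<in> J" for a using Icarr[OF that] .
  show minus: "- a \<in> J" if "a \<in> J" for a
    using mult[OF that, of "- 1"] by (simp add: mvpoly_closed)
  show "a - b \<in> J" if "a \<in> J" "b \<in> J" for a b using add[OF that(1) minus[OF that(2)]] by simp
  show "sum f A \<in> J" if "\<And>i. i \<in> A \<Longrightarrow> f i \<in> J" for f and A :: "'b set"
    using that by (induction A rule: infinite_finite_induct) (auto intro: z add)
qed

lemma mvpoly_idealI:
  fixes J :: "('k::field) mvpoly set"
  assumes "J \<subseteq> carrier (mvpoly_ring n)" "0 \<in> J" "\<And>a b. a \<in> J \<Longrightarrow> b \<in> J \<Longrightarrow> a + b \<in> J"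
    "\<And>a c. a \<in> J \<Longrightarrow> c \<in> carrier (mvpoly_ring n) \<Longrightarrow> c * a \<in> J"
  shows "ideal J (mvpoly_ring n)"
  using assms by (intro cring.ideal_of_closed[OF cring_mvpoly]) auto

lemma mvpoly_expand: "(f :: ('k::field) mvpoly) = (\<Sum>m\<in>keys f. single m (lookup f m))"
proof (rule poly_mapping_eqI)
  fix t
  have "lookup (\<Sum>m\<in>keys f. single m (lookup f m)) t =
      (\<Sum>m\<in>keys f. if m = t then lookup f m else 0)"
    unfolding lookup_sum lookup_single by (simp add: when_def)
  also have "\<dots> = lookup f t"
    by (simp add: in_keys_iff)
  finally show "lookup f t =
      lookup (\<Sum>m\<in>keys f. single m (lookup f m)) t" ..
qed

lemma mvpoly_mult_expand: "(f :: ('k::field) mvpoly) * g =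
  (\<Sum>m\<in>keys f. \<Sum>t\<in>keys g.
    single (m + t) (lookup f m * lookup g t))"
  by (subst (1) mvpoly_expand[of f], subst (1) mvpoly_expand[of g])
    (simp add: sum_product mult_single)

lemma mem_ideal_of_terms:
  assumes "ideal J (mvpoly_ring n)"
    and "\<And>m. m \<in> keys f \<Longrightarrow> single m (lookup f m) \<in> J"
  shows "(f :: ('k::field) mvpoly) \<in> J"
  by (subst mvpoly_expand) (intro mvpoly_ideal_closed(8)[OF assms(1)] assms(2))

text \<open>Meant for predicates closed under adding exponents. Colon by a monomial becomes a shift
  of U, adjoining a variable a disjunction, intersection a conjunction; the ideal theory turns into
  statements about exponents.\<close>

definition monomial_ideal :: "nat \<Rightarrow> (monom_exp \<Rightarrow> bool) \<Rightarrow> ('k::field) mvpoly set" where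
  "monomial_ideal n U = {f \<in> carrier (mvpoly_ring n). \<forall>m\<in>keys f. U m}"

lemma monomial_ideal_ideal:
  assumes "\<And>m t. U m \<Longrightarrow> U (m + t)"
  shows "ideal (monomial_ideal n U :: ('k::field) mvpoly set) (mvpoly_ring n)"
proof (rule mvpoly_idealI)
  fix a b :: "'k mvpoly" assume "a \<in> monomial_ideal n U" "b \<in> monomial_ideal n U"
  then show "a + b \<in> monomial_ideal n U"
    using keys_add[of a b] unfolding monomial_ideal_def by auto
next
  fix a c :: "'k mvpoly" assume a: "a \<in> monomial_ideal n U" "c \<in> carrier (mvpoly_ring n)"
  then have "U m" if "m \<in> keys (c * a)" for m
  proof -
    have "m \<in> {s + t | s t. s \<in> keys c \<and> t \<in> keys a}"
      using keys_mult[of c a] that by (rule subsetD)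
    then obtain s t where "m = s + t" "t \<in> keys a" by auto
    then show ?thesis using assms[of t s] a(1) unfolding monomial_ideal_def by (auto simp: add.commute)
  qed
  then show "c * a \<in> monomial_ideal n U"
    using a unfolding monomial_ideal_def by auto
qed (auto simp: monomial_ideal_def)

lemma monomial_ideal_cong:
  "(\<And>m. keys m \<subseteq> {1..n} \<Longrightarrow> U m \<longleftrightarrow> U' m) \<Longrightarrow> monomial_ideal n U = monomial_ideal n U'"
  unfolding monomial_ideal_def mem_mvpoly_ring by auto

text \<open>Shifting exponents by t is injective, so no terms merge or cancel.\<close>

lemma keys_times_monomial:
  "keys (f * single t (1::'k::field)) = (\<lambda>m. m + t) ` keys (f :: 'k mvpoly)"
proof -
  have "f * single t 1 = (\<Sum>m\<in>keys f. single (m + t) (lookup f m))"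
    by (subst (1) mvpoly_expand[of f]) (simp add: sum_distrib_right mult_single)
  then have l: "lookup (f * single t 1) s =
      (\<Sum>m\<in>keys f. if m + t = s then lookup f m else 0)" for s
    by (simp add: lookup_sum lookup_single when_def)
  have "lookup (f * single t 1) (m + t) = lookup f m" for m
    unfolding l by (simp add: in_keys_iff)
  moreover have "s \<in> (\<lambda>m. m + t) ` keys f" if "lookup (f * single t 1) s \<noteq> 0" for s
  proof (rule ccontr)
    assume "s \<notin> (\<lambda>m. m + t) ` keys f"
    then have "lookup (f * single t 1) s = 0"
      unfolding l by (intro sum.neutral) auto
    then show False using that by simp
  qed
  ultimately show ?thesis by (auto simp: in_keys_iff)
qed

lemma colon_monomial_ideal:
  assumes t: "keys t \<subseteq> {1..n}"
  shows "colon_ideal (mvpoly_ring n) (monomial_ideal n U) (single t (1::'k::field)) =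
    monomial_ideal n (\<lambda>m. U (m + t))"
proof -
  show ?thesis
    unfolding colon_ideal_def monomial_ideal_def
    using t by (simp add: mem_mvpoly_ring keys_times_monomial keys_plus_nat cong: conj_cong)
qed

lemma adjoin_var_monomial_ideal:
  assumes x: "x \<in> {1..n}" and U: "\<And>m t. U m \<Longrightarrow> U (m + t)"
  shows "adjoin (mvpoly_ring n) (monomial_ideal n U) (var x :: ('k::field) mvpoly) =
    monomial_ideal n (\<lambda>m. U m \<or> lookup m x \<ge> 1)" (is "?L = ?R")
proof
  note I = monomial_ideal_ideal[of U, OF U, where 'k='k and n=n]
  have R: "ideal ?R (mvpoly_ring n)"
    by (rule monomial_ideal_ideal) (auto simp: U lookup_add)
  have "var x \<in> (?R :: 'k mvpoly set)"
    unfolding monomial_ideal_def using var_closed[OF x] by (auto simp: var_def)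
  then show "?L \<subseteq> (?R :: 'k mvpoly set)"
    by (intro cring.adjoin_minimal[OF cring_mvpoly R]) (auto simp: monomial_ideal_def)
  have L: "ideal ?L (mvpoly_ring n)"
    by (rule cring.adjoin_ideal[OF cring_mvpoly I var_closed[OF x]])
  note sup = cring.adjoin_superset[OF cring_mvpoly I var_closed[OF x]]
  show "?R \<subseteq> (?L :: 'k mvpoly set)"
  proof
    fix f :: "'k mvpoly" assume f: "f \<in> ?R"
    show "f \<in> ?L"
    proof (rule mem_ideal_of_terms[OF L])
      fix m assume m: "m \<in> keys f"
      have mc: "keys m \<subseteq> {1..n}" using f m unfolding monomial_ideal_def mem_mvpoly_ring by auto
      from f m consider "U m" | "lookup m x \<ge> 1" unfolding monomial_ideal_def by auto
      then show "single m (lookup f m) \<in> ?L"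
      proof cases
        case 1
        then have "single m (lookup f m) \<in> monomial_ideal n U"
          using mc unfolding monomial_ideal_def by auto
        then show ?thesis using sup by blast
      next
        case 2
        \<comment> \<open>Subtraction of exponents is truncated; the bound
          \<open>lookup m x \<ge> 1\<close> makes it invertible here.\<close>
        define t where "t = m - single x 1"
        have mt: "m = t + single x 1"
          unfolding t_def using 2 by (intro poly_mapping_eqI) (auto simp: lookup_add lookup_minus lookup_single when_def)
        have "keys t \<subseteq> {1..n}" using mc unfolding mt keys_plus_nat by simp
        then have "single t (lookup f m) * var x \<in> ?L"
          using sup by (intro mvpoly_ideal_closed(3)[OF L]) auto
        moreover have "single t c * var x = single m c" for c :: 'k
          unfolding var_def mult_single mt by simp
        ultimately show ?thesis by simp
      qed
    qed
  qed
qed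

text \<open>The coefficient of x_j^k when f is read as a polynomial in x_j over the other variables;
  the test on m keeps x_j itself out of the coefficient.\<close>

lift_definition coeff_var :: "nat \<Rightarrow> nat \<Rightarrow> ('k::zero) mvpoly \<Rightarrow> 'k mvpoly"
  is "\<lambda>j k f m. if lookup m j = 0 then f (m + single j k) else 0"
proof -
  fix j k :: nat and f :: "monom_exp \<Rightarrow> 'k" assume "finite {m. f m \<noteq> 0}"
  moreover have "{m. (if lookup m j = 0 then f (m + single j k) else 0) \<noteq> 0} \<subseteq>
      (\<lambda>t. t - single j k) ` {m. f m \<noteq> 0}"
  proof
    fix m assume "m \<in> {m. (if lookup m j = 0 then f (m + single j k) else 0) \<noteq> 0}"
    then have "f (m + single j k) \<noteq> 0" by (auto split: if_splits)
    then show "m \<in> (\<lambda>t. t - single j k) ` {m. f m \<noteq> 0}"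
      by (intro image_eqI[of _ _ "m + single j k"]) auto
  qed
  ultimately show "finite {m. (if lookup m j = 0 then f (m + single j k) else 0) \<noteq> 0}"
    by (meson finite_imageI finite_subset)
qed

lemma coeff_var_add: "coeff_var j k (f + g) = coeff_var j k f + coeff_var j k (g :: ('k::field) mvpoly)"
  by (rule poly_mapping_eqI) (simp add: coeff_var.rep_eq lookup_add)

lemma coeff_var_zero [simp]: "coeff_var j k 0 = (0 :: ('k::field) mvpoly)"
  by (rule poly_mapping_eqI) (simp add: coeff_var.rep_eq)

lemma coeff_var_sum: "coeff_var j k (sum f A) = (\<Sum>i\<in>A. coeff_var j k (f i :: ('k::field) mvpoly))"
  by (induction A rule: infinite_finite_induct) (auto simp: coeff_var_add)

lemma coeff_var_single: "coeff_var j k (single m (c::'k::field)) =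
  (if lookup m j = k then single (m - single j k) c else 0)"
proof (rule poly_mapping_eqI)
  fix t
  have "m = t + single j k \<longleftrightarrow> m - single j k = t"
    if "lookup t j = 0" "lookup m j = k"
  proof
    assume "m - single j k = t"
    then show "m = t + single j k"
      using that by (auto intro!: poly_mapping_eqI simp: lookup_add lookup_minus lookup_single when_def)
  qed simp
  moreover have "m \<noteq> t + single j k" if "lookup t j = 0" "lookup m j \<noteq> k"
    using that by (auto simp: lookup_add)
  moreover have "m - single j k \<noteq> t" if "lookup t j \<noteq> 0" "lookup m j = k"
    using that by (auto simp: lookup_minus)
  ultimately show "lookup (coeff_var j k (single m c)) t =
    lookup (if lookup m j = k then single (m - single j k) c else 0) t"
    by (auto simp: coeff_var.rep_eq lookup_single when_def)
qed

lemma keys_coeff_var: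
  "m \<in> keys (coeff_var j k (f :: ('k::field) mvpoly)) \<Longrightarrow>
    lookup m j = 0 \<and> m + single j k \<in> keys f"
  by (auto simp: in_keys_iff coeff_var.rep_eq split: if_splits)

lemma coeff_var_closed [simp]:
  "f \<in> carrier (mvpoly_ring n) \<Longrightarrow> coeff_var j k (f :: ('k::field) mvpoly) \<in> carrier (mvpoly_ring n)"
  unfolding mem_mvpoly_ring using keys_coeff_var[of _ j k f] by (fastforce simp: keys_plus_nat)

lemma coeff_var_mult_free:
  assumes "\<And>m. m \<in> keys h \<Longrightarrow> lookup m j = 0"
  shows "coeff_var j k (f * h) = coeff_var j k f * (h :: ('k::field) mvpoly)"
proof -
  have *: "coeff_var j k (single (m + t) (a * b)) = coeff_var j k (single m a) * single t (b::'k)"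
    if "lookup t j = 0" for m t a b
  proof (cases "lookup m j = k")
    case True
    then have "m + t - single j k = (m - single j k) + t"
      by (intro poly_mapping_eqI) (auto simp: lookup_add lookup_minus lookup_single when_def)
    then show ?thesis using that True by (simp add: coeff_var_single lookup_add mult_single)
  qed (use that in \<open>simp add: coeff_var_single lookup_add\<close>)
  have "coeff_var j k (f * h) = (\<Sum>m\<in>keys f. \<Sum>t\<in>keys h.
     coeff_var j k (single m (lookup f m)) * single t (lookup h t))"
    unfolding mvpoly_mult_expand[of f h] coeff_var_sum by (intro sum.cong refl *) (use assms in auto)
  also have "\<dots> = coeff_var j k (\<Sum>m\<in>keys f. single m (lookup f m)) *
      (\<Sum>t\<in>keys h. single t (lookup h t))"
    unfolding coeff_var_sum by (simp add: sum_product)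
  also have "\<dots> = coeff_var j k f * h" unfolding mvpoly_expand[symmetric] ..
  finally show ?thesis .
qed

text \<open>With powers of x_j at most e in z and at most D in a, only the top terms of both
  together reach D + e.\<close>

lemma coeff_var_top_mult:
  assumes z: "\<And>m. m \<in> keys z \<Longrightarrow> \<exists>i\<le>e. m = single j i"
    and a: "\<And>m. m \<in> keys a \<Longrightarrow> lookup m j \<le> D"
  shows "coeff_var j (D + e) (z * a) =
    single 0 (lookup z (single j e)) * coeff_var j D (a :: ('k::field) mvpoly)"
proof -
  let ?s = "single j e"
  have *: "coeff_var j (D + e) (single (m + t) (lookup z m * c)) =
    (if m = ?s then single 0 (lookup z ?s) * coeff_var j D (single t c) else 0)"
    if mt: "m \<in> keys z" "t \<in> keys a" for m t c
  proof -
    obtain i where i: "i \<le> e" "m = single j i" using z mt by blast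
    have t: "lookup t j \<le> D" using a mt by blast
    have "single j e + t - single j (D + e) = t - single j D"
      by (intro poly_mapping_eqI) (auto simp: lookup_add lookup_minus lookup_single when_def)
    moreover have "m = ?s \<longleftrightarrow> i = e" unfolding i(2) by (metis lookup_single_eq)
    ultimately show ?thesis
      using i t by (auto simp: coeff_var_single lookup_add mult_single)
  qed
  have "coeff_var j (D + e) (z * a) = (\<Sum>m\<in>keys z. \<Sum>t\<in>keys a.
     if m = ?s then single 0 (lookup z ?s) * coeff_var j D (single t (lookup a t)) else 0)"
    unfolding mvpoly_mult_expand[of z a] coeff_var_sum by (intro sum.cong refl *)
  also have "\<dots> = (\<Sum>m\<in>keys z. if m = ?s then
      single 0 (lookup z ?s) * coeff_var j D (\<Sum>t\<in>keys a. single t (lookup a t)) else 0)"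
    by (intro sum.cong refl) (simp add: coeff_var_sum sum_distrib_left)
  also have "\<dots> = single 0 (lookup z ?s) * coeff_var j D a"
    unfolding mvpoly_expand[of a, symmetric] by (simp add: in_keys_iff)
  finally show ?thesis .
qed

lemma coeff_var_remove_top:
  assumes a: "\<And>m. m \<in> keys a \<Longrightarrow> lookup m j \<le> D"
    and m: "m \<in> keys (a - single (single j D) 1 * coeff_var j D (a :: ('k::field) mvpoly))"
  shows "lookup m j < D"
proof -
  let ?t = "\<lambda>m. single m (lookup a m)"
  have *: "single (single j D) 1 * coeff_var j D (?t m) =
      (if lookup m j = D then ?t m else 0)" for m
  proof (cases "lookup m j = D")
    case True
    then have "single j D + (m - single j D) = m"
      by (intro poly_mapping_eqI) (auto simp: lookup_add lookup_minus lookup_single when_def)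
    then show ?thesis using True by (simp add: coeff_var_single mult_single)
  qed (simp add: coeff_var_single)
  have "single (single j D) 1 * coeff_var j D a =
      (\<Sum>m\<in>keys a. if lookup m j = D then ?t m else 0)"
    by (subst (1) mvpoly_expand[of a]) (simp add: coeff_var_sum sum_distrib_left *)
  then have eq: "a - single (single j D) 1 * coeff_var j D a =
      (\<Sum>m\<in>keys a. ?t m - (if lookup m j = D then ?t m else 0))"
    unfolding sum_subtractf mvpoly_expand[of a, symmetric] by simp
  from m have "m \<in> (\<Union>m\<in>keys a. keys (?t m - (if lookup m j = D then ?t m else 0)))"
    unfolding eq by (rule subsetD[OF keys_sum])
  then obtain t where t: "t \<in> keys a"
    and mt: "m \<in> keys (?t t - (if lookup t j = D then ?t t else 0))"
    by blast
  have "lookup t j \<noteq> D" using mt by (cases "lookup t j = D") simp_all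
  moreover from this have "m \<in> keys (?t t)" using mt by simp
  then have "m = t" by (simp split: if_splits)
  ultimately have "m \<in> keys a \<and> lookup m j \<noteq> D" using t by blast
  then show ?thesis using a[of m] by linarith
qed

text \<open>For an ideal Q this says that Q is generated by polynomials free of x_j; for
  \<open>j \<in> {1..n}\<close> the ring R/Q is then a polynomial ring in x_j over a quotient of the
  ring in the other variables.\<close>

definition coeff_closed :: "nat \<Rightarrow> ('k::field) mvpoly set \<Rightarrow> bool" where
  "coeff_closed j Q \<longleftrightarrow> (\<forall>f\<in>Q. \<forall>k. coeff_var j k f \<in> Q)"

lemma coeff_closed_adjoin:
  assumes "coeff_closed j Q" and "\<And>m. m \<in> keys h \<Longrightarrow> lookup m j = 0"
  shows "coeff_closed j (adjoin (mvpoly_ring n) Q (h :: ('k::field) mvpoly))"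
  unfolding coeff_closed_def
proof (intro ballI allI)
  fix f k assume "f \<in> adjoin (mvpoly_ring n) Q h"
  then obtain q c where "q \<in> Q" "c \<in> carrier (mvpoly_ring n)" "f = q + c * h" by (elim adjoinE) auto
  moreover from this have "coeff_var j k f = coeff_var j k q + coeff_var j k c * h"
    using coeff_var_mult_free[OF assms(2)] by (simp add: coeff_var_add)
  ultimately show "coeff_var j k f \<in> adjoin (mvpoly_ring n) Q h"
    using assms(1) adjoinI[of "coeff_var j k q" Q "coeff_var j k c" "mvpoly_ring n" h]
    by (simp add: coeff_closed_def)
qed

text \<open>R/Q is a polynomial ring in x_j, and the leading coefficient of z is a nonzero constant,
  hence a unit. If z a lies in Q, so does the top coefficient of a; subtract the top terms and
  descend in the degree.\<close>

lemma nonzerodiv_univariate: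
  assumes Q: "ideal Q (mvpoly_ring n)" "coeff_closed j Q" and j: "j \<in> {1..n}"
    and z: "z \<noteq> 0" "keys z \<subseteq> range (single j)"
  shows "nonzerodiv_mod (mvpoly_ring n) Q (z :: ('k::field) mvpoly)"
proof -
  note cl = mvpoly_ideal_closed[OF Q(1)]
  define e where "e = Max ((\<lambda>m. lookup m j) ` keys z)"
  have ne: "keys z \<noteq> {}" using z by simp
  have "e \<in> (\<lambda>m. lookup m j) ` keys z"
    unfolding e_def using ne by (intro Max_in) auto
  then have top: "single j e \<in> keys z" using z(2) by auto
  have ze: "\<exists>i\<le>e. m = single j i" if mz: "m \<in> keys z" for m
  proof -
    have "lookup m j \<le> e" unfolding e_def using mz by (intro Max_ge) auto
    moreover obtain i where "m = single j i" using z(2) mz by blast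
    ultimately show ?thesis by auto
  qed
  let ?c = "lookup z (single j e)"
  have c: "?c \<noteq> 0" using top by (simp add: in_keys_iff)
  have zc: "z \<in> carrier (mvpoly_ring n)"
    unfolding mem_mvpoly_ring
  proof
    fix m assume "m \<in> keys z"
    then obtain i where "m = single j i" using ze by blast
    then show "keys m \<subseteq> {1..n}" using j by simp
  qed
  have main: "a \<in> Q" if "a \<in> carrier (mvpoly_ring n)" "z * a \<in> Q"
    "\<And>m. m \<in> keys a \<Longrightarrow> lookup m j < D" for a D
    using that
  proof (induction D arbitrary: a)
    case 0
    then have "keys a = {}" by blast
    then show ?case using cl(1) by simp
  next
    case (Suc D)
    have le: "lookup m j \<le> D" if "m \<in> keys a" for m
      using Suc.prems(3)[OF that] by simp
    let ?x = "single (single j D) (1::'k)"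
    have x: "?x \<in> carrier (mvpoly_ring n)" using j by (intro mvpoly_single_closed) auto
    have lead: "single 0 ?c * coeff_var j D a \<in> Q"
      using Q(2) Suc.prems(2) coeff_var_top_mult[OF ze le] unfolding coeff_closed_def by metis
    have "single 0 (inverse ?c) * (single 0 ?c * coeff_var j D a) \<in> Q"
      by (rule cl(3)[OF lead mvpoly_single_closed]) simp
    then have b: "coeff_var j D a \<in> Q" using c by (simp add: mult.assoc[symmetric] mult_single)
    then have xb: "?x * coeff_var j D a \<in> Q" using cl(3) x by blast
    have "a - ?x * coeff_var j D a \<in> Q"
    proof (rule Suc.IH)
      show "a - ?x * coeff_var j D a \<in> carrier (mvpoly_ring n)" using Suc.prems(1) x by auto
      have "z * a - z * (?x * coeff_var j D a) \<in> Q" using cl(7) Suc.prems(2) cl(3)[OF xb zc] by blast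
      then show "z * (a - ?x * coeff_var j D a) \<in> Q" by (simp add: algebra_simps)
    qed (rule coeff_var_remove_top[OF le])
    from cl(2)[OF this xb] show ?case by simp
  qed
  show ?thesis
    unfolding nonzerodiv_mod_def
  proof (intro ballI impI)
    fix a assume a: "a \<in> carrier (mvpoly_ring n)" "a \<otimes>\<^bsub>mvpoly_ring n\<^esub> z \<in> Q"
    let ?M = "(\<lambda>m. lookup m j) ` keys a"
    show "a \<in> Q"
    \<comment> \<open>If a = 0, the maximum is taken over the empty set, but the degree bound is
      then vacuous.\<close>
    proof (rule main[OF a(1), of "Suc (Max ?M)"])
      show "z * a \<in> Q" using a(2) by (simp add: mult.commute)
      fix m assume "m \<in> keys a"
      then have "lookup m j \<le> Max ?M" by (intro Max_ge) auto
      then show "lookup m j < Suc (Max ?M)" by simp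
    qed
  qed
qed

section \<open>Noetherianity\<close>

text \<open>A monotone subsequence exists; if it descends, it reaches its least value and is
  constant from there on.\<close>

lemma nat_mono_subseq:
  fixes f :: "nat \<Rightarrow> nat"
  shows "\<exists>g :: nat \<Rightarrow> nat. strict_mono g \<and> incseq (f \<circ> g)"
proof -
  obtain g :: "nat \<Rightarrow> nat" where g: "strict_mono g" "monoseq (\<lambda>n. f (g n))"
    using seq_monosub[of f] by blast
  show ?thesis
  proof (cases "incseq (\<lambda>n. f (g n))")
    case True
    then show ?thesis using g by (intro exI[of _ g]) (auto simp: comp_def)
  next
    case False
    then have dec: "decseq (\<lambda>n. f (g n))" using g(2) unfolding monoseq_iff by blast
    obtain N where N: "\<And>n. f (g N) \<le> f (g n)"
      using ex_has_least_nat[of "\<lambda>_. True" 0 "\<lambda>n. f (g n)"] by auto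
    have "f (g (n + N)) = f (g N)" for n
      using N[of "n + N"] decseqD[OF dec, of N "n + N"] by simp
    moreover have "strict_mono (\<lambda>n. g (n + N))"
      using g(1) by (simp add: strict_mono_def)
    ultimately show ?thesis
      by (intro exI[of _ "\<lambda>n. g (n + N)"]) (auto simp: comp_def incseq_def)
  qed
qed

lemma dickson_subseq:
  fixes f :: "nat \<Rightarrow> 'v \<Rightarrow>\<^sub>0 nat"
  assumes "finite V"
  shows "\<exists>g :: nat \<Rightarrow> nat. strict_mono g \<and> (\<forall>v\<in>V. incseq (\<lambda>k. lookup (f (g k)) v))"
  using assms
proof (induction V)
  case empty
  then show ?case using strict_mono_id by (intro exI[of _ id]) (auto simp: id_def)
next
  case (insert v V)
  then obtain g :: "nat \<Rightarrow> nat" where g: "strict_mono g" "\<And>w. w \<in> V \<Longrightarrow> incseq (\<lambda>k. lookup (f (g k)) w)" by blast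
  obtain h :: "nat \<Rightarrow> nat" where h: "strict_mono h" "incseq ((\<lambda>k. lookup (f (g k)) v) \<circ> h)"
    using nat_mono_subseq by blast
  have "incseq (\<lambda>k. lookup (f ((g \<circ> h) k)) w)" if "w \<in> insert v V" for w
  proof (cases "w = v")
    case True
    then show ?thesis using h(2) by (simp add: comp_def)
  next
    case False
    then have "incseq (\<lambda>k. lookup (f (g k)) w)" using g(2) that by blast
    then show ?thesis
      using h(1) unfolding incseq_def by (simp add: strict_mono_less_eq)
  qed
  then show ?case using strict_mono_o[OF g(1) h(1)] by blast
qed

lemma dickson:
  fixes f :: "nat \<Rightarrow> 'v \<Rightarrow>\<^sub>0 nat"
  assumes "finite V" "\<And>k. keys (f k) \<subseteq> V"
  shows "\<exists>i j t. i < j \<and> f j = f i + t"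
proof -
  obtain g :: "nat \<Rightarrow> nat" where g: "strict_mono g" "\<And>v. v \<in> V \<Longrightarrow> incseq (\<lambda>k. lookup (f (g k)) v)"
    using dickson_subseq[OF assms(1)] by blast
  have le: "lookup (f (g 0)) v \<le> lookup (f (g 1)) v" for v
  proof (cases "v \<in> V")
    case True
    then show ?thesis using incseqD[OF g(2)] by simp
  next
    case False
    then have "v \<notin> keys (f (g 0))" using assms(2) by blast
    then show ?thesis by (simp add: in_keys_iff)
  qed
  have "f (g 1) = f (g 0) + (f (g 1) - f (g 0))"
    using le by (intro poly_mapping_eqI) (simp add: lookup_add lookup_minus)
  moreover have "g 0 < g 1" using g(1) by (simp add: strict_mono_def)
  ultimately show ?thesis by blast
qed

text \<open>The order of \<open>poly_mapping\<close> compares exponent vectors lexicographically and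
  respects addition. With 0 as least element it serves as the monomial order.\<close>

lemma zero_le_monom: "(0 :: monom_exp) \<le> m"
proof (rule ccontr)
  assume "\<not> 0 \<le> m"
  then have "m < 0" by simp
  then have "less_fun (lookup m) (lookup 0)" by (simp add: less_poly_mapping.rep_eq)
  then show False by (auto simp: less_fun_def)
qed

text \<open>Dickson's lemma finds f j = f i + t with i < j in any infinite descent, which then does
  not descend. Fixing finitely many variables is essential: lexicographically x_1 > x_2 > x_3 > ...
  never ends.\<close>

lemma wf_monom: "wf {(m, t). m < (t :: monom_exp) \<and> keys m \<subseteq> {1..n} \<and> keys t \<subseteq> {1..n}}"
  unfolding wf_iff_no_infinite_down_chain
proof
  assume "\<exists>f. \<forall>i. (f (Suc i), f i) \<in> {(m, t). m < (t :: monom_exp) \<and> keys m \<subseteq> {1..n} \<and> keys t \<subseteq> {1..n}}"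
  then obtain f :: "nat \<Rightarrow> monom_exp" where f: "\<And>i. f (Suc i) < f i" "\<And>i. keys (f i) \<subseteq> {1..n}" by auto
  obtain i j t where ij: "i < j" "f j = f i + t" using dickson[of "{1..n}" f] f(2) by auto
  have "f j < f i" using ij(1) by (induction rule: less_Suc_induct) (auto intro: f(1) less_trans)
  then show False using ij(2) zero_le_monom[of t] by (metis add.right_neutral add_left_mono leD)
qed

text \<open>F consists of the exponents minimal under divisibility: infinitely many of them would
  contradict Dickson's lemma, and well-foundedness leads from any exponent of L down to one of
  them.\<close>

lemma finite_monomial_basis:
  fixes L :: "monom_exp set"
  assumes L: "\<And>m. m \<in> L \<Longrightarrow> keys m \<subseteq> {1..n}"
  shows "\<exists>F\<subseteq>L. finite F \<and> (\<forall>m\<in>L. \<exists>s\<in>F. \<exists>t. m = s + t)"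
proof -
  let ?F = "{m \<in> L. \<forall>s\<in>L. \<forall>t. m = s + t \<longrightarrow> t = 0}"
  have "finite ?F"
  proof (rule ccontr)
    assume "infinite ?F"
    then obtain f :: "nat \<Rightarrow> monom_exp" where f: "inj f" "range f \<subseteq> ?F"
      using infinite_countable_subset by blast
    have fL: "f k \<in> L" for k using f(2) by blast
    obtain i j t where ij: "i < j" "f j = f i + t" using dickson[of "{1..n}" f] L[OF fL] by auto
    have "t = 0" using f(2) ij(2) fL[of i] by blast
    then show False using ij f(1) by (auto dest: injD)
  qed
  moreover have "\<exists>s\<in>?F. \<exists>t. m = s + t" if "m \<in> L" for m
    using wf_monom[of n] that
  proof (induction m rule: wf_induct_rule)
    case (less m)
    show ?case
    proof (cases "m \<in> ?F")
      case True
      then show ?thesis by (intro bexI[of _ m] exI[of _ 0]) auto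
    next
      case False
      then obtain s t where st: "s \<in> L" "m = s + t" "t \<noteq> 0" using less.prems by blast
      have "s < m" using st add_left_mono[OF zero_le_monom[of t], of s] by (simp add: order.strict_iff_order)
      then obtain s' t' where "s' \<in> ?F" "s = s' + t'" using less.IH[of s] st(1) less.prems L by blast
      then show ?thesis using st(2) by (metis (no_types, lifting) add.assoc)
    qed
  qed
  ultimately show ?thesis by (intro exI[of _ ?F]) blast
qed

section \<open>Leading monomials and Hilbert's basis theorem\<close>

definition lead_monom :: "('k::field) mvpoly \<Rightarrow> monom_exp" where
  "lead_monom f = Max (keys f)"

lemma lead_monom_in: "f \<noteq> 0 \<Longrightarrow> lead_monom f \<in> keys f"
  unfolding lead_monom_def by (intro Max_in) auto

lemma lead_monom_ge: "m \<in> keys f \<Longrightarrow> m \<le> lead_monom f"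
  unfolding lead_monom_def by (intro Max_ge) auto

text \<open>Division: A is a finite part of I whose leading exponents divide all leading exponents
  of I. Subtracting a multiple of an element of A removes the leading term of f, and the monomial
  order is well-founded.\<close>

theorem noetherian_mvpoly: "noetherian_ring (mvpoly_ring n :: ('k::field) mvpoly ring)"
proof (rule ring.noetherian_ringI[OF cring.axioms(1)[OF cring_mvpoly]])
  fix I :: "'k mvpoly set" assume I: "ideal I (mvpoly_ring n)"
  note cl = mvpoly_ideal_closed[OF I]
  let ?L = "lead_monom ` (I - {0})"
  have keysI: "keys m \<subseteq> {1..n}" if "f \<in> I" "m \<in> keys f" for f m
    using cl(5)[OF that(1)] that(2) unfolding mem_mvpoly_ring by blast
  have "\<exists>F\<subseteq>?L. finite F \<and> (\<forall>m\<in>?L. \<exists>s\<in>F. \<exists>t. m = s + t)"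
    by (rule finite_monomial_basis) (use keysI lead_monom_in in blast)
  then obtain F where F: "F \<subseteq> ?L" "finite F" "\<And>m. m \<in> ?L \<Longrightarrow> \<exists>s\<in>F. \<exists>t. m = s + t" by blast
  obtain A where A: "A \<subseteq> I - {0}" "finite A" "F = lead_monom ` A"
    using finite_subset_image[OF F(2,1)] by blast
  have Ac: "A \<subseteq> carrier (mvpoly_ring n)" using A cl(5) by blast
  let ?G = "Idl\<^bsub>mvpoly_ring n\<^esub> A"
  have ring: "ring (mvpoly_ring n :: 'k mvpoly ring)" by (rule cring.axioms(1)[OF cring_mvpoly])
  have G: "ideal ?G (mvpoly_ring n)" by (rule ring.genideal_ideal[OF ring Ac])
  note gl = mvpoly_ideal_closed[OF G]
  have AG: "A \<subseteq> ?G" by (rule ring.genideal_self[OF ring Ac])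
  have GI: "?G \<subseteq> I" using A by (intro ring.genideal_minimal[OF ring I]) auto
  have "f \<in> ?G" if "f \<in> I" "f \<noteq> 0" "lead_monom f = m" for f m
    using wf_monom[of n] that
  proof (induction m arbitrary: f rule: wf_induct_rule)
    case (less m)
    obtain g t where g: "g \<in> A" "lead_monom f = lead_monom g + t"
      using F(3)[of "lead_monom f"] less.prems unfolding A(3) by blast
    have g0: "g \<noteq> 0" "g \<in> I" using g(1) A(1) by auto
    let ?c = "lookup f (lead_monom f)" and ?d = "lookup g (lead_monom g)"
    have d: "?d \<noteq> 0" using lead_monom_in[OF g0(1)] by (simp add: in_keys_iff)
    let ?u = "single t (?c / ?d)"
    have tk: "keys t \<subseteq> {1..n}"
      using keysI[OF less.prems(1) lead_monom_in[OF less.prems(2)]] unfolding g(2) keys_plus_nat by simp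
    then have u: "?u \<in> carrier (mvpoly_ring n)" by simp
    have ug: "?u * g \<in> ?G" using gl(3) AG g(1) u by blast
    let ?h = "f - ?u * g"
    have ugexp: "?u * g = (\<Sum>s\<in>keys g. single (s + t) (?c / ?d * lookup g s))"
      by (subst (1) mvpoly_expand[of g]) (simp add: sum_distrib_left mult_single add.commute)
    have lk: "lookup (?u * g) s = (\<Sum>s'\<in>keys g. if s' + t = s then ?c / ?d * lookup g s' else 0)" for s
      unfolding ugexp lookup_sum lookup_single when_def ..
    have le: "s \<le> lead_monom f" if s: "s \<in> keys (?u * g)" for s
    proof -
      have "\<exists>s'\<in>keys g. s = s' + t"
      proof (rule ccontr)
        assume "\<not> ?thesis"
        then have "lookup (?u * g) s = 0" unfolding lk by (intro sum.neutral) auto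
        then show False using s by (simp add: in_keys_iff)
      qed
      then obtain s' where "s' \<in> keys g" "s = s' + t" by blast
      then show ?thesis using lead_monom_ge[of s' g] unfolding g(2) by (simp add: add_right_mono)
    qed
    have "lookup (?u * g) (lead_monom f) = ?c"
      unfolding lk unfolding g(2) using d lead_monom_in[OF g0(1)] by simp
    then have top: "lead_monom f \<notin> keys ?h" by (simp add: in_keys_iff lookup_minus)
    have hI: "?h \<in> I" using cl(7)[OF less.prems(1)] ug GI by blast
    have "?h \<in> ?G"
    proof (cases "?h = 0")
      case False
      have "lead_monom ?h \<in> keys f \<union> keys (?u * g)"
        using lead_monom_in[OF False] keys_diff[of f "?u * g"] by blast
      then have "lead_monom ?h \<le> lead_monom f" using le lead_monom_ge by blast
      moreover have "lead_monom ?h \<noteq> lead_monom f" using lead_monom_in[OF False] top by metis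
      ultimately have lt: "lead_monom ?h < m" using less.prems(3) by simp
      show ?thesis
        by (rule less.IH[OF _ hI False refl])
          (use lt keysI[OF hI lead_monom_in[OF False]] keysI[OF less.prems(1) lead_monom_in[OF less.prems(2)]] less.prems(3) in auto)
    qed (use gl(1) in simp)
    from gl(2)[OF this ug] show ?case by simp
  qed
  then have "I \<subseteq> ?G" using gl(1) by blast
  then show "\<exists>A\<subseteq>carrier (mvpoly_ring n). finite A \<and> I = Idl\<^bsub>mvpoly_ring n\<^esub> A"
    using Ac A(2) GI by blast
qed

section \<open>Matroids and weak regularity\<close>

lemma matroid_bases_finite:
  assumes "matroid_bases V \<B>" "finite V" "B \<in> \<B>"
  shows "finite B" "B \<subseteq> V"
proof -
  show "B \<subseteq> V" using assms unfolding matroid_bases_def by blast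
  then show "finite B" using assms(2) finite_subset by blast
qed

lemma matroid_bases_exchange:
  assumes "matroid_bases V \<B>" "F \<in> \<B>" "G \<in> \<B>" "v \<in> F - G"
  shows "\<exists>w\<in>G - F. (F - {v}) \<union> {w} \<in> \<B>"
  using assms by (simp add: matroid_bases_def)

text \<open>Exchanging an element of A - B for one of B - A keeps the size of A and shrinks A - B.
  At the end A lies in B, and an element of B - A would find no exchange partner in A - B.\<close>

lemma matroid_bases_card:
  assumes \<B>: "matroid_bases V \<B>" and V: "finite V" and AB: "A \<in> \<B>" "B \<in> \<B>"
  shows "card A = card B"
  using AB(1)
proof (induction "card (A - B)" arbitrary: A)
  case 0
  have fin: "finite A" "finite B" using matroid_bases_finite[OF \<B> V] 0 AB(2) by auto
  then have sub: "A \<subseteq> B" using 0 by auto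
  have "B \<subseteq> A"
  proof
    fix v assume "v \<in> B"
    show "v \<in> A"
    proof (rule ccontr)
      assume "v \<notin> A"
      then have "\<exists>w\<in>A - B. (B - {v}) \<union> {w} \<in> \<B>" using matroid_bases_exchange[OF \<B> AB(2) 0(2), of v] \<open>v \<in> B\<close> by blast
      then show False using sub by auto
    qed
  qed
  then show ?case using sub by auto
next
  case (Suc k)
  have fin: "finite A" "finite B" using matroid_bases_finite[OF \<B> V] Suc(3) AB(2) by auto
  obtain v where v: "v \<in> A - B" using Suc(2) by (metis card.empty ex_in_conv nat.distinct(1))
  then obtain w where w: "w \<in> B - A" "(A - {v}) \<union> {w} \<in> \<B>" using matroid_bases_exchange[OF \<B> Suc(3) AB(2) v] by blast
  have "(A - {v}) \<union> {w} - B = (A - B) - {v}" using v w by auto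
  then have "k = card ((A - {v}) \<union> {w} - B)" using Suc(2) v fin by simp
  then have "card ((A - {v}) \<union> {w}) = card B" using Suc(1) w(2) by blast
  moreover have "card ((A - {v}) \<union> {w}) = card A"
    using v w fin card_Suc_Diff1[of A v] by (simp del: card_Suc_Diff1)
  ultimately show ?case by simp
qed

text \<open>The exchange axiom prescribes the element that leaves; here the entering one is
  prescribed. Move A towards B by exchanging elements other than x until A - B = {x}. Equal size
  leaves B - A = {y}, and B with y replaced by x is A.\<close>

lemma matroid_bases_dual_exchange:
  assumes \<B>: "matroid_bases V \<B>" and V: "finite V" and AB: "A \<in> \<B>" "B \<in> \<B>" and x: "x \<in> A - B"
  shows "\<exists>y\<in>B - A. (B - {y}) \<union> {x} \<in> \<B>"
  using AB(1) x
proof (induction "card (A - B)" arbitrary: A rule: less_induct)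
  case less
  have fin: "finite A" "finite B" using matroid_bases_finite[OF \<B> V] less(2) AB(2) by auto
  show ?case
  proof (cases "A - B = {x}")
    case True
    have "card (B - A) = card (A - B)"
      using matroid_bases_card[OF \<B> V less(2) AB(2)] fin by (simp add: card_Diff_subset_Int Int_commute)
    then obtain y where y: "B - A = {y}" using True by (metis card_1_singletonE is_singletonI is_singleton_altdef)
    then have "(B - {y}) \<union> {x} = A" using True by auto
    then show ?thesis using y less(2) by auto
  next
    case False
    then obtain a where a: "a \<in> A - B" "a \<noteq> x" using less(3) by blast
    then obtain w where w: "w \<in> B - A" "(A - {a}) \<union> {w} \<in> \<B>" using matroid_bases_exchange[OF \<B> less(2) AB(2) a(1)] by blast
    let ?A = "(A - {a}) \<union> {w}"
    have "?A - B \<subset> A - B" using a w by auto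
    then have "card (?A - B) < card (A - B)" using fin by (intro psubset_card_mono) auto
    then obtain y where "y \<in> B - ?A" "(B - {y}) \<union> {x} \<in> \<B>" using less(1)[of ?A] w a less(3) by blast
    then show ?thesis using a w by auto
  qed
qed

text \<open>The vanishing constant term puts z into the ideal generated by x_j, hence into p_B for
  every B containing j; being nonzero lets z be cancelled modulo p_B when j lies outside B.\<close>

definition univariate :: "nat \<Rightarrow> ('k::field) mvpoly \<Rightarrow> bool" where
  "univariate j z \<longleftrightarrow> z \<noteq> 0 \<and> keys z \<subseteq> range (single j) \<and> lookup z 0 = 0"

lemma univariate_keys:
  assumes "univariate j z" "m \<in> keys z"
  obtains k where "m = single j k" "k \<ge> 1"
proof -
  obtain k where k: "m = single j k" using assms unfolding univariate_def by blast
  have "m \<noteq> 0" using assms unfolding univariate_def by (auto simp: in_keys_iff)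
  then have "k \<noteq> 0" using k by (cases "k = 0") auto
  then show ?thesis using that k by simp
qed

lemma univariate_closed:
  assumes "univariate j z" "j \<in> {1..n}"
  shows "z \<in> carrier (mvpoly_ring n)"
  unfolding mem_mvpoly_ring
proof
  fix m assume "m \<in> keys z"
  then obtain k where "m = single j k" by (rule univariate_keys[OF assms(1)])
  then show "keys m \<subseteq> {1..n}" using assms(2) by simp
qed

section \<open>Elementary symmetric polynomials as a regular sequence\<close>

definition esym :: "'v set \<Rightarrow> ('v \<Rightarrow> 'a::comm_ring_1) \<Rightarrow> nat \<Rightarrow> 'a" where
  "esym A z k = (\<Sum>S | S \<subseteq> A \<and> card S = k. \<Prod>j\<in>S. z j)"

lemma esym_closed:
  assumes "\<And>j. j \<in> A \<Longrightarrow> z j \<in> carrier (mvpoly_ring n)"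
  shows "esym A z k \<in> carrier (mvpoly_ring n)"
  unfolding esym_def using assms by (intro mvpoly_sum_closed mvpoly_prod_closed) auto

text \<open>Modulo the \<open>z\<^sub>j\<close> with \<open>j\<close> outside \<open>D\<close>, the symmetric polynomial of degree \<open>card D\<close> is the product of
  the \<open>z\<^sub>j\<close> over \<open>D\<close>, which allows induction on \<open>D\<close>. Generic linear forms would not work over finite fields.\<close>

lemma esym_regular:
  fixes Q :: "('k::field) mvpoly set"
  assumes z: "\<And>j. j \<in> {1..n} \<Longrightarrow> univariate j (z j)"
    and D: "D \<subseteq> {1..n}" and Q: "ideal Q (mvpoly_ring n)"
    and zQ: "\<And>j. j \<in> {1..n} - D \<Longrightarrow> z j \<in> Q" and cl: "\<And>j. j \<in> D \<Longrightarrow> coeff_closed j Q"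
  shows "weakly_regular (mvpoly_ring n) Q (map (esym {1..n} z) (rev [1..<card D + 1]))"
  using D Q zQ cl
proof (induction "card D" arbitrary: D Q)
  case 0
  then show ?case by simp
next
  case (Suc d)
  note R = cring_mvpoly[where 'k='k and n=n]
  have finD: "finite D" using Suc(3) finite_subset by blast
  have zc: "z j \<in> carrier (mvpoly_ring n)" if "j \<in> {1..n}" for j
    using univariate_closed[OF z[OF that] that] .
  have zcD: "z j \<in> carrier (mvpoly_ring n)" if "j \<in> D" for j using zc Suc(3) that by blast
  let ?e = "esym {1..n} z (Suc d)" and ?p = "\<Prod>j\<in>D. z j"
  let ?ts = "map (esym {1..n} z) (rev [1..<d + 1])"
  have ts: "set ?ts \<subseteq> carrier (mvpoly_ring n)" using esym_closed[of "{1..n}" z n] zc by auto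
  have ec: "?e \<in> carrier (mvpoly_ring n)" using esym_closed[of "{1..n}" z n] zc by blast
  have pc: "(\<Prod>j\<in>A. z j) \<in> carrier (mvpoly_ring n)" if "A \<subseteq> D" for A using zcD that by blast
  \<comment> \<open>A set of the same size other than D has an index outside D, so its product lies
    in Q: the symmetric polynomial is congruent to the product over D.\<close>
  let ?q = "\<Sum>S\<in>{S. S \<subseteq> {1..n} \<and> card S = Suc d} - {D}. \<Prod>j\<in>S. z j"
  have q: "?q \<in> Q"
  proof (rule mvpoly_ideal_closed(8)[OF Suc(4)])
    fix S assume S: "S \<in> {S. S \<subseteq> {1..n} \<and> card S = Suc d} - {D}"
    have "\<not> S \<subseteq> D" using S Suc(2) card_subset_eq[OF finD, of S] by auto
    then obtain j where j: "j \<in> S" "j \<notin> D" by blast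
    have finS: "finite S" using S finite_subset by blast
    have "(\<Prod>i\<in>S. z i) = z j * (\<Prod>i\<in>S - {j}. z i)" using j finS by (simp add: prod.remove)
    also have "\<dots> \<in> Q"
    proof (rule mvpoly_ideal_closed(4)[OF Suc(4)])
      show "z j \<in> Q" using Suc(5) j S by blast
      show "(\<Prod>i\<in>S - {j}. z i) \<in> carrier (mvpoly_ring n)" using zc S by blast
    qed
    finally show "(\<Prod>i\<in>S. z i) \<in> Q" .
  qed
  have "?e = ?p + ?q" unfolding esym_def
    by (rule sum.remove) (use Suc(2,3) in auto)
  then have e: "?e = ?p \<oplus>\<^bsub>mvpoly_ring n\<^esub> ?q" by simp
  have nzj: "nonzerodiv_mod (mvpoly_ring n) Q (z j)" if "j \<in> D" for j
  proof -
    have j: "j \<in> {1..n}" using that Suc(3) by blast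
    have "z j \<noteq> 0" "keys (z j) \<subseteq> range (single j)"
      using z[OF j] unfolding univariate_def by blast+
    then show ?thesis by (rule nonzerodiv_univariate[OF Suc(4) Suc(6)[OF that] j])
  qed
  have nzp: "nonzerodiv_mod (mvpoly_ring n) Q (\<Prod>j\<in>A. z j)" if "finite A" "A \<subseteq> D" for A
    using that
  proof (induction A)
    case empty
    then show ?case by (simp add: nonzerodiv_mod_def)
  next
    case (insert j A)
    then show ?case
      using cring.nonzerodiv_mod_mult[OF R, of "z j" "\<Prod>j\<in>A. z j" Q] zcD pc nzj by simp
  qed
  \<comment> \<open>Adjoining \<open>z j\<close> removes j from D; closure under coefficients in the
    other x_i persists, since \<open>z j\<close> does not involve them.\<close>
  have reg: "weakly_regular (mvpoly_ring n) (adjoin (mvpoly_ring n) Q (z j)) ?ts" if j: "j \<in> D" for j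
  proof -
    have dj: "d = card (D - {j})" using Suc(2) j finD by simp
    note sup = cring.adjoin_superset[OF R Suc(4) zcD[OF j]]
    have "weakly_regular (mvpoly_ring n) (adjoin (mvpoly_ring n) Q (z j))
        (map (esym {1..n} z) (rev [1..<card (D - {j}) + 1]))"
    proof (rule Suc(1)[OF dj])
      show "ideal (adjoin (mvpoly_ring n) Q (z j)) (mvpoly_ring n)"
        by (rule cring.adjoin_ideal[OF R Suc(4) zcD[OF j]])
      show "z i \<in> adjoin (mvpoly_ring n) Q (z j)" if "i \<in> {1..n} - (D - {j})" for i
        using that sup Suc(5) by (cases "i = j") auto
      show "coeff_closed i (adjoin (mvpoly_ring n) Q (z j))" if i: "i \<in> D - {j}" for i
      proof (rule coeff_closed_adjoin)
        show "coeff_closed i Q" using Suc(6) i by blast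
        fix m assume "m \<in> keys (z j)"
        then obtain k where "m = single j k"
          using univariate_keys z[of j] j Suc(3) by blast
        then show "lookup m i = 0" using i by (simp add: lookup_single when_def)
      qed
    qed (use Suc(3) in auto)
    then show ?thesis unfolding dj[symmetric] .
  qed
  \<comment> \<open>Factor by factor; the empty product 1 gives the unit ideal, modulo which every
    sequence is weakly regular.\<close>
  have regp: "weakly_regular (mvpoly_ring n) (adjoin (mvpoly_ring n) Q (\<Prod>j\<in>A. z j)) ?ts" if "finite A" "A \<subseteq> D" for A
    using that
  proof (induction A)
    case empty
    have "1 \<in> adjoin (mvpoly_ring n) Q 1" using cring.adjoin_superset(2)[OF R Suc(4), of 1] by simp
    then have "adjoin (mvpoly_ring n) Q 1 = carrier (mvpoly_ring n)"
      using ideal.one_imp_carrier[OF cring.adjoin_ideal[OF R Suc(4), of 1]] by simp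
    then show ?case using cring.weakly_regular_unit[OF R ts] by simp
  next
    case (insert j A)
    then have "weakly_regular (mvpoly_ring n) (adjoin (mvpoly_ring n) Q (z j \<otimes>\<^bsub>mvpoly_ring n\<^esub> (\<Prod>j\<in>A. z j))) ?ts"
      by (intro cring.weakly_regular_adjoin_mult[OF R Suc(4) _ _ ts] zcD pc nzj reg) auto
    then show ?case using insert by simp
  qed
  have "weakly_regular (mvpoly_ring n) (adjoin (mvpoly_ring n) Q ?e) ?ts"
    using regp[OF finD] cring.adjoin_cong[OF R Suc(4) ec pc q e] by simp
  moreover have "nonzerodiv_mod (mvpoly_ring n) Q ?e"
    using cring.nonzerodiv_mod_cong[OF R Suc(4) ec pc q e] nzp[OF finD] by simp
  ultimately show ?case unfolding Suc(2)[symmetric] by simp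
qed

text \<open>\<open>T\<close> collects the variables set to zero (contracted elements), \<open>S\<close> is the support of \<open>N\<close>.\<close>

definition minor_exponent :: "nat set set \<Rightarrow> nat set \<Rightarrow> nat set \<Rightarrow> nat \<Rightarrow> monom_exp \<Rightarrow> bool" where
  "minor_exponent \<B> T S l m \<longleftrightarrow> (\<exists>i\<in>T. lookup m i \<ge> 1) \<or>
     (\<forall>B\<in>\<B>. T \<subseteq> B \<longrightarrow> l \<le> (\<Sum>i\<in>B. lookup m i) + card (B \<inter> S))"

lemma minor_exponent_add: "minor_exponent \<B> T S l m \<Longrightarrow> minor_exponent \<B> T S l (m + t)"
proof -
  have "(\<Sum>i\<in>B. lookup m i) \<le> (\<Sum>i\<in>B. lookup (m + t) i)" for B
    by (rule sum_mono) (simp add: lookup_add)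
  then show "minor_exponent \<B> T S l m \<Longrightarrow> minor_exponent \<B> T S l (m + t)"
    unfolding minor_exponent_def lookup_add by (meson add_le_mono1 order_trans trans_le_add1)
qed

text \<open>For a basis B through x both sides gain 1, the left in the degree of the exponent on B,
  the right in the size of \<open>B \<inter> S\<close>.\<close>

lemma minor_exponent_shift:
  assumes "\<And>B. B \<in> \<B> \<Longrightarrow> finite B" "x \<notin> T" "x \<notin> S" "finite S"
  shows "minor_exponent \<B> T S l (m + single x 1) \<longleftrightarrow> minor_exponent \<B> T (insert x S) l m"
proof -
  have "(\<Sum>i\<in>B. lookup (m + single x 1) i) + card (B \<inter> S) =
      (\<Sum>i\<in>B. lookup m i) + card (B \<inter> insert x S)" if "B \<in> \<B>" for B
    using assms(1)[OF that] assms(3,4)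
    by (cases "x \<in> B") (simp_all add: lookup_add lookup_single when_def sum.distrib)
  moreover have "lookup (m + single x 1) i = lookup m i" if "i \<in> T" for i
    using that assms(2) by (auto simp: lookup_add lookup_single when_def)
  ultimately show ?thesis unfolding minor_exponent_def by auto
qed

text \<open>For a basis \<open>B\<close> avoiding \<open>x\<close> the exchange property yields a basis through \<open>x\<close> on which the
  condition is at least as strong; so the bases avoiding \<open>x\<close> become redundant modulo \<open>x\<close>.\<close>

lemma minor_exponent_contract:
  assumes \<B>: "matroid_bases {1..n} \<B>" and A: "A \<in> \<B>" "insert x T \<subseteq> A" and x: "x \<notin> S" "x \<notin> T"
  shows "minor_exponent \<B> T S l m \<or> lookup m x \<ge> 1 \<longleftrightarrow> minor_exponent \<B> (insert x T) S l m"
proof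
  assume r: "minor_exponent \<B> (insert x T) S l m"
  show "minor_exponent \<B> T S l m \<or> lookup m x \<ge> 1"
  proof (rule ccontr)
    assume "\<not> ?thesis"
    then have not: "\<not> minor_exponent \<B> T S l m" and "\<not> lookup m x \<ge> 1" by blast+
    then have mx: "lookup m x = 0" by simp
    have mT: "lookup m i = 0" if "i \<in> T" for i
      using not that unfolding minor_exponent_def by (meson less_one not_le)
    obtain B where B: "B \<in> \<B>" "T \<subseteq> B" "\<not> l \<le> (\<Sum>i\<in>B. lookup m i) + card (B \<inter> S)"
      using not unfolding minor_exponent_def by blast
    have all: "l \<le> (\<Sum>i\<in>B'. lookup m i) + card (B' \<inter> S)" if "B' \<in> \<B>" "insert x T \<subseteq> B'" for B'
      using r mx mT that unfolding minor_exponent_def by auto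
    have xB: "x \<notin> B" using all[of B] B by auto
    \<comment> \<open>The element y that leaves B lies outside A, hence outside T, so the new basis
      still contains T. The entering x has exponent 0 and lies outside S, so neither summand
      grows.\<close>
    obtain y where y: "y \<in> B - A" "(B - {y}) \<union> {x} \<in> \<B>"
      using matroid_bases_dual_exchange[OF \<B> _ A(1) B(1), of x] A(2) xB by auto
    let ?B = "(B - {y}) \<union> {x}"
    have finB: "finite B" by (rule matroid_bases_finite(1)[OF \<B> _ B(1)]) simp
    have "(\<Sum>i\<in>?B. lookup m i) = (\<Sum>i\<in>B - {y}. lookup m i)"
      using finB xB mx by simp
    also have "\<dots> \<le> (\<Sum>i\<in>B. lookup m i)" using finB by (intro sum_mono2) auto
    finally have "(\<Sum>i\<in>?B. lookup m i) \<le> (\<Sum>i\<in>B. lookup m i)" .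
    moreover have "card (?B \<inter> S) \<le> card (B \<inter> S)" using finB x(1) by (intro card_mono) auto
    moreover have "insert x T \<subseteq> ?B" using y(1) B(2) A(2) by auto
    ultimately show False using all[OF y(2)] B(3) by linarith
  qed
qed (auto simp: minor_exponent_def)

text \<open>A colon enlarges S and a sum enlarges T, so the inner measure drops. When neither step
  applies, every basis B over T meets S in exactly B - T; then l drops by the rank r - card T of the
  contraction, and S becomes empty again. The filtration ends at unit ideals and at p_T for bases
  T.\<close>

theorem matroid_minor_regular:
  fixes z :: "nat \<Rightarrow> ('k::field) mvpoly"
  assumes \<B>: "matroid_bases {1..n} \<B>" and r: "\<And>B. B \<in> \<B> \<Longrightarrow> card B = r"
    and z: "\<And>j. j \<in> {1..n} \<Longrightarrow> univariate j (z j)"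
    and "S \<subseteq> {1..n}" "S \<inter> T = {}" "B\<^sub>0 \<in> \<B>" "T \<subseteq> B\<^sub>0"
  shows "weakly_regular (mvpoly_ring n) (monomial_ideal n (minor_exponent \<B> T S l))
    (map (esym {1..n} z) (rev [1..<n - r + 1]))"
  using assms(4-)
proof (induction l arbitrary: T S B\<^sub>0 rule: less_induct)
  case (less l)
  note outer = less.IH
  from less.prems show ?case
  proof (induction "(n - card T) + (n - card S)" arbitrary: T S B\<^sub>0 rule: less_induct)
    case less
    note R = cring_mvpoly[where 'k='k and n=n]
    have Bsub: "B \<subseteq> {1..n}" if "B \<in> \<B>" for B using \<B> that unfolding matroid_bases_def by blast
    have finB: "finite B" if "B \<in> \<B>" for B using Bsub[OF that] finite_subset by blast
    have Tsub: "T \<subseteq> {1..n}" using less.prems Bsub by blast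
    have finT: "finite T" and finS: "finite S" using Tsub less.prems finite_subset by blast+
    let ?I = "monomial_ideal n (minor_exponent \<B> T S l) :: 'k mvpoly set"
    let ?ts = "map (esym {1..n} z) (rev [1..<n - r + 1])"
    have zc: "z j \<in> carrier (mvpoly_ring n)" if "j \<in> {1..n}" for j
      using univariate_closed[OF z[OF that] that] .
    have ts: "set ?ts \<subseteq> carrier (mvpoly_ring n)" using esym_closed[of "{1..n}" z n] zc by auto
    have I: "ideal ?I (mvpoly_ring n)" by (rule monomial_ideal_ideal[of "minor_exponent \<B> T S l", OF minor_exponent_add])
    consider "l = 0" | "l > 0" "T \<in> \<B>"
      | x A where "x \<notin> T" "x \<notin> S" "A \<in> \<B>" "insert x T \<subseteq> A"
      | "l > 0" "T \<notin> \<B>" "\<And>A. A \<in> \<B> \<Longrightarrow> T \<subseteq> A \<Longrightarrow> A - T \<subseteq> S"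
      by blast
    then show ?case
    proof cases
      case 1
      then have "?I = carrier (mvpoly_ring n)" unfolding monomial_ideal_def minor_exponent_def by auto
      then show ?thesis using cring.weakly_regular_unit[OF R ts] by simp
    next
      case 2
      \<comment> \<open>T is disjoint from S, so the condition for B = T alone forces some variable
        of T to divide the monomial; the ideal is p_T.\<close>
      have "minor_exponent \<B> T S l m \<longleftrightarrow> (\<exists>i\<in>T. lookup m i \<ge> 1)" for m
      proof -
        have "\<exists>i\<in>T. lookup m i \<ge> 1"
          if "l \<le> (\<Sum>i\<in>T. lookup m i) + card (T \<inter> S)"
        proof (rule ccontr)
          assume "\<not> ?thesis"
          then have "(\<Sum>i\<in>T. lookup m i) = 0" by (intro sum.neutral) auto
          then show False using that 2(1) less.prems(2) by (simp add: Int_commute)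
        qed
        then show ?thesis unfolding minor_exponent_def using 2(2) by blast
      qed
      then have I_eq: "?I = monomial_ideal n (\<lambda>m. \<exists>i\<in>T. lookup m i \<ge> 1)"
        by (intro monomial_ideal_cong) blast
      have "weakly_regular (mvpoly_ring n) ?I (map (esym {1..n} z) (rev [1..<card ({1..n} - T) + 1]))"
      proof (rule esym_regular[OF z _ I])
        fix j assume j: "j \<in> {1..n} - ({1..n} - T)"
        then have j': "j \<in> {1..n}" "j \<in> T" by auto
        have "\<exists>i\<in>T. lookup m i \<ge> 1" if m: "m \<in> keys (z j)" for m
        proof -
          obtain k where "m = single j k" "k \<ge> 1" by (rule univariate_keys[OF z[OF j'(1)] m])
          then show ?thesis using j'(2) by (intro bexI[of _ j]) auto
        qed
        then show "z j \<in> ?I" unfolding I_eq unfolding monomial_ideal_def using zc[OF j'(1)] by simp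
      next
        fix j assume j: "j \<in> {1..n} - T"
        show "coeff_closed j ?I"
          unfolding coeff_closed_def
        proof (intro ballI allI)
          fix f k assume f: "f \<in> ?I"
          have "\<exists>i\<in>T. lookup m i \<ge> 1" if "m \<in> keys (coeff_var j k f)" for m
          proof -
            have "m + single j k \<in> keys f" using keys_coeff_var[OF that] by blast
            moreover have "\<forall>m\<in>keys f. \<exists>i\<in>T. lookup m i \<ge> 1"
              using f unfolding I_eq unfolding monomial_ideal_def by simp
            ultimately obtain i where i: "i \<in> T" "lookup (m + single j k) i \<ge> 1" by blast
            then have "i \<noteq> j" using j by blast
            then have "lookup m i \<ge> 1" using i(2) by (simp add: lookup_add lookup_single when_def)
            then show ?thesis using i(1) by blast
          qed
          then show "coeff_var j k f \<in> ?I" using f unfolding I_eq unfolding monomial_ideal_def by simp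
        qed
      qed auto
      moreover have "card ({1..n} - T) = n - r" using Tsub finT r[OF 2(2)] by (simp add: card_Diff_subset)
      ultimately show ?thesis by (simp only:)
    next
      case 3
      have x: "x \<in> {1..n}" using 3 Bsub by blast
      have cardT: "card T < n" "card S < n"
      proof -
        have "T \<subset> {1..n}" "S \<subset> {1..n}" using x 3(1,2) Tsub less.prems(1) by blast+
        moreover have "card A < n" if "A \<subset> {1..n}" for A using psubset_card_mono[OF _ that] by simp
        ultimately show "card T < n" "card S < n" by blast+
      qed
      have "colon_ideal (mvpoly_ring n) ?I (var x) = monomial_ideal n (minor_exponent \<B> T (insert x S) l)"
        unfolding var_def using colon_monomial_ideal[of "single x 1" n "minor_exponent \<B> T S l"] x
          minor_exponent_shift[OF finB 3(1,2) finS] by simp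
      moreover have "weakly_regular (mvpoly_ring n) (monomial_ideal n (minor_exponent \<B> T (insert x S) l)) ?ts"
        using less.prems x 3 cardT finS by (intro less.hyps) auto
      moreover have "adjoin (mvpoly_ring n) ?I (var x) = monomial_ideal n (minor_exponent \<B> (insert x T) S l)"
        using adjoin_var_monomial_ideal[OF x, of "minor_exponent \<B> T S l", OF minor_exponent_add] minor_exponent_contract[OF \<B> 3(3,4,2,1)] by simp
      moreover have "weakly_regular (mvpoly_ring n) (monomial_ideal n (minor_exponent \<B> (insert x T) S l)) ?ts"
        using less.prems x 3 cardT finT by (intro less.hyps) auto
      ultimately show ?thesis
        using cring.weakly_regular_filtration[OF R I var_closed[OF x] ts] by simp
    next
      case 4
      let ?r = "r - card T"
      have "T \<subset> B\<^sub>0" using less.prems(3,4) 4(2) by blast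
      then have "card T < r" using r[OF less.prems(3)] finB[OF less.prems(3)] psubset_card_mono by metis
      have "card (B \<inter> S) = ?r" if "B \<in> \<B>" "T \<subseteq> B" for B
      proof -
        have "B \<inter> S = B - T" using 4(3)[OF that] less.prems(2) by blast
        then show ?thesis using r[OF that(1)] finT that(2) by (simp add: card_Diff_subset)
      qed
      \<comment> \<open>Subtraction is truncated: for \<open>l \<le> ?r\<close> the new exponent is
        0 and the ideal is the unit ideal.\<close>
      then have "minor_exponent \<B> T S l m \<longleftrightarrow> minor_exponent \<B> T {} (l - ?r) m" for m
        unfolding minor_exponent_def by (auto simp: le_diff_conv)
      then have "?I = monomial_ideal n (minor_exponent \<B> T {} (l - ?r))"
        by (intro monomial_ideal_cong) blast
      moreover have "weakly_regular (mvpoly_ring n) (monomial_ideal n (minor_exponent \<B> T {} (l - ?r)) :: 'k mvpoly set) ?ts"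
        using 4(1) \<open>card T < r\<close> less.prems by (intro outer[of _ _ _ B\<^sub>0]) auto
      ultimately show ?thesis by simp
    qed
  qed
qed

section \<open>Dimension\<close>

text \<open>Gaussian elimination with one pivot: the unknown p is solved from equation b and
  substituted into the other equations, leaving one equation and one unknown less.\<close>

lemma linear_system_nontrivial_solution:
  fixes M :: "'a \<Rightarrow> 'b \<Rightarrow> 'k::field"
  assumes "finite B" "finite A" "card B < card A"
  shows "\<exists>c. (\<exists>a\<in>A. c a \<noteq> 0) \<and> (\<forall>b\<in>B. (\<Sum>a\<in>A. c a * M a b) = 0)"
  using assms
proof (induction B arbitrary: A M rule: finite_induct)
  case empty
  then obtain a where "a \<in> A" by fastforce
  then show ?case by (intro exI[of _ "\<lambda>_. 1"]) auto
next
  case (insert b B)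
  show ?case
  proof (cases "\<forall>a\<in>A. M a b = 0")
    case True
    have "card B < card A" using insert by simp
    then obtain c where "\<exists>a\<in>A. c a \<noteq> 0" "\<forall>b\<in>B. (\<Sum>a\<in>A. c a * M a b) = 0"
      using insert.IH[OF insert.prems(1), of M] by blast
    then show ?thesis using True by (intro exI[of _ c]) simp
  next
    case False
    then obtain p where p: "p \<in> A" "M p b \<noteq> 0" by blast
    let ?A = "A - {p}"
    let ?M = "\<lambda>a b'. M a b' - M a b / M p b * M p b'"
    have "card B < card ?A" using insert p by simp
    then obtain c a where c: "a \<in> ?A" "c a \<noteq> 0" "\<And>b'. b' \<in> B \<Longrightarrow> (\<Sum>a\<in>?A. c a * ?M a b') = 0"
      using insert.IH[of ?A ?M] insert.prems(1) by auto
    let ?s = "\<Sum>a\<in>?A. c a * M a b / M p b"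
    let ?c = "c(p := - ?s)"
    have sum: "(\<Sum>a\<in>A. ?c a * M a b') = (\<Sum>a\<in>?A. c a * M a b') - ?s * M p b'" for b'
    proof -
      have "(\<Sum>a\<in>A. ?c a * M a b') = ?c p * M p b' + (\<Sum>a\<in>?A. ?c a * M a b')"
        by (rule sum.remove[OF insert.prems(1) p(1)])
      also have "(\<Sum>a\<in>?A. ?c a * M a b') = (\<Sum>a\<in>?A. c a * M a b')" by (intro sum.cong) auto
      finally show ?thesis by simp
    qed
    have "(\<Sum>a\<in>A. ?c a * M a b') = 0" if b': "b' \<in> insert b B" for b'
    proof (cases "b' = b")
      case True
      then show ?thesis unfolding sum using p(2) by (simp add: sum_distrib_right)
    next
      case False
      then have "(\<Sum>a\<in>?A. c a * ?M a b') = 0" using c(3) b' by blast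
      moreover have "(\<Sum>a\<in>?A. c a * ?M a b') = (\<Sum>a\<in>?A. c a * M a b') - ?s * M p b'"
        by (simp add: algebra_simps sum_subtractf sum_distrib_left sum_distrib_right)
      ultimately show ?thesis unfolding sum by simp
    qed
    moreover have "\<exists>a\<in>A. ?c a \<noteq> 0" using c(1,2) by (intro bexI[of _ a]) auto
    ultimately show ?thesis by blast
  qed
qed

section \<open>Prime chains and algebraic independence\<close>

lemma prime_power_mem:
  assumes "primeideal P (mvpoly_ring n)" "y \<in> carrier (mvpoly_ring n)" "y \<notin> P"
    "g \<in> carrier (mvpoly_ring n)" "y ^ k * g \<in> P"
  shows "(g :: ('k::field) mvpoly) \<in> P"
  using assms(5)
proof (induction k)
  case (Suc k)
  have "y \<otimes>\<^bsub>mvpoly_ring n\<^esub> (y ^ k * g) \<in> P" using Suc(2) by (simp add: mult.assoc)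
  then have "y ^ k * g \<in> P"
    using primeideal.I_prime[OF assms(1,2), of "y ^ k * g"] assms by auto
  then show ?case by (rule Suc(1))
qed simp

text \<open>The terms of lowest degree in \<open>y\<^sub>j\<close> pass from \<open>P\<^sub>j\<close> to \<open>P\<^sub>j\<^sub>+\<^sub>1\<close>, since
  \<open>y\<^sub>j\<close> lies in the latter but not in the former.\<close>

lemma chain_algebraically_independent:
  fixes P :: "nat \<Rightarrow> ('k::field) mvpoly set"
  assumes P: "\<And>i. i \<le> Suc d \<Longrightarrow> primeideal (P i) (mvpoly_ring n)"
    and y: "\<And>i. i \<le> d \<Longrightarrow> y i \<in> P (Suc i) \<and> y i \<notin> P i" and mono: "\<And>i. i \<le> d \<Longrightarrow> P i \<subseteq> P (Suc i)"
    and "j \<le> Suc d" "finite F" "F \<noteq> {}" "\<And>a. a \<in> F \<Longrightarrow> c a \<noteq> 0"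
    and "\<And>a b. a \<in> F \<Longrightarrow> b \<in> F \<Longrightarrow> (\<And>i. i \<in> {j..d} \<Longrightarrow> a i = b i) \<Longrightarrow> a = b"
    and "(\<Sum>a\<in>F. single 0 (c a) * (\<Prod>i\<in>{j..d}. y i ^ a i)) \<in> P j"
  shows False
  using assms(4-)
proof (induction "Suc d - j" arbitrary: j F)
  case 0
  then have j: "j = Suc d" by simp
  interpret Pj: primeideal "P j" "mvpoly_ring n" using P j by simp
  obtain a where a: "a \<in> F" using 0 by blast
  \<comment> \<open>The index set \<open>{j..d}\<close> is now empty, so all exponent vectors in F
    agree; what remains is a nonzero constant in a prime ideal.\<close>
  have "F = {a}" using 0(6) a unfolding j by force
  then have "single 0 (c a) \<in> P j" using 0(7) unfolding j by simp
  then have "single 0 (inverse (c a)) * single 0 (c a) \<in> P j"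
    by (rule mvpoly_ideal_closed(3)[OF Pj.is_ideal]) simp
  then have "1 \<in> P j" using 0(5)[OF a] by (simp add: mult_single)
  then show False using Pj.one_imp_carrier Pj.I_notcarr by simp
next
  case (Suc k)
  then have j: "j \<le> d" by simp
  have Pj: "primeideal (P j) (mvpoly_ring n)" and PS: "primeideal (P (Suc j)) (mvpoly_ring n)" using P j by auto
  have Pid: "ideal (P i) (mvpoly_ring n)" if "i \<le> Suc d" for i using P[OF that] by (rule primeideal.axioms)
  have yc: "y i \<in> carrier (mvpoly_ring n)" if "i \<le> d" for i
    using mvpoly_ideal_closed(5)[OF Pid[of "Suc i"]] y[OF that] that by simp
  \<comment> \<open>The least exponent of \<open>y j\<close>: the common factor
    \<open>y j ^ \<mu>\<close> is cancelled modulo \<open>P j\<close>, and modulo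
    \<open>P (Suc j)\<close> only the terms attaining \<mu> survive.\<close>
  define \<mu> where "\<mu> = Min ((\<lambda>a. a j) ` F)"
  have \<mu>le: "\<mu> \<le> a j" if "a \<in> F" for a unfolding \<mu>_def using that Suc(4) by simp
  have "\<mu> \<in> (\<lambda>a. a j) ` F" unfolding \<mu>_def using Suc(4,5) by (intro Min_in) auto
  then have F'ne: "{a\<in>F. a j = \<mu>} \<noteq> {}" by auto
  let ?F = "{a\<in>F. a j = \<mu>}"
  let ?p = "\<lambda>a. \<Prod>i\<in>{Suc j..d}. y i ^ a i"
  let ?t = "\<lambda>a. single 0 (c a) * (y j ^ (a j - \<mu>) * ?p a)"
  have pc: "?p a \<in> carrier (mvpoly_ring n)" for a using yc by (intro mvpoly_prod_closed) auto
  have tc: "?t a \<in> carrier (mvpoly_ring n)" for a using pc yc[OF j] by auto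
  have split: "{j..d} = insert j {Suc j..d}" using j by auto
  have "(\<Sum>a\<in>F. single 0 (c a) * (\<Prod>i\<in>{j..d}. y i ^ a i)) = y j ^ \<mu> * (\<Sum>a\<in>F. ?t a)"
    unfolding sum_distrib_left
  proof (rule sum.cong[OF refl])
    fix a assume a: "a \<in> F"
    have "y j ^ a j = y j ^ \<mu> * y j ^ (a j - \<mu>)" using \<mu>le[OF a] by (simp add: power_add[symmetric])
    then show "single 0 (c a) * (\<Prod>i\<in>{j..d}. y i ^ a i) = y j ^ \<mu> * ?t a"
      unfolding split by (simp add: mult.assoc mult.left_commute)
  qed
  then have "y j ^ \<mu> * (\<Sum>a\<in>F. ?t a) \<in> P j" using Suc(8) by simp
  moreover have "(\<Sum>a\<in>F. ?t a) \<in> carrier (mvpoly_ring n)" by (intro mvpoly_sum_closed tc)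
  moreover have "y j \<notin> P j" using y[OF j] by blast
  ultimately have "(\<Sum>a\<in>F. ?t a) \<in> P j" using prime_power_mem[OF Pj yc[OF j]] by blast
  then have G: "(\<Sum>a\<in>F. ?t a) \<in> P (Suc j)" using mono[OF j] by blast
  have "(\<Sum>a\<in>F - ?F. ?t a) \<in> P (Suc j)"
  proof (rule mvpoly_ideal_closed(8)[OF Pid])
    fix a assume a: "a \<in> F - ?F"
    then have "\<exists>e. a j - \<mu> = Suc e" using \<mu>le[of a] by (intro exI[of _ "a j - \<mu> - 1"]) auto
    then obtain e where e: "a j - \<mu> = Suc e" by blast
    have eq: "?t a = (single 0 (c a) * (y j ^ e * ?p a)) * y j"
      unfolding e by (simp add: mult_ac)
    have "single 0 (c a) * (y j ^ e * ?p a) \<in> carrier (mvpoly_ring n)"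
      using pc yc[OF j] by (intro mvpoly_closed(4) mvpoly_closed(7)) auto
    then show "?t a \<in> P (Suc j)"
      unfolding eq using mvpoly_ideal_closed(3)[OF Pid[of "Suc j"], of "y j"] y[OF j] j by simp
  qed (use j in simp)
  moreover have "(\<Sum>a\<in>F. ?t a) = (\<Sum>a\<in>F - ?F. ?t a) + (\<Sum>a\<in>?F. ?t a)"
    using Suc(4) by (intro sum.subset_diff) auto
  ultimately have "(\<Sum>a\<in>?F. ?t a) \<in> P (Suc j)"
    using mvpoly_ideal_closed(7)[OF Pid[of "Suc j"] G, of "\<Sum>a\<in>F - ?F. ?t a"] j by simp
  moreover have "(\<Sum>a\<in>?F. ?t a) = (\<Sum>a\<in>?F. single 0 (c a) * ?p a)"
    by (intro sum.cong) auto
  ultimately have "(\<Sum>a\<in>?F. single 0 (c a) * ?p a) \<in> P (Suc j)" by simp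
  then show False
  proof (rule Suc(1)[rotated -1])
    fix a b assume ab: "a \<in> ?F" "b \<in> ?F" "\<And>i. i \<in> {Suc j..d} \<Longrightarrow> a i = b i"
    show "a = b"
    proof (rule Suc(7))
      fix i assume "i \<in> {j..d}"
      then show "a i = b i" using ab unfolding split by auto
    qed (use ab in auto)
  qed (use Suc F'ne j in auto)
qed

text \<open>Each exponent is bounded separately, not the total degree, so that the admissible
  monomials fill a box and their number is a product.\<close>

definition exponents_le :: "nat \<Rightarrow> ('k::zero) mvpoly \<Rightarrow> bool" where
  "exponents_le D f \<longleftrightarrow> (\<forall>m\<in>keys f. \<forall>v. lookup m v \<le> D)"

lemma exponents_le_mult:
  assumes "exponents_le D f" "exponents_le E g"
  shows "exponents_le (D + E) (f * (g :: ('k::field) mvpoly))"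
  unfolding exponents_le_def
proof (intro ballI allI)
  fix m v assume "m \<in> keys (f * g)"
  then have "m \<in> {a + b |a b. a \<in> keys f \<and> b \<in> keys g}" using keys_mult by (rule subsetD[rotated])
  then obtain a b where ab: "m = a + b" "a \<in> keys f" "b \<in> keys g" by auto
  then have "lookup a v \<le> D" "lookup b v \<le> E" using assms unfolding exponents_le_def by auto
  then show "lookup m v \<le> D + E" unfolding ab(1) lookup_add by simp
qed

lemma exponents_le_power: "exponents_le D f \<Longrightarrow> exponents_le (k * D) ((f :: ('k::field) mvpoly) ^ k)"
proof (induction k)
  case 0
  then show ?case by (simp add: exponents_le_def)
next
  case (Suc k)
  then show ?case using exponents_le_mult[of D f "k * D" "f ^ k"] by simp
qed

lemma exponents_le_prod:
  "(\<And>i. i \<in> A \<Longrightarrow> exponents_le (D i) (f i)) \<Longrightarrow> finite A \<Longrightarrow>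
    exponents_le (\<Sum>i\<in>A. D i) (\<Prod>i\<in>A. f i :: ('k::field) mvpoly)"
proof (induction A rule: infinite_finite_induct)
  case empty
  then show ?case by (simp add: exponents_le_def)
next
  case (insert i A)
  then show ?case using exponents_le_mult[of "D i" "f i"] by simp
qed simp

lemma lookup_scale: "lookup (single 0 c * f) m = (c :: 'k::field) * lookup (f :: 'k mvpoly) m"
  unfolding mult_map_scale_conv_mult[symmetric] by (simp add: Poly_Mapping.map.rep_eq when_def)

lemma card_bounded_monomials:
  assumes B: "B \<subseteq> {1..n}" "card B = r"
  shows "finite {m :: monom_exp. keys m \<subseteq> {1..n} \<and> (\<forall>v. lookup m v \<le> K) \<and> (\<forall>i\<in>B. lookup m i < l)}"
    (is "finite ?S")
    and "card {m :: monom_exp. keys m \<subseteq> {1..n} \<and> (\<forall>v. lookup m v \<le> K) \<and> (\<forall>i\<in>B. lookup m i < l)}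
      \<le> l ^ r * Suc K ^ (n - r)"
proof -
  let ?g = "\<lambda>m :: monom_exp. restrict (lookup m) {1..n}"
  let ?T = "PiE {1..n} (\<lambda>i. if i \<in> B then {..<l} else {..K})"
  have finB: "finite B" using B(1) finite_subset by blast
  have inj: "inj_on ?g ?S"
  proof (rule inj_onI)
    fix m t assume mt: "m \<in> ?S" "t \<in> ?S" "?g m = ?g t"
    show "m = t"
    proof (rule poly_mapping_eqI)
      fix v show "lookup m v = lookup t v"
      proof (cases "v \<in> {1..n}")
        case True
        then show ?thesis using fun_cong[OF mt(3), of v] by simp
      next
        case False
        then have "v \<notin> keys m" "v \<notin> keys t" using mt by auto
        then show ?thesis by (simp add: in_keys_iff)
      qed
    qed
  qed
  have sub: "?g ` ?S \<subseteq> ?T" by (auto simp: PiE_iff)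
  have finT: "finite ?T" by (intro finite_PiE) auto
  show "finite ?S" using inj_on_finite[OF inj sub finT] .
  have "card ?S \<le> card ?T" by (rule card_inj_on_le[OF inj sub finT])
  also have "card ?T = (\<Prod>i\<in>{1..n}. if i \<in> B then l else Suc K)"
    by (subst card_PiE) (auto intro!: prod.cong)
  also have "\<dots> = (\<Prod>i\<in>B. l) * (\<Prod>i\<in>{1..n} - B. Suc K)"
    using B(1) by (simp add: prod.If_cases Int_absorb1 Diff_eq)
  also have "\<dots> = l ^ r * Suc K ^ (n - r)"
    using B finB by (simp add: card_Diff_subset)
  finally show "card ?S \<le> l ^ r * Suc K ^ (n - r)" .
qed

text \<open>A chain of length d + 1 yields y_0, ..., y_d without a nontrivial polynomial relation
  over K in \<open>Q 0\<close>. Their powers below N have N^(d+1) products, whose exponents grow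
  linearly in N, but only O(N^d) monomials of that size lie outside I. For large N some nontrivial
  combination of the products lies in I, hence in \<open>Q 0\<close>.\<close>

theorem prime_chain_length_le:
  fixes Q :: "nat \<Rightarrow> ('k::field) mvpoly set"
  assumes \<B>: "finite \<B>" "\<And>B. B \<in> \<B> \<Longrightarrow> B \<subseteq> {1..n} \<and> card B = r"
    and U: "\<And>m. \<not> U m \<Longrightarrow> \<exists>B\<in>\<B>. \<forall>i\<in>B. lookup m i < l"
    and Q: "\<forall>i\<le>k. primeideal (Q i) (mvpoly_ring n)" "\<forall>i<k. Q i \<subset> Q (Suc i)"
    and I: "monomial_ideal n U \<subseteq> Q 0"
  shows "k \<le> n - r"
proof (rule ccontr)
  define d where "d = n - r"
  assume "\<not> k \<le> n - r"
  then have k: "Suc d \<le> k" unfolding d_def by simp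
  have "\<forall>i. \<exists>y. i \<le> d \<longrightarrow> y \<in> Q (Suc i) \<and> y \<notin> Q i" using Q(2) k by (meson Suc_le_lessD le_trans not_less_eq_eq psubset_imp_ex_mem Diff_iff)
  then obtain y where y: "\<And>i. i \<le> d \<Longrightarrow> y i \<in> Q (Suc i) \<and> y i \<notin> Q i" by metis
  have Qid: "ideal (Q i) (mvpoly_ring n)" if "i \<le> k" for i using Q(1) that by (simp add: primeideal.axioms(1))
  have yc: "y i \<in> carrier (mvpoly_ring n)" if "i \<le> d" for i
    using mvpoly_ideal_closed(5)[OF Qid[of "Suc i"]] y[OF that] that k by simp
  \<comment> \<open>The added 0 keeps the set nonempty when n = 0.\<close>
  define D where "D = Max ((\<lambda>(m, v). lookup m v) ` (\<Union>i\<in>{..d}. keys (y i) \<times> {1..n}) \<union> {0})"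
  have yD: "exponents_le D (y i)" if "i \<le> d" for i
    unfolding exponents_le_def
  proof (intro ballI allI)
    fix m v assume m: "m \<in> keys (y i)"
    show "lookup m v \<le> D"
    proof (cases "v \<in> {1..n}")
      case True
      have "lookup m v \<in> (\<lambda>(m, v). lookup m v) ` (\<Union>i\<in>{..d}. keys (y i) \<times> {1..n})"
        using True m that by (intro image_eqI[of _ _ "(m, v)"]) auto
      then show ?thesis unfolding D_def by (intro Max_ge) auto
    next
      case False
      then have "v \<notin> keys m" using yc[OF that] m unfolding mem_mvpoly_ring by blast
      then show ?thesis by (simp add: in_keys_iff)
    qed
  qed
  \<comment> \<open>C (K + 1)^d bounds the number of monomials outside I with exponents up to K. As
    K + 1 is at most N ((d + 1) D + 1), choosing N above C ((d + 1) D + 1)^d makes N^(d+1) exceed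
    that bound.\<close>
  define C where "C = card \<B> * l ^ r"
  define N where "N = C * (Suc d * D + 1) ^ d + 1"
  define K where "K = Suc d * (N * D)"
  let ?A = "PiE {..d} (\<lambda>_. {..<N})"
  let ?Y = "\<lambda>a. \<Prod>i\<in>{..d}. y i ^ a i"
  let ?S = "\<lambda>B. {m :: monom_exp. keys m \<subseteq> {1..n} \<and> (\<forall>v. lookup m v \<le> K) \<and> (\<forall>i\<in>B. lookup m i < l)}"
  let ?M = "{m :: monom_exp. keys m \<subseteq> {1..n} \<and> (\<forall>v. lookup m v \<le> K) \<and> \<not> U m}"
  have sub: "?M \<subseteq> (\<Union>B\<in>\<B>. ?S B)"
  proof
    fix m assume m: "m \<in> ?M"
    then obtain B where B: "B \<in> \<B>" "\<forall>i\<in>B. lookup m i < l" using U[of m] by blast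
    then have "m \<in> ?S B" using m by simp
    then show "m \<in> (\<Union>B\<in>\<B>. ?S B)" using B(1) by blast
  qed
  have bnd: "finite (?S B)" "card (?S B) \<le> l ^ r * Suc K ^ d" if "B \<in> \<B>" for B
    using card_bounded_monomials[of B n r K l] \<B>(2)[OF that] unfolding d_def by blast+
  have finS: "finite (\<Union>B\<in>\<B>. ?S B)" by (intro finite_UN_I \<B>(1) bnd(1))
  have finM: "finite ?M" using finite_subset[OF sub finS] .
  have "card ?M \<le> card (\<Union>B\<in>\<B>. ?S B)" by (rule card_mono[OF finS sub])
  also have "\<dots> \<le> (\<Sum>B\<in>\<B>. card (?S B))" by (rule card_UN_le[OF \<B>(1)])
  also have "\<dots> \<le> (\<Sum>B\<in>\<B>. l ^ r * Suc K ^ d)"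
    by (intro sum_mono bnd(2))
  also have "\<dots> = C * Suc K ^ d" by (simp add: C_def)
  also have "\<dots> \<le> C * (N * (Suc d * D + 1)) ^ d"
  proof (intro mult_left_mono power_mono)
    show "Suc K \<le> N * (Suc d * D + 1)" unfolding K_def N_def by (simp add: algebra_simps)
  qed auto
  also have "\<dots> = N ^ d * (C * (Suc d * D + 1) ^ d)" by (simp only: power_mult_distrib mult_ac)
  also have "\<dots> < N ^ d * N"
  proof -
    have "C * (Suc d * D + 1) ^ d < N" "0 < N" unfolding N_def by auto
    then show ?thesis by (intro mult_strict_left_mono) auto
  qed
  also have "\<dots> = card ?A" by (simp add: card_PiE)
  finally have "card ?M < card ?A" .
  moreover have finA: "finite ?A" by (intro finite_PiE) auto
  ultimately obtain c :: "(nat \<Rightarrow> nat) \<Rightarrow> 'k" where c: "\<exists>a\<in>?A. c a \<noteq> 0" "\<And>m. m \<in> ?M \<Longrightarrow> (\<Sum>a\<in>?A. c a * lookup (?Y a) m) = 0"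
    using linear_system_nontrivial_solution[OF finM, of ?A "\<lambda>a m. lookup (?Y a) m"] by blast
  let ?f = "\<Sum>a\<in>?A. single 0 (c a) * ?Y a"
  have Yc: "?Y a \<in> carrier (mvpoly_ring n)" for a using yc by (intro mvpoly_prod_closed) auto
  have fc: "?f \<in> carrier (mvpoly_ring n)" using Yc by (intro mvpoly_sum_closed mvpoly_closed(4)) auto
  have lf: "lookup ?f m = (\<Sum>a\<in>?A. c a * lookup (?Y a) m)" for m
    by (simp add: lookup_sum lookup_scale)
  have YX: "lookup m v \<le> K" if a: "a \<in> ?A" and m: "m \<in> keys (?Y a)" for a m v
  proof -
    have "exponents_le (\<Sum>i\<in>{..d}. a i * D) (?Y a)"
      using yD by (intro exponents_le_prod exponents_le_power) auto
    then have "lookup m v \<le> (\<Sum>i\<in>{..d}. a i * D)" using m unfolding exponents_le_def by blast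
    also have "\<dots> \<le> (\<Sum>i\<in>{..d}. N * D)"
      using a by (intro sum_mono mult_right_mono) (auto simp: PiE_iff less_imp_le)
    also have "\<dots> = K" by (simp add: K_def)
    finally show ?thesis .
  qed
  have "U m" if m: "m \<in> keys ?f" for m
  proof (rule ccontr)
    assume nU: "\<not> U m"
    have nz: "(\<Sum>a\<in>?A. c a * lookup (?Y a) m) \<noteq> 0" using m unfolding in_keys_iff lf .
    then obtain a where a: "a \<in> ?A" "c a * lookup (?Y a) m \<noteq> 0" by (meson sum.neutral)
    then have "m \<in> keys (?Y a)" by (simp add: in_keys_iff)
    then have "lookup m v \<le> K" for v using YX[OF a(1)] by blast
    moreover have "keys m \<subseteq> {1..n}" using fc m unfolding mem_mvpoly_ring by blast
    ultimately have "m \<in> ?M" using nU by blast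
    then show False using c(2) nz by blast
  qed
  then have f0: "?f \<in> Q 0" using I fc unfolding monomial_ideal_def by blast
  let ?F = "{a \<in> ?A. c a \<noteq> 0}"
  have "(\<Sum>a\<in>?F. single 0 (c a) * (\<Prod>i\<in>{0..d}. y i ^ a i)) = ?f"
    unfolding atLeast0AtMost using finA by (intro sum.mono_neutral_left) auto
  then have "(\<Sum>a\<in>?F. single 0 (c a) * (\<Prod>i\<in>{0..d}. y i ^ a i)) \<in> Q 0" using f0 by simp
  then show False
  proof (rule chain_algebraically_independent[of d Q n y 0 ?F c, rotated -1])
    show "primeideal (Q i) (mvpoly_ring n)" if "i \<le> Suc d" for i using Q(1) k that by simp
    show "Q i \<subseteq> Q (Suc i)" if "i \<le> d" for i using Q(2) k that by (meson Suc_le_lessD le_trans not_less_eq_eq psubset_imp_subset)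
    \<comment> \<open>Functions in \<open>?A\<close> take the value \<open>undefined\<close> outside
      \<open>{..d}\<close>, so agreement on that set is equality.\<close>
    show "a = b" if ab: "a \<in> ?F" "b \<in> ?F" "\<And>i. i \<in> {0..d} \<Longrightarrow> a i = b i" for a b
      using ab by (intro PiE_ext[of a "{..d}" "\<lambda>_. {..<N}" b]) auto
  qed (use y c(1) finA in auto)
qed

section \<open>Zariski's lemma\<close>

text \<open>The order is strictly compatible with addition, so the sum of the leading exponents
  arises from the two leading terms alone and nothing cancels it.\<close>

lemma lead_monom_mult:
  assumes "f \<noteq> 0" "g \<noteq> 0"
  shows "lead_monom f + lead_monom g \<in> keys (f * (g :: ('k::field) mvpoly))"
proof -
  let ?a = "lead_monom f" and ?b = "lead_monom g"
  have eq: "m + t = ?a + ?b \<longleftrightarrow> m = ?a \<and> t = ?b" if "m \<in> keys f" "t \<in> keys g" for m t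
  proof
    assume s: "m + t = ?a + ?b"
    have le: "m \<le> ?a" "t \<le> ?b" using lead_monom_ge that by blast+
    have "m = ?a"
    proof (rule ccontr)
      assume "m \<noteq> ?a"
      then have "m + t < ?a + ?b" using le by (intro add_less_le_mono) auto
      then show False using s by simp
    qed
    then show "m = ?a \<and> t = ?b" using s by simp
  qed simp
  have "lookup (f * g) (?a + ?b) =
    (\<Sum>m\<in>keys f. \<Sum>t\<in>keys g. if m + t = ?a + ?b then lookup f m * lookup g t else 0)"
    unfolding mvpoly_mult_expand[of f g] lookup_sum lookup_single when_def ..
  also have "\<dots> = (\<Sum>m\<in>keys f. \<Sum>t\<in>keys g. if t = ?b then (if m = ?a then lookup f m * lookup g t else 0) else 0)"
    by (intro sum.cong refl) (simp add: eq)
  also have "\<dots> = (\<Sum>m\<in>keys f. if m = ?a then lookup f m * lookup g ?b else 0)"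
    using lead_monom_in[OF assms(2)] by (intro sum.cong refl) simp
  also have "\<dots> = lookup f ?a * lookup g ?b"
    using lead_monom_in[OF assms(1)] by simp
  finally show ?thesis
    using lead_monom_in[OF assms(1)] lead_monom_in[OF assms(2)] by (simp add: in_keys_iff)
qed

text \<open>The leading exponents of f and g add up to 0, the least exponent, so both are 0.\<close>

lemma mvpoly_unit_const:
  assumes "f * g = (1 :: ('k::field) mvpoly)"
  shows "keys f \<subseteq> {0}"
proof
  have ne: "f \<noteq> 0" "g \<noteq> 0" using assms by auto
  have "lead_monom f + lead_monom g = 0" using lead_monom_mult[OF ne] unfolding assms by simp
  then have l0: "lead_monom f \<le> 0"
    using add_left_mono[OF zero_le_monom[of "lead_monom g"], of "lead_monom f"] by simp
  fix m assume "m \<in> keys f"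
  then have "m \<le> 0" using lead_monom_ge l0 by (meson order_trans)
  then show "m \<in> {0}" using zero_le_monom[of m] by simp
qed

section \<open>The subrings K[T], spans and independence over them\<close>

definition polys_in :: "nat set \<Rightarrow> ('k::field) mvpoly set" where
  "polys_in T = {f. \<forall>m\<in>keys f. keys m \<subseteq> T}"

lemma polys_in_closed:
  fixes p q :: "('k::field) mvpoly"
  shows "0 \<in> polys_in T" "1 \<in> polys_in T" "single 0 c \<in> polys_in T"
    "p \<in> polys_in T \<Longrightarrow> q \<in> polys_in T \<Longrightarrow> p + q \<in> polys_in T"
    "p \<in> polys_in T \<Longrightarrow> q \<in> polys_in T \<Longrightarrow> p * q \<in> polys_in T"
    "p \<in> polys_in T \<Longrightarrow> - p \<in> polys_in T"
    "p \<in> polys_in T \<Longrightarrow> p ^ k \<in> polys_in T"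
    "t \<in> T \<Longrightarrow> var t \<in> polys_in T"
proof -
  show one: "1 \<in> polys_in T" "0 \<in> polys_in T" "single 0 c \<in> polys_in T"
    "t \<in> T \<Longrightarrow> var t \<in> polys_in T" by (auto simp: polys_in_def var_def)
  show "p \<in> polys_in T \<Longrightarrow> - p \<in> polys_in T" unfolding polys_in_def by (simp add: keys_uminus_eq)
  have mult: "p * q \<in> polys_in T" if "p \<in> polys_in T" "q \<in> polys_in T" for p q :: "'k mvpoly"
    unfolding polys_in_def
  proof (intro CollectI ballI)
    fix m assume "m \<in> keys (p * q)"
    then have "m \<in> {a + b |a b. a \<in> keys p \<and> b \<in> keys q}" using keys_mult by (rule subsetD[rotated])
    then obtain a b where ab: "m = a + b" "a \<in> keys p" "b \<in> keys q" by auto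
    then show "keys m \<subseteq> T" using that unfolding ab(1) keys_plus_nat polys_in_def by auto
  qed
  then show "p \<in> polys_in T \<Longrightarrow> q \<in> polys_in T \<Longrightarrow> p * q \<in> polys_in T" .
  show "p \<in> polys_in T \<Longrightarrow> q \<in> polys_in T \<Longrightarrow> p + q \<in> polys_in T"
    unfolding polys_in_def using keys_add[of p q] by blast
  show "p \<in> polys_in T \<Longrightarrow> p ^ k \<in> polys_in T" by (induction k) (auto intro: one mult)
qed

lemma polys_in_prod: "(\<And>i. i \<in> A \<Longrightarrow> f i \<in> polys_in T) \<Longrightarrow> prod f A \<in> polys_in T"
  by (induction A rule: infinite_finite_induct) (auto intro: polys_in_closed)

lemma polys_in_carrier: "T \<subseteq> {1..n} \<Longrightarrow> p \<in> polys_in T \<Longrightarrow> p \<in> carrier (mvpoly_ring n)"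
  unfolding polys_in_def mem_mvpoly_ring by blast

lemma mvpoly_ring_induct [consumes 1, case_names const add var_mult]:
  assumes f: "f \<in> carrier (mvpoly_ring n :: ('k::field) mvpoly ring)"
    and const: "\<And>c. P (single 0 c)"
    and add: "\<And>f g. P f \<Longrightarrow> P g \<Longrightarrow> P (f + g)"
    and mult: "\<And>i f. i \<in> {1..n} \<Longrightarrow> P f \<Longrightarrow> P (var i * f)"
  shows "P f"
proof -
  have single: "P (single m c)" if "keys m \<subseteq> {1..n}" for m c
    using that
  proof (induction "\<Sum>i\<in>{1..n}. lookup m i" arbitrary: m)
    case 0
    have "m = 0"
    proof (rule poly_mapping_eqI)
      fix i show "lookup m i = lookup 0 i"
        using 0 by (cases "i \<in> {1..n}") (auto simp: in_keys_iff)
    qed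
    then show ?case using const by simp
  next
    case (Suc k)
    then have "(\<Sum>i\<in>{1..n}. lookup m i) \<noteq> 0" by linarith
    then obtain i where i: "i \<in> {1..n}" "lookup m i \<noteq> 0" by (meson sum.neutral)
    define t where "t = m - single i 1"
    have mt: "m = t + single i 1"
      unfolding t_def using i by (intro poly_mapping_eqI) (auto simp: lookup_add lookup_minus lookup_single when_def)
    have "(\<Sum>j\<in>{1..n}. lookup m j) = (\<Sum>j\<in>{1..n}. lookup t j) + (\<Sum>j\<in>{1..n}. if i = j then 1 else 0)"
      unfolding mt lookup_add lookup_single when_def sum.distrib ..
    then have "k = (\<Sum>j\<in>{1..n}. lookup t j)" using Suc(2) i(1) by simp
    moreover have "keys t \<subseteq> {1..n}" using Suc(3) unfolding mt keys_plus_nat by blast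
    ultimately have "P (single t c)" using Suc(1) by blast
    then have "P (var i * single t c)" by (rule mult[OF i(1)])
    moreover have "var i * single t c = single m c"
      unfolding var_def mult_single mt by (simp add: add.commute)
    ultimately show ?case by simp
  qed
  have "P (\<Sum>m\<in>A. single m (lookup f m))" if "finite A" "A \<subseteq> keys f" for A
    using that
  proof (induction A rule: finite_induct)
    case empty
    then show ?case using const[of 0] by simp
  next
    case (insert m A)
    then have "keys m \<subseteq> {1..n}" using f unfolding mem_mvpoly_ring by blast
    then show ?case using insert add single by simp
  qed
  then show ?thesis using mvpoly_expand[of f] by (metis finite_keys order_refl)
qed

definition poly_span :: "nat set \<Rightarrow> monom_exp set \<Rightarrow> ('k::field) mvpoly set" where
  "poly_span T E = {\<Sum>m\<in>E. c m * single m 1 | c. \<forall>m. c m \<in> polys_in T}"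

lemma poly_span_closed:
  fixes f g :: "('k::field) mvpoly"
  shows "0 \<in> poly_span T E"
    "f \<in> poly_span T E \<Longrightarrow> g \<in> poly_span T E \<Longrightarrow> f + g \<in> poly_span T E"
    "f \<in> poly_span T E \<Longrightarrow> q \<in> polys_in T \<Longrightarrow> q * f \<in> poly_span T E"
    "finite E \<Longrightarrow> m \<in> E \<Longrightarrow> single m 1 \<in> poly_span T E"
proof -
  show "0 \<in> poly_span T E"
    unfolding poly_span_def by (intro CollectI exI[of _ "\<lambda>_. 0"]) (simp add: polys_in_closed(1))
  show "f + g \<in> poly_span T E" if fg: "f \<in> poly_span T E" "g \<in> poly_span T E"
  proof -
    obtain c d where "f = (\<Sum>m\<in>E. c m * single m 1)" "g = (\<Sum>m\<in>E. d m * single m 1)"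
      "\<forall>m. c m \<in> polys_in T" "\<forall>m. d m \<in> polys_in T" using fg unfolding poly_span_def by auto
    then show ?thesis
      unfolding poly_span_def
      by (intro CollectI exI[of _ "\<lambda>m. c m + d m"]) (simp add: sum.distrib distrib_right polys_in_closed(4))
  qed
  show "q * f \<in> poly_span T E" if fq: "f \<in> poly_span T E" "q \<in> polys_in T"
  proof -
    obtain c where "f = (\<Sum>m\<in>E. c m * single m 1)" "\<forall>m. c m \<in> polys_in T" using fq unfolding poly_span_def by auto
    then show ?thesis
      unfolding poly_span_def
      by (intro CollectI exI[of _ "\<lambda>m. q * c m"]) (simp add: sum_distrib_left mult.assoc polys_in_closed(5)[OF fq(2)])
  qed
  show "single m 1 \<in> poly_span T E" if "finite E" "m \<in> E"
    unfolding poly_span_def using that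
    by (intro CollectI exI[of _ "\<lambda>t. if t = m then 1 else 0"])
      (auto simp: if_distrib[of "\<lambda>x. x * _"] polys_in_closed(1,2) cong: if_cong)
qed

text \<open>Linear independence over K[T] of the monomials of E as elements of R/M.\<close>

definition poly_indep :: "('k::field) mvpoly set \<Rightarrow> nat set \<Rightarrow> monom_exp set \<Rightarrow> bool" where
  "poly_indep M T E \<longleftrightarrow> (\<forall>c. (\<forall>m. c m \<in> polys_in T) \<longrightarrow>
     (\<Sum>m\<in>E. c m * single m 1) \<in> M \<longrightarrow> (\<forall>m\<in>E. c m = 0))"

text \<open>Suppose that the variables in \<open>T\<close> are algebraically independent modulo \<open>M\<close>, and that
  multiplication by \<open>c\<close> takes all \<open>x\<^sub>i e\<close> into the \<open>K[T]\<close>-span \<open>V\<close> of finitely many independent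
  monomials \<open>e\<close>. Then \<open>V\<close> localized at \<open>c\<close> is everything, so in the field \<open>R/M\<close> the inverse of
  \<open>1 + x\<^sub>t c\<close> has the form \<open>v/c\<^sup>N\<close> with \<open>v\<close> in \<open>V\<close>. By independence \<open>1 + x\<^sub>t c\<close> divides \<open>c\<^sup>N\<close> in
  \<open>K[T]\<close>, which is absurd.\<close>

lemma no_finite_span:
  fixes M :: "('k::field) mvpoly set"
  assumes M: "maximalideal M (mvpoly_ring n)" and T: "T \<subseteq> {1..n}" "t \<in> T" and MT: "M \<inter> polys_in T \<subseteq> {0}"
    and E: "finite E" "0 \<in> E" "poly_indep M T E" and c: "c \<in> polys_in T" "c \<noteq> 0"
    and step: "\<And>i e. i \<in> {1..n} - T \<Longrightarrow> e \<in> E \<Longrightarrow>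
      \<exists>a\<in>M. \<exists>v\<in>poly_span T E. c * (var i * single e 1) = a + v"
  shows False
proof -
  interpret M: maximalideal M "mvpoly_ring n" by fact
  note cl = mvpoly_ideal_closed[OF M.is_ideal]
  note sp = poly_span_closed[where T=T and E=E]
  define V where "V = {a + v | a v. a \<in> M \<and> v \<in> poly_span T E}"
  have V_I: "a + v \<in> V" if "a \<in> M" "v \<in> poly_span T E" for a v unfolding V_def using that by blast
  have V_E: "\<exists>a v. a \<in> M \<and> v \<in> poly_span T E \<and> f = a + v" if "f \<in> V" for f using that unfolding V_def by blast
  have V_add: "f + g \<in> V" if fg: "f \<in> V" "g \<in> V" for f g
  proof -
    obtain a v b w where *: "a \<in> M" "v \<in> poly_span T E" "f = a + v" "b \<in> M" "w \<in> poly_span T E" "g = b + w"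
      using V_E[OF fg(1)] V_E[OF fg(2)] by blast
    show ?thesis using V_I[OF cl(2)[OF *(1,4)] sp(2)[OF *(2,5)]] unfolding *(3,6) by (simp add: ac_simps)
  qed
  have V_mult: "q * f \<in> V" if fq: "f \<in> V" "q \<in> polys_in T" for f q
  proof -
    obtain a v where *: "a \<in> M" "v \<in> poly_span T E" "f = a + v" using V_E[OF fq(1)] by blast
    show ?thesis
      using V_I[OF cl(3)[OF *(1) polys_in_carrier[OF T(1) fq(2)]] sp(3)[OF *(2) fq(2)]] unfolding *(3)
      by (simp add: distrib_left)
  qed
  have V_sum: "sum h B \<in> V" if "\<And>b. b \<in> B \<Longrightarrow> h b \<in> V" for h and B :: "monom_exp set"
    using that
  proof (induction B rule: infinite_finite_induct)
    case (insert b B)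
    then show ?case using V_add by simp
  qed (use V_I[OF cl(1) sp(1)] in simp_all)
  have V_step: "c * (var i * f) \<in> V" if i: "i \<in> {1..n}" and f: "f \<in> V" for i f
  proof (cases "i \<in> T")
    case True
    then have "var i * f \<in> V" by (intro V_mult[OF f] polys_in_closed(8))
    then show ?thesis by (rule V_mult[OF _ c(1)])
  next
    case False
    obtain a v where av: "a \<in> M" "v \<in> poly_span T E" "f = a + v" using V_E[OF f] by blast
    obtain d where d: "v = (\<Sum>m\<in>E. d m * single m 1)" "\<And>m. d m \<in> polys_in T"
      using av(2) unfolding poly_span_def by auto
    have "c * (var i * v) = (\<Sum>m\<in>E. d m * (c * (var i * single m 1)))"
      unfolding d(1) sum_distrib_left by (intro sum.cong refl) (simp add: mult_ac)
    also have "\<dots> \<in> V"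
    proof (rule V_sum)
      fix m assume "m \<in> E"
      then obtain b w where "b \<in> M" "w \<in> poly_span T E" "c * (var i * single m 1) = b + w"
        using step[of i m] i False by blast
      then have "c * (var i * single m 1) \<in> V" using V_I by simp
      then show "d m * (c * (var i * single m 1)) \<in> V" by (rule V_mult[OF _ d(2)])
    qed
    finally have "c * (var i * v) \<in> V" .
    moreover have "c * (var i * a) \<in> M"
      using cl(3)[OF cl(3)[OF av(1) var_closed[OF i]] polys_in_carrier[OF T(1) c(1)]] .
    then have "c * (var i * a) \<in> V" using V_I[OF _ sp(1)] by simp
    ultimately show ?thesis unfolding av(3) using V_add by (simp add: distrib_left)
  qed
  \<comment> \<open>Every monomial is reached from 1 by multiplications with variables, each at the
    cost of one factor c.\<close>
  have all: "\<exists>N. c ^ N * f \<in> V" if "f \<in> carrier (mvpoly_ring n)" for f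
    using that
  proof (induction f rule: mvpoly_ring_induct)
    case (const a)
    have "0 + single 0 1 \<in> V" using V_I[OF cl(1) sp(4)[OF E(1,2)]] .
    then have "1 \<in> V" by simp
    from V_mult[OF this polys_in_closed(3)[of a]] show ?case by (intro exI[of _ 0]) simp
  next
    case (add f g)
    then obtain A B where AB: "c ^ A * f \<in> V" "c ^ B * g \<in> V" by blast
    have "c ^ B * (c ^ A * f) + c ^ A * (c ^ B * g) \<in> V"
      by (intro V_add V_mult[OF AB(1)] V_mult[OF AB(2)] polys_in_closed(7) c(1))
    then have "c ^ (A + B) * (f + g) \<in> V" by (simp add: power_add algebra_simps)
    then show ?case by blast
  next
    case (var_mult i f)
    then obtain N where "c ^ N * f \<in> V" by blast
    then have "c * (var i * (c ^ N * f)) \<in> V" by (rule V_step[OF var_mult(1)])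
    then have "c ^ Suc N * (var i * f) \<in> V" by (simp add: mult_ac)
    then show ?case by blast
  qed
  let ?x = "var t :: 'k mvpoly"
  \<comment> \<open>The constant term 1 makes p a nonzero element of K[T], so it lies outside M and
    is invertible modulo M; as c is nonzero, p is not constant.\<close>
  define p where "p = 1 + ?x * c"
  have pT: "p \<in> polys_in T" unfolding p_def by (intro polys_in_closed(2,4,5,8) c(1) T(2))
  have xc_keys: "keys (?x * c) = (\<lambda>m. m + single t 1) ` keys c"
    unfolding var_def by (subst mult.commute) (rule keys_times_monomial)
  have xc0: "0 \<notin> keys (?x * c)"
    unfolding xc_keys
  proof
    assume "0 \<in> (\<lambda>m. m + single t 1) ` keys c"
    then obtain m where "0 = m + single t (1::nat)" by blast
    then have "lookup (0 :: monom_exp) t = lookup m t + 1" by (metis lookup_add lookup_single_eq)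
    then show False by simp
  qed
  have "lookup p 0 = 1" using xc0 unfolding p_def by (simp add: lookup_add in_keys_iff)
  then have "p \<noteq> 0" by auto
  then have pM: "p \<notin> M" using MT pT by blast
  have pc: "p \<in> carrier (mvpoly_ring n)" by (rule polys_in_carrier[OF T(1) pT])
  let ?J = "adjoin (mvpoly_ring n) M p"
  have J: "ideal ?J (mvpoly_ring n)" by (rule cring.adjoin_ideal[OF cring_mvpoly M.is_ideal pc])
  note sup = cring.adjoin_superset[OF cring_mvpoly M.is_ideal pc]
  have "?J = M \<or> ?J = carrier (mvpoly_ring n)"
    using mvpoly_ideal_closed(5)[OF J] by (intro M.I_maximal[OF J sup(1)]) blast
  then have "1 \<in> ?J" using sup(2) pM by auto
  then obtain a u where au: "a \<in> M" "u \<in> carrier (mvpoly_ring n)" "1 = a + u * p" by (elim adjoinE) auto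
  obtain N where "c ^ N * u \<in> V" using all[OF au(2)] by blast
  then obtain b v where bv: "b \<in> M" "v \<in> poly_span T E" "c ^ N * u = b + v" using V_E by blast
  obtain d where d: "v = (\<Sum>m\<in>E. d m * single m 1)" "\<And>m. d m \<in> polys_in T"
    using bv(2) unfolding poly_span_def by auto
  \<comment> \<open>The coefficients of p v - c^N, with c^N placed at the monomial 1. This element
    lies in M, so independence makes the coefficient at exponent 0 vanish, which is why E has to
    contain 0.\<close>
  let ?d = "\<lambda>m. p * d m - (if m = 0 then c ^ N else 0)"
  have "(\<Sum>m\<in>E. ?d m * single m 1) = p * v - (\<Sum>m\<in>E. if m = 0 then c ^ N * single m 1 else 0)"
    unfolding d(1) sum_distrib_left sum_subtractf[symmetric] by (intro sum.cong refl) (auto simp: algebra_simps)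
  also have "\<dots> = p * v - c ^ N" using E(1,2) by simp
  also have "\<dots> = - (p * b) - c ^ N * a"
  proof -
    have "p * v = p * (c ^ N * u) - p * b" unfolding bv(3) by (simp add: algebra_simps)
    moreover have "1 - a = u * p" unfolding au(3) by simp
    then have "p * (c ^ N * u) = c ^ N * (1 - a)" by (simp only: mult_ac)
    ultimately have "p * v = c ^ N * (1 - a) - p * b" by simp
    then show ?thesis by (simp add: right_diff_distrib)
  qed
  also have "\<dots> \<in> M"
    using cl(7)[OF cl(6)[OF cl(3)[OF bv(1) pc]] cl(3)[OF au(1) mvpoly_closed(7)[OF polys_in_carrier[OF T(1) c(1)]]]] .
  finally have "(\<Sum>m\<in>E. ?d m * single m 1) \<in> M" .
  moreover have "?d m \<in> polys_in T" for m
  proof -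
    have "- (if m = 0 then c ^ N else 0) \<in> polys_in T" by (simp add: polys_in_closed(1,6,7) c(1))
    from polys_in_closed(4)[OF polys_in_closed(5)[OF pT d(2)[of m]] this] show ?thesis by simp
  qed
  ultimately have "?d 0 = 0" using E(3)[unfolded poly_indep_def, rule_format, of ?d 0] E(2) by blast
  then have "c ^ N = p * d 0" by simp
  then have "p dvd c ^ N" by (rule dvdI)
  \<comment> \<open>The factor turns c^N into a power of -(x_t c), which is congruent to 1 modulo p
    = 1 + x_t c; so p divides 1.\<close>
  then have "p dvd (- ?x) ^ N * c ^ N" by (rule dvd_mult)
  then have 1: "p dvd (- (?x * c)) ^ N" by (simp add: power_mult_distrib[symmetric])
  have "1 - (- (?x * c)) ^ N = p * (\<Sum>i<N. (- (?x * c)) ^ i)"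
    using one_diff_power_eq[of "- (?x * c)" N] by (simp add: p_def)
  then have "p dvd 1 - (- (?x * c)) ^ N" by simp
  then have "p dvd (1 - (- (?x * c)) ^ N) + (- (?x * c)) ^ N" using 1 by (rule dvd_add)
  then have "p dvd 1" by simp
  then obtain w where "p * w = 1" by (metis dvdE)
  then have kp: "keys p \<subseteq> {0}" by (rule mvpoly_unit_const)
  obtain m where "m \<in> keys c" using c(2) by (metis ex_in_conv keys_eq_empty)
  then have m: "m + single t 1 \<in> keys (?x * c)" unfolding xc_keys by blast
  then have m0: "m + single t 1 \<noteq> 0" using xc0 by metis
  then have "lookup p (m + single t 1) \<noteq> 0"
    using m unfolding p_def by (simp add: lookup_add lookup_one in_keys_iff when_def)
  then show False using kp m0 by (auto simp: in_keys_iff)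
qed

text \<open>T is a maximal set of variables algebraically independent modulo M. If T is empty, M
  contains a nonzero polynomial in x_j alone. Otherwise each x_i outside T is algebraic over K[T],
  so R/M becomes finite over K[T] once some nonzero c is inverted, which
  \<open>no_finite_span\<close> excludes.\<close>

theorem maximalideal_meets_univariate:
  fixes M :: "('k::field) mvpoly set"
  assumes M: "maximalideal M (mvpoly_ring n)" and j: "j \<in> {1..n}"
  shows "\<exists>f\<in>M. f \<noteq> 0 \<and> keys f \<subseteq> range (single j)"
proof -
  interpret M: maximalideal M "mvpoly_ring n" by fact
  note cl = mvpoly_ideal_closed[OF M.is_ideal]
  have one: "1 \<notin> M" using M.one_imp_carrier M.I_notcarr by auto
  let ?\<T> = "{T. T \<subseteq> {1..n} \<and> M \<inter> polys_in T \<subseteq> {0}}"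
  have "M \<inter> polys_in {} \<subseteq> {0}"
  proof
    fix f assume f: "f \<in> M \<inter> polys_in {}"
    then have "keys f \<subseteq> {0}" unfolding polys_in_def by auto
    then have fc: "f = single 0 (lookup f 0)"
      by (intro poly_mapping_eqI) (auto simp: lookup_single when_def in_keys_iff)
    show "f \<in> {0}"
    proof (rule ccontr)
      assume "f \<notin> {0}"
      then have "lookup f 0 \<noteq> 0" using fc by (metis insertI1 single_zero)
      moreover have "single 0 (inverse (lookup f 0)) * f \<in> M"
        using f by (intro cl(3)) auto
      ultimately show False using one fc by (metis left_inverse mult_single add.right_neutral single_one)
    qed
  qed
  then have ne: "?\<T> \<noteq> {}" by blast
  have "finite ?\<T>" by (rule finite_subset[of _ "Pow {1..n}"]) auto
  from finite_has_maximal[OF this ne] obtain T where T': "T \<in> ?\<T>"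
    and max': "\<forall>T'\<in>?\<T>. T \<subseteq> T' \<longrightarrow> T = T'" by (rule bexE)
  have T: "T \<subseteq> {1..n}" "M \<inter> polys_in T \<subseteq> {0}" using T' by simp_all
  have max: "T = T'" if "T' \<subseteq> {1..n}" "M \<inter> polys_in T' \<subseteq> {0}" "T \<subseteq> T'" for T'
    using max' that by simp
  have "\<forall>i\<in>{1..n} - T. \<exists>f. f \<in> M \<and> f \<in> polys_in (insert i T) \<and> f \<noteq> 0"
  proof
    fix i assume i: "i \<in> {1..n} - T"
    have "\<not> M \<inter> polys_in (insert i T) \<subseteq> {0}"
    proof
      assume *: "M \<inter> polys_in (insert i T) \<subseteq> {0}"
      have "insert i T \<subseteq> {1..n}" using i T(1) by blast
      from max[OF this * subset_insertI] have "i \<in> T" by (rule ssubst) (rule insertI1)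
      then show False using i by blast
    qed
    then show "\<exists>f. f \<in> M \<and> f \<in> polys_in (insert i T) \<and> f \<noteq> 0" by auto
  qed
  then obtain F where "\<forall>i\<in>{1..n} - T. F i \<in> M \<and> F i \<in> polys_in (insert i T) \<and> F i \<noteq> 0"
    by (rule exE[OF bchoice])
  then have F: "F i \<in> M \<and> F i \<in> polys_in (insert i T) \<and> F i \<noteq> 0" if "i \<in> {1..n} - T" for i
    using that by (rule bspec)
  show ?thesis
  proof (cases "T = {}")
    case True
    then have f: "F j \<in> M" "F j \<in> polys_in {j}" "F j \<noteq> 0" using F[of j] j by auto
    have "m \<in> range (single j)" if "m \<in> keys (F j)" for m
    proof -
      have "keys m \<subseteq> {j}" using f(2) that unfolding polys_in_def by blast
      then have "m = single j (lookup m j)"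
        by (intro poly_mapping_eqI) (auto simp: lookup_single when_def in_keys_iff)
      then show ?thesis by blast
    qed
    then show ?thesis using f(1,3) by blast
  next
    case False
    then obtain t where t: "t \<in> T" by blast
    let ?J = "{1..n} - T"
    \<comment> \<open>F i is a relation for x_i over K[T] of degree \<open>e i\<close> in x_i, with
      leading coefficient \<open>h i\<close>.\<close>
    define e where "e i = Max ((\<lambda>m. lookup m i) ` keys (F i))" for i
    define h where "h i = coeff_var i (e i) (F i)" for i
    have le_e: "lookup m i \<le> e i" if "m \<in> keys (F i)" for m i
      unfolding e_def using that by (intro Max_ge) auto
    have keysF: "keys m \<subseteq> insert i T" if "i \<in> ?J" "m \<in> keys (F i)" for m i
      using F[OF that(1)] that(2) unfolding polys_in_def by blast
    have h: "h i \<in> polys_in T" "h i \<noteq> 0" if i: "i \<in> ?J" for i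
    proof -
      show "h i \<in> polys_in T"
        unfolding polys_in_def
      proof (intro CollectI ballI)
        fix m assume m: "m \<in> keys (h i)"
        have *: "lookup m i = 0" "m + single i (e i) \<in> keys (F i)"
          using keys_coeff_var[OF m[unfolded h_def]] by simp_all
        have "i \<notin> keys m" using *(1) by (simp add: in_keys_iff)
        moreover have "keys m \<subseteq> insert i T"
          using keysF[OF i *(2)] unfolding keys_plus_nat by blast
        ultimately show "keys m \<subseteq> T" by blast
      qed
      have "e i \<in> (\<lambda>m. lookup m i) ` keys (F i)"
        unfolding e_def using F[OF i] by (intro Max_in) auto
      then obtain m where m: "m \<in> keys (F i)" "lookup m i = e i" by auto
      have "m - single i (e i) + single i (e i) = m"
        using m(2) by (intro poly_mapping_eqI) (auto simp: lookup_add lookup_minus lookup_single when_def)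
      then have "lookup (h i) (m - single i (e i)) = lookup (F i) m"
        unfolding h_def using m(2) by (simp add: coeff_var.rep_eq lookup_minus)
      then show "h i \<noteq> 0" using m(1) by (auto simp: in_keys_iff)
    qed
    have e_pos: "e i > 0" if i: "i \<in> ?J" for i
    proof (rule ccontr)
      assume "\<not> e i > 0"
      then have 0: "lookup m i = 0" if "m \<in> keys (F i)" for m using le_e[OF that] by simp
      have "F i \<in> polys_in T"
        unfolding polys_in_def
      proof (intro CollectI ballI)
        fix m assume m: "m \<in> keys (F i)"
        have "i \<notin> keys m" using 0[OF m] by (simp add: in_keys_iff)
        then show "keys m \<subseteq> T" using keysF[OF i m] by blast
      qed
      then show False using F[OF i] T(2) by blast
    qed
    \<comment> \<open>The monomials reduced with respect to the relations F i; up to denominators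
      from K[T] they span R modulo M.\<close>
    define E where "E = {m :: monom_exp. keys m \<subseteq> ?J \<and> (\<forall>i\<in>?J. lookup m i < e i)}"
    have finE: "finite E"
    proof (rule finite_subset)
      show "finite {m :: monom_exp. keys m \<subseteq> {1..n} \<and> (\<forall>v. lookup m v \<le> Max (e ` {1..n})) \<and> (\<forall>i\<in>{}. lookup m i < 0)}"
        by (rule card_bounded_monomials(1)[of "{}" n 0]) auto
      show "E \<subseteq> \<dots>"
      proof
        fix m assume m: "m \<in> E"
        have "lookup m v \<le> Max (e ` {1..n})" for v
        proof (cases "v \<in> ?J")
          case True
          then have "lookup m v \<le> e v" using m unfolding E_def by (simp add: less_imp_le)
          also have "\<dots> \<le> Max (e ` {1..n})" using True by (intro Max_ge) auto
          finally show ?thesis .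
        next
          case False
          then have "v \<notin> keys m" using m unfolding E_def by blast
          then show ?thesis by (simp add: in_keys_iff)
        qed
        then show "m \<in> {m. keys m \<subseteq> {1..n} \<and> (\<forall>v. lookup m v \<le> Max (e ` {1..n})) \<and> (\<forall>i\<in>{}. lookup m i < 0)}"
          using m unfolding E_def by blast
      qed
    qed
    \<comment> \<open>A maximal independent set among them plays the part of a basis; it must
      contain the monomial 1, where \<open>no_finite_span\<close> compares coefficients.\<close>
    let ?\<E> = "{E'. 0 \<in> E' \<and> E' \<subseteq> E \<and> poly_indep M T E'}"
    have "poly_indep M T {0}"
      unfolding poly_indep_def using T(2) by auto
    moreover have "0 \<in> E" unfolding E_def using e_pos by auto
    ultimately have ne: "?\<E> \<noteq> {}" by blast
    have "finite ?\<E>" by (rule finite_subset[of _ "Pow E"]) (use finE in auto)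
    from finite_has_maximal[OF this ne] obtain E' where E'': "E' \<in> ?\<E>"
      and max'': "\<forall>E''\<in>?\<E>. E' \<subseteq> E'' \<longrightarrow> E' = E''" by (rule bexE)
    have E': "0 \<in> E'" "E' \<subseteq> E" "poly_indep M T E'" using E'' by simp_all
    have E'max: "E' = E''" if "E'' \<subseteq> E" "poly_indep M T E''" "E' \<subseteq> E''" for E''
      using max'' that E'(1) by blast
    have finE': "finite E'" using E'(2) finE finite_subset by blast
    note sp = poly_span_closed[where T=T and E=E']
    \<comment> \<open>Elements that enter M + span after multiplication by a nonzero element of
      K[T]: the span over the fraction field of K[T], written without fractions.\<close>
    define W where "W = {f. \<exists>q\<in>polys_in T. q \<noteq> 0 \<and> (\<exists>a\<in>M. \<exists>v\<in>poly_span T E'. q * f = a + v)}"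
    have W_I: "f \<in> W" if "q \<in> polys_in T" "q \<noteq> 0" "a \<in> M" "v \<in> poly_span T E'" "q * f = a + v" for f q a v
      unfolding W_def using that by blast
    have W_E: "\<exists>q a v. q \<in> polys_in T \<and> q \<noteq> 0 \<and> a \<in> M \<and> v \<in> poly_span T E' \<and> q * f = a + v" if "f \<in> W" for f
      using that unfolding W_def by blast
    have Tc: "q \<in> carrier (mvpoly_ring n)" if "q \<in> polys_in T" for q :: "'k mvpoly" by (rule polys_in_carrier[OF T(1) that])
    have W_M: "f \<in> W" if "f \<in> M" for f
      using W_I[OF polys_in_closed(2) _ that sp(1), of f] by simp
    have W_add: "f + g \<in> W" if fg: "f \<in> W" "g \<in> W" for f g
    proof -
      obtain q a v where 1: "q \<in> polys_in T" "q \<noteq> 0" "a \<in> M" "v \<in> poly_span T E'" "q * f = a + v" using W_E[OF fg(1)] by blast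
      obtain p b w where 2: "p \<in> polys_in T" "p \<noteq> 0" "b \<in> M" "w \<in> poly_span T E'" "p * g = b + w" using W_E[OF fg(2)] by blast
      have "(q * p) * (f + g) = p * (q * f) + q * (p * g)" by (simp add: algebra_simps)
      also have "\<dots> = (p * a + q * b) + (p * v + q * w)" unfolding 1(5) 2(5) by (simp add: algebra_simps)
      finally show ?thesis
        using 1(1,2) 2(1,2) cl(2)[OF cl(3)[OF 1(3) Tc[OF 2(1)]] cl(3)[OF 2(3) Tc[OF 1(1)]]]
          sp(2)[OF sp(3)[OF 1(4) 2(1)] sp(3)[OF 2(4) 1(1)]] polys_in_closed(5)[OF 1(1) 2(1)]
        by (intro W_I[of "q * p" "p * a + q * b" "p * v + q * w"]) auto
    qed
    have W_mult: "p * f \<in> W" if fp: "f \<in> W" "p \<in> polys_in T" for f p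
    proof -
      obtain q a v where 1: "q \<in> polys_in T" "q \<noteq> 0" "a \<in> M" "v \<in> poly_span T E'" "q * f = a + v" using W_E[OF fp(1)] by blast
      have "q * (p * f) = p * a + p * v" using 1(5) by (metis distrib_left mult.left_commute)
      then show ?thesis by (rule W_I[OF 1(1,2) cl(3)[OF 1(3) Tc[OF fp(2)]] sp(3)[OF 1(4) fp(2)]])
    qed
    have W_sat: "f \<in> W" if fp: "p * f \<in> W" "p \<in> polys_in T" "p \<noteq> 0" for f p
    proof -
      obtain q a v where 1: "q \<in> polys_in T" "q \<noteq> 0" "a \<in> M" "v \<in> poly_span T E'" "q * (p * f) = a + v" using W_E[OF fp(1)] by blast
      have "q * p \<noteq> 0" using 1(2) fp(3) by simp
      moreover have "(q * p) * f = a + v" using 1(5) by (simp add: mult.assoc)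
      ultimately show ?thesis by (rule W_I[OF polys_in_closed(5)[OF 1(1) fp(2)] _ 1(3,4)])
    qed
    have W_sum: "sum g A \<in> W" if "\<And>s. s \<in> A \<Longrightarrow> g s \<in> W" for g and A :: "monom_exp set"
      using that by (induction A rule: infinite_finite_induct) (auto intro: W_add W_M[OF cl(1)])
    have W_mon: "single m 1 \<in> W" if m: "m \<in> E" for m
    proof (cases "m \<in> E'")
      case True
      from sp(4)[OF finE' True] show ?thesis
        by (intro W_I[OF polys_in_closed(2) _ cl(1), of "single m 1"]) auto
    next
      case False
      have "\<not> poly_indep M T (insert m E')"
      proof
        assume *: "poly_indep M T (insert m E')"
        have "insert m E' \<subseteq> E" using E'(2) m by blast
        from E'max[OF this * subset_insertI] have "m \<in> E'" by (rule ssubst) (rule insertI1)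
        then show False using False by blast
      qed
      then obtain c where c: "\<And>s. c s \<in> polys_in T" "(\<Sum>s\<in>insert m E'. c s * single s 1) \<in> M"
        and nz: "\<exists>s\<in>insert m E'. c s \<noteq> 0" unfolding poly_indep_def by blast
      let ?v = "\<Sum>s\<in>E'. c s * single s 1"
      have sum: "(\<Sum>s\<in>insert m E'. c s * single s 1) = c m * single m 1 + ?v"
        using False finE' by simp
      have cm: "c m \<noteq> 0"
      proof
        assume "c m = 0"
        then have "?v \<in> M" using c(2) unfolding sum by simp
        then have "\<forall>s\<in>E'. c s = 0" using E'(3) c(1) unfolding poly_indep_def by blast
        then show False using nz \<open>c m = 0\<close> by blast
      qed
      have "?v \<in> poly_span T E'" unfolding poly_span_def using c(1) by blast
      then have "- 1 * ?v \<in> poly_span T E'" by (rule sp(3)) (rule polys_in_closed(6)[OF polys_in_closed(2)])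
      then show ?thesis
        using c(1)[of m] cm c(2) unfolding sum
        by (intro W_I[of "c m" "c m * single m 1 + ?v" "- 1 * ?v"]) auto
    qed
    have W_step: "var i * single m 1 \<in> W" if i: "i \<in> ?J" and m: "m \<in> E'" for i m
    proof -
      have mE: "m \<in> E" using m E'(2) by blast
      have vm: "var i * single m 1 = (single (m + single i 1) 1 :: 'k mvpoly)"
        by (simp add: var_def mult_single add.commute)
      show ?thesis
      proof (cases "lookup m i + 1 < e i")
        case True
        have "m + single i 1 \<in> E"
          using mE True i unfolding E_def by (auto simp: keys_plus_nat lookup_add lookup_single when_def)
        then show ?thesis unfolding vm by (rule W_mon)
      next
        case False
        have lt: "lookup m i < e i" using mE i unfolding E_def by blast
        then have ei: "lookup m i + 1 = e i" using False by simp
        \<comment> \<open>Multiplying m by x_i leaves E and gives m0 times x_i^(e i). Modulo M,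
          \<open>h i\<close> times this is minus the lower terms of F i times m0, which lie in W,
          and W allows division by \<open>h i\<close>.\<close>
        define m0 where "m0 = m - single i (lookup m i)"
        have m0: "m = m0 + single i (lookup m i)"
          unfolding m0_def by (intro poly_mapping_eqI) (auto simp: lookup_add lookup_minus lookup_single when_def)
        have m0i: "lookup m0 i = 0" unfolding m0_def by (simp add: lookup_minus)
        have m0l: "lookup m0 s = lookup m s" if "s \<noteq> i" for s
          using that unfolding m0_def by (simp add: lookup_minus lookup_single when_def)
        have m0k: "keys m0 \<subseteq> ?J" using mE unfolding E_def by (subst (asm) m0) (auto simp: keys_plus_nat)
        have m0E: "m0 + single i k \<in> E" if "k < e i" for k
          using that m0k i m0i m0l mE unfolding E_def
          by (auto simp: keys_plus_nat lookup_add lookup_single when_def)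
        let ?x = "single (single i (e i)) (1::'k)"
        let ?g = "F i - ?x * h i"
        have FM: "F i * single m0 1 \<in> M"
        proof (rule cl(4)[OF _ mvpoly_single_closed])
          show "F i \<in> M" using F[OF i] by blast
          show "keys m0 \<subseteq> {1..n}" using m0k by blast
        qed
        have "?x \<in> polys_in (insert i T)" unfolding polys_in_def by auto
        moreover have "h i \<in> polys_in (insert i T)" using h(1)[OF i] unfolding polys_in_def by blast
        ultimately have "- (?x * h i) \<in> polys_in (insert i T)"
          by (rule polys_in_closed(6)[OF polys_in_closed(5)])
        then have "F i + - (?x * h i) \<in> polys_in (insert i T)"
          using F[OF i] polys_in_closed(4) by blast
        then have gT: "?g \<in> polys_in (insert i T)" by simp
        have g_lt: "lookup s i < e i" if "s \<in> keys ?g" for s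
          by (rule coeff_var_remove_top[OF le_e that[unfolded h_def]])
        have "?g * single m0 1 = (\<Sum>s\<in>keys ?g. single s (lookup ?g s) * single m0 1)"
          by (subst (1) mvpoly_expand[of ?g]) (simp only: sum_distrib_right)
        also have "\<dots> \<in> W"
        proof (rule W_sum)
          fix s assume s: "s \<in> keys ?g"
          define k where "k = lookup s i"
          define s' where "s' = s - single i k"
          have s': "s = s' + single i k"
            unfolding s'_def k_def by (intro poly_mapping_eqI) (auto simp: lookup_add lookup_minus lookup_single when_def)
          have "i \<notin> keys s'" unfolding s'_def k_def by (simp add: in_keys_iff lookup_minus)
          moreover have "keys s \<subseteq> insert i T" using gT s unfolding polys_in_def by blast
          ultimately have s'T: "keys s' \<subseteq> T" unfolding s' keys_plus_nat by blast
          have "single s (lookup ?g s) * single m0 1 =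
              single s' (lookup ?g s) * single (m0 + single i k) 1"
            unfolding mult_single by (subst (1) s') (simp add: ac_simps)
          moreover have "single s' (lookup ?g s) \<in> polys_in T"
            using s'T unfolding polys_in_def by auto
          ultimately show "single s (lookup ?g s) * single m0 1 \<in> W"
            using W_mult[OF W_mon[OF m0E]] g_lt[OF s] unfolding k_def by simp
        qed
        finally have "- 1 * (?g * single m0 1) \<in> W"
          by (rule W_mult) (rule polys_in_closed(6)[OF polys_in_closed(2)])
        from W_add[OF W_M[OF FM] this]
        have mem: "F i * single m0 1 + - 1 * (?g * single m0 1) \<in> W" .
        have eq1: "F i * single m0 1 + - 1 * (?g * single m0 1) = h i * (?x * single m0 1)"
          by (simp add: algebra_simps)
        have "single i (e i) + m0 = m + single i 1"
          unfolding m0_def ei[symmetric]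
          by (intro poly_mapping_eqI) (auto simp: lookup_add lookup_minus lookup_single when_def)
        then have eq2: "?x * single m0 1 = var i * single m 1"
          unfolding vm mult_single by simp
        show ?thesis by (rule W_sat[OF mem[unfolded eq1 eq2] h[OF i]])
      qed
    qed
    have "\<forall>im\<in>?J \<times> E'. \<exists>q. q \<in> polys_in T \<and> q \<noteq> 0 \<and>
        (\<exists>a\<in>M. \<exists>v\<in>poly_span T E'. q * (var (fst im) * single (snd im) 1) = a + v)"
    proof
      fix im assume "im \<in> ?J \<times> E'"
      then have "fst im \<in> ?J" "snd im \<in> E'" by auto
      from W_E[OF W_step[OF this]] show "\<exists>q. q \<in> polys_in T \<and> q \<noteq> 0 \<and>
        (\<exists>a\<in>M. \<exists>v\<in>poly_span T E'. q * (var (fst im) * single (snd im) 1) = a + v)" by blast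
    qed
    then obtain Q where "\<forall>im\<in>?J \<times> E'. Q im \<in> polys_in T \<and> Q im \<noteq> 0 \<and>
        (\<exists>a\<in>M. \<exists>v\<in>poly_span T E'. Q im * (var (fst im) * single (snd im) 1) = a + v)"
      by (rule exE[OF bchoice])
    then have Q: "Q im \<in> polys_in T \<and> Q im \<noteq> 0 \<and>
        (\<exists>a\<in>M. \<exists>v\<in>poly_span T E'. Q im * (var (fst im) * single (snd im) 1) = a + v)"
      if "im \<in> ?J \<times> E'" for im
      using that by (rule bspec)
    \<comment> \<open>One common denominator for the finitely many products x_i m with m in
      \<open>E'\<close>.\<close>
    let ?c = "prod Q (?J \<times> E')"
    have finJE: "finite (?J \<times> E')" using finE' by simp
    have False
    proof (rule no_finite_span[OF M T(1) t T(2) finE' E'(1,3)])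
      show "?c \<in> polys_in T" using Q by (intro polys_in_prod) blast
      show "?c \<noteq> 0" using Q finJE by (simp add: prod_zero_iff)
      fix i m assume im: "i \<in> ?J" "m \<in> E'"
      then obtain a v where av: "a \<in> M" "v \<in> poly_span T E'" "Q (i, m) * (var i * single m 1) = a + v"
        using Q[of "(i, m)"] by auto
      let ?r = "prod Q (?J \<times> E' - {(i, m)})"
      have r: "?r \<in> polys_in T" using Q by (intro polys_in_prod) blast
      have "?c = ?r * Q (i, m)" using prod.remove[OF finJE, of "(i, m)" Q] im by (simp add: mult.commute)
      then have "?c * (var i * single m 1) = ?r * a + ?r * v"
        by (simp only: mult.assoc av(3) distrib_left)
      then show "\<exists>a\<in>M. \<exists>v\<in>poly_span T E'. ?c * (var i * single m 1) = a + v"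
        using cl(3)[OF av(1) Tc[OF r]] sp(3)[OF av(2) r] by blast
    qed
    then show ?thesis ..
  qed
qed

section \<open>Symbolic powers of C-matroidal ideals\<close>

lemma ex_exponent_add:
  "\<exists>i\<in>F. lookup m i \<ge> (1::nat) \<Longrightarrow> \<exists>i\<in>F. lookup (m + t) i \<ge> 1"
  unfolding lookup_add using trans_le_add1 by blast

lemma var_ideal_eq:
  assumes "F \<subseteq> {1..n}"
  shows "(var_ideal n F :: ('k::field) mvpoly set) = monomial_ideal n (\<lambda>m. \<exists>i\<in>F. lookup m i \<ge> 1)"
    (is "_ = ?I")
proof -
  have ring: "ring (mvpoly_ring n :: 'k mvpoly ring)" by (rule cring.axioms(1)[OF cring_mvpoly])
  have sub: "(var ` F :: 'k mvpoly set) \<subseteq> carrier (mvpoly_ring n)" using assms by auto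
  note G = ring.genideal_ideal[OF ring sub]
  have I: "ideal ?I (mvpoly_ring n)" by (rule monomial_ideal_ideal) (rule ex_exponent_add)
  show ?thesis
    unfolding var_ideal_def
  proof
    have "(var ` F :: 'k mvpoly set) \<subseteq> ?I"
    proof
      fix p :: "'k mvpoly" assume "p \<in> var ` F"
      then obtain i where i: "i \<in> F" "p = var i" by auto
      have "p \<in> carrier (mvpoly_ring n)" using sub i by blast
      moreover have "\<exists>i\<in>F. lookup m i \<ge> 1" if "m \<in> keys p" for m
        using that i(1) unfolding i(2) var_def by (intro bexI[of _ i]) auto
      ultimately show "p \<in> ?I" unfolding monomial_ideal_def by blast
    qed
    then show "Idl\<^bsub>mvpoly_ring n\<^esub> (var ` F) \<subseteq> ?I" by (rule ring.genideal_minimal[OF ring I])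
  next
    show "?I \<subseteq> Idl\<^bsub>mvpoly_ring n\<^esub> (var ` F)"
    proof
      fix f :: "'k mvpoly" assume f: "f \<in> ?I"
      show "f \<in> Idl\<^bsub>mvpoly_ring n\<^esub> (var ` F)"
      proof (rule mem_ideal_of_terms[OF G])
        fix m assume m: "m \<in> keys f"
        have mc: "keys m \<subseteq> {1..n}" using f m unfolding monomial_ideal_def mem_mvpoly_ring by blast
        have "\<exists>i\<in>F. lookup m i \<ge> 1" using f m unfolding monomial_ideal_def by blast
        then obtain i where i: "i \<in> F" "lookup m i \<ge> 1" by blast
        define t where "t = m - single i 1"
        have mt: "m = t + single i 1"
          unfolding t_def using i(2) by (intro poly_mapping_eqI) (auto simp: lookup_add lookup_minus lookup_single when_def)
        have tc: "keys t \<subseteq> {1..n}" using mc unfolding mt keys_plus_nat by blast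
        have "(var i :: 'k mvpoly) \<in> Idl\<^bsub>mvpoly_ring n\<^esub> (var ` F)"
          using ring.genideal_self[OF ring sub] i(1) by blast
        then have "single t (lookup f m) * var i \<in> Idl\<^bsub>mvpoly_ring n\<^esub> (var ` F)"
          by (rule mvpoly_ideal_closed(3)[OF G _ mvpoly_single_closed[OF tc]])
        moreover have "single t c * var i = single m c" for c :: 'k
          unfolding var_def mult_single mt by simp
        ultimately show "single m (lookup f m) \<in> Idl\<^bsub>mvpoly_ring n\<^esub> (var ` F)" by simp
      qed
    qed
  qed
qed

lemma var_ideal_ideal: "F \<subseteq> {1..n} \<Longrightarrow> ideal (var_ideal n F :: ('k::field) mvpoly set) (mvpoly_ring n)"
  unfolding var_ideal_eq by (rule monomial_ideal_ideal) (rule ex_exponent_add)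

text \<open>Dropping the terms divisible by a variable of F changes a polynomial by an element of
  p_F. The product of two such remainders has no term involving F, so it lies in p_F only if it is
  0, and then one of them is 0.\<close>

lemma var_ideal_prime:
  assumes F: "F \<subseteq> {1..n}"
  shows "primeideal (var_ideal n F :: ('k::field) mvpoly set) (mvpoly_ring n)"
proof (rule primeidealI[OF var_ideal_ideal[OF F] cring_mvpoly])
  let ?P = "var_ideal n F :: 'k mvpoly set"
  note cl = mvpoly_ideal_closed[OF var_ideal_ideal[OF F, where 'k='k]]
  have mem: "f \<in> ?P \<longleftrightarrow> f \<in> carrier (mvpoly_ring n) \<and> (\<forall>m\<in>keys f. \<exists>i\<in>F. lookup m i \<ge> 1)" for f
    unfolding var_ideal_eq[OF F] monomial_ideal_def by simp
  have "1 \<notin> ?P" unfolding mem by simp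
  then show "carrier (mvpoly_ring n) \<noteq> ?P" by (metis mvpoly_closed(2))
  fix a b :: "'k mvpoly" assume ab: "a \<in> carrier (mvpoly_ring n)" "b \<in> carrier (mvpoly_ring n)" "a \<otimes>\<^bsub>mvpoly_ring n\<^esub> b \<in> ?P"
  let ?N = "{m. \<not> (\<exists>i\<in>F. lookup m i \<ge> (1::nat))}"
  define red where "red f = (\<Sum>m\<in>keys f \<inter> ?N. single m (lookup f m))" for f :: "'k mvpoly"
  have diff: "f - red f \<in> ?P" if "f \<in> carrier (mvpoly_ring n)" for f
  proof -
    have eq: "f = (\<Sum>m\<in>keys f - ?N. single m (lookup f m)) + red f"
      unfolding red_def by (subst (1) mvpoly_expand[of f], subst (1) sum.subset_diff[of "keys f \<inter> ?N"])
        (auto simp: Diff_Int)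
    have "f - red f = (\<Sum>m\<in>keys f - ?N. single m (lookup f m))"
      by (rule diff_eq_eq[THEN iffD2, OF eq])
    also have "\<dots> \<in> ?P"
    proof (rule cl(8))
      fix m assume m: "m \<in> keys f - ?N"
      then have "keys m \<subseteq> {1..n}" using that unfolding mem_mvpoly_ring by blast
      then show "single m (lookup f m) \<in> ?P" unfolding mem using m by auto
    qed
    finally show ?thesis .
  qed
  have redN: "m \<in> ?N" if "m \<in> keys (red f)" for m f
  proof -
    have "m \<in> (\<Union>s\<in>keys f \<inter> ?N. keys (single s (lookup f s)))"
      using that unfolding red_def by (rule subsetD[OF keys_sum])
    then obtain s where "s \<in> ?N" "m \<in> keys (single s (lookup f s))" by blast
    moreover from this have "m = s" by (simp split: if_splits)
    ultimately show ?thesis by simp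
  qed
  have redc: "red f \<in> carrier (mvpoly_ring n)" if "f \<in> carrier (mvpoly_ring n)" for f
    using mvpoly_closed(6)[OF that cl(5)[OF diff[OF that]]] by simp
  have "a * b - red a * red b = (a - red a) * b + red a * (b - red b)" by (simp add: algebra_simps)
  also have "\<dots> \<in> ?P"
    by (rule cl(2)[OF cl(4)[OF diff[OF ab(1)] ab(2)] cl(3)[OF diff[OF ab(2)] redc[OF ab(1)]]])
  finally have d: "a * b - red a * red b \<in> ?P" .
  have "a * b \<in> ?P" using ab(3) by simp
  from cl(7)[OF this d] have r: "red a * red b \<in> ?P" by simp
  have "red a * red b = 0"
  proof (rule ccontr)
    assume "red a * red b \<noteq> 0"
    then obtain m where m: "m \<in> keys (red a * red b)" by (metis ex_in_conv keys_eq_empty)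
    then have "m \<in> {s + t |s t. s \<in> keys (red a) \<and> t \<in> keys (red b)}"
      using keys_mult by (rule subsetD[rotated])
    then obtain s t where st: "m = s + t" "s \<in> keys (red a)" "t \<in> keys (red b)" by auto
    have "\<exists>i\<in>F. lookup m i \<ge> 1" using r m unfolding mem by blast
    then obtain i where i: "i \<in> F" "lookup m i \<ge> 1" by blast
    have "\<not> lookup s i \<ge> 1" "\<not> lookup t i \<ge> 1"
      using redN[OF st(2)] redN[OF st(3)] i(1) by simp_all
    then show False using i(2) unfolding st(1) lookup_add by linarith
  qed
  then have "red a = 0 \<or> red b = 0" by simp
  then show "a \<in> ?P \<or> b \<in> ?P" using diff[OF ab(1)] diff[OF ab(2)] by auto
qed

lemma ideal_power_var_ideal:
  assumes F: "F \<subseteq> {1..n}"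
  shows "ideal_power (mvpoly_ring n) (var_ideal n F :: ('k::field) mvpoly set) l =
    monomial_ideal n (\<lambda>m. l \<le> (\<Sum>i\<in>F. lookup m i))"
proof (induction l)
  case 0
  then show ?case by (simp add: monomial_ideal_def)
next
  case (Suc l)
  let ?R = "mvpoly_ring n :: 'k mvpoly ring" and ?P = "var_ideal n F :: 'k mvpoly set"
  let ?I = "\<lambda>l. monomial_ideal n (\<lambda>m. l \<le> (\<Sum>i\<in>F. lookup m i)) :: 'k mvpoly set"
  have finF: "finite F" using F finite_subset by blast
  have Iid: "ideal (?I l) ?R" for l
    by (rule monomial_ideal_ideal) (simp add: lookup_add sum.distrib)
  have ring: "ring ?R" by (rule cring.axioms(1)[OF cring_mvpoly])
  have Pid: "ideal ?P ?R" by (rule var_ideal_ideal[OF F])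
  have prod: "ideal (?P \<cdot>\<^bsub>?R\<^esub> ?I l) ?R" by (rule ring.ideal_prod_is_ideal[OF ring Pid Iid])
  have "?P \<cdot>\<^bsub>?R\<^esub> ?I l = ?I (Suc l)"
  proof
    show "?P \<cdot>\<^bsub>?R\<^esub> ?I l \<subseteq> ?I (Suc l)"
    proof
      fix f assume "f \<in> ?P \<cdot>\<^bsub>?R\<^esub> ?I l"
      then show "f \<in> ?I (Suc l)"
      proof (induction f rule: ideal_prod.induct)
        case (prod p q)
        have "Suc l \<le> (\<Sum>i\<in>F. lookup m i)" if m: "m \<in> keys (p * q)" for m
        proof -
          have "m \<in> {s + t |s t. s \<in> keys p \<and> t \<in> keys q}"
            using m keys_mult by (rule subsetD[rotated])
          then obtain s t where st: "m = s + t" "s \<in> keys p" "t \<in> keys q" by auto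
          have "\<exists>i\<in>F. lookup s i \<ge> 1"
            using prod(1) st(2) unfolding var_ideal_eq[OF F] unfolding monomial_ideal_def by blast
          then obtain i where i: "i \<in> F" "lookup s i \<ge> 1" by blast
          have "1 \<le> (\<Sum>i\<in>F. lookup s i)"
            using i(2) member_le_sum[OF i(1) _ finF, of "lookup s"] by linarith
          moreover have "l \<le> (\<Sum>i\<in>F. lookup t i)"
            using prod(2) st(3) unfolding monomial_ideal_def by blast
          ultimately show ?thesis unfolding st(1) lookup_add sum.distrib by linarith
        qed
        moreover have "p * q \<in> carrier ?R"
          using mvpoly_ideal_closed(5)[OF Pid prod(1)] mvpoly_ideal_closed(5)[OF Iid prod(2)] by (rule mvpoly_closed(4))
        ultimately show ?case unfolding monomial_ideal_def by simp
      next
        case (sum s1 s2)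
        then show ?case using mvpoly_ideal_closed(2)[OF Iid] by simp
      qed
    qed
    show "?I (Suc l) \<subseteq> ?P \<cdot>\<^bsub>?R\<^esub> ?I l"
    proof
      fix f assume f: "f \<in> ?I (Suc l)"
      show "f \<in> ?P \<cdot>\<^bsub>?R\<^esub> ?I l"
      proof (rule mem_ideal_of_terms[OF prod])
        fix m assume m: "m \<in> keys f"
        have mc: "keys m \<subseteq> {1..n}" using f m unfolding monomial_ideal_def mem_mvpoly_ring by blast
        have deg: "Suc l \<le> (\<Sum>i\<in>F. lookup m i)" using f m unfolding monomial_ideal_def by blast
        then have "(\<Sum>i\<in>F. lookup m i) \<noteq> 0" by linarith
        then obtain i where i: "i \<in> F" "lookup m i \<noteq> 0" by (meson sum.neutral)
        define t where "t = m - single i 1"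
        have mt: "m = t + single i 1"
          unfolding t_def using i(2) by (intro poly_mapping_eqI) (auto simp: lookup_add lookup_minus lookup_single when_def)
        have tc: "keys t \<subseteq> {1..n}" using mc unfolding mt keys_plus_nat by blast
        have "(\<Sum>j\<in>F. lookup m j) = (\<Sum>j\<in>F. lookup t j) + (\<Sum>j\<in>F. if i = j then 1 else 0)"
          unfolding mt lookup_add lookup_single when_def sum.distrib ..
        then have "l \<le> (\<Sum>j\<in>F. lookup t j)" using deg i(1) finF by simp
        then have "single t (lookup f m) \<in> ?I l"
          using tc unfolding monomial_ideal_def by auto
        moreover have "(var ` F :: 'k mvpoly set) \<subseteq> carrier ?R" using F by auto
        then have "var i \<in> ?P"
          using i(1) ring.genideal_self[OF ring, of "var ` F"] unfolding var_ideal_def by blast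
        ultimately have "var i \<otimes>\<^bsub>?R\<^esub> single t (lookup f m) \<in> ?P \<cdot>\<^bsub>?R\<^esub> ?I l"
          by (intro ideal_prod.prod)
        moreover have "var i * single t c = single m c" for c :: 'k
          unfolding var_def mult_single mt by (simp add: add.commute)
        ultimately show "single m (lookup f m) \<in> ?P \<cdot>\<^bsub>?R\<^esub> ?I l" by simp
      qed
    qed
  qed
  then show ?case using Suc by simp
qed

section \<open>Associated primes and symbolic powers\<close>

lemma finite_prod_notin_prime:
  fixes P :: "('k::field) mvpoly set"
  assumes P: "primeideal P (mvpoly_ring n)" and "finite A"
    and "\<And>x. x \<in> A \<Longrightarrow> g x \<in> carrier (mvpoly_ring n) \<and> g x \<notin> P"
  shows "prod g A \<notin> P"
  using assms(2,3)
proof (induction A rule: finite_induct)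
  case empty
  then show ?case using primeideal.compl_one[OF P] by simp
next
  case (insert x A)
  have "g x \<in> carrier (mvpoly_ring n) - P" "prod g A \<in> carrier (mvpoly_ring n) - P"
    using insert by auto
  then show ?case using primeideal.compl_mult[OF P, of "g x" "prod g A"] insert(1,2) by simp
qed

text \<open>If J : f is prime but none of the p_B, each B offers some g outside this prime with g f
  in p_B, and the product of all g contradicts primality. Conversely, p_B is J : f for f the product
  of all variables outside B, as every other member of the antichain contains such a
  variable.\<close>

lemma Ass_inter_var_ideals:
  assumes \<B>: "finite \<B>" "\<And>B. B \<in> \<B> \<Longrightarrow> B \<subseteq> {1..n}"
    and antichain: "\<And>A B. A \<in> \<B> \<Longrightarrow> B \<in> \<B> \<Longrightarrow> A \<subseteq> B \<Longrightarrow> A = B"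
  shows "Ass_quotient (mvpoly_ring n) (carrier (mvpoly_ring n) \<inter> \<Inter> (var_ideal n ` \<B>) :: ('k::field) mvpoly set) =
    var_ideal n ` \<B>"
proof -
  let ?R = "mvpoly_ring n :: 'k mvpoly ring" and ?p = "\<lambda>B. var_ideal n B :: 'k mvpoly set"
  let ?J = "carrier ?R \<inter> \<Inter> (?p ` \<B>)"
  note pcl = mvpoly_ideal_closed[OF var_ideal_ideal[where 'k='k]]
  have J_eq: "?J = monomial_ideal n (\<lambda>m. \<forall>B\<in>\<B>. \<exists>i\<in>B. lookup m i \<ge> 1)"
    using var_ideal_eq[OF \<B>(2), where 'k='k] unfolding monomial_ideal_def by auto
  show ?thesis
  proof
    show "Ass_quotient ?R ?J \<subseteq> ?p ` \<B>"
    proof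
      fix P assume "P \<in> Ass_quotient ?R ?J"
      then obtain f where P: "primeideal P ?R" and f: "f \<in> carrier ?R" and Pf: "P = colon_ideal ?R ?J f"
        unfolding Ass_quotient_def by blast
      show "P \<in> ?p ` \<B>"
      proof (rule ccontr)
        assume np: "P \<notin> ?p ` \<B>"
        have ex: "\<exists>g. g \<in> carrier ?R \<and> g \<notin> P \<and> g * f \<in> ?p B" if B: "B \<in> \<B>" for B
        proof (cases "f \<in> ?p B")
          case True
          then show ?thesis using primeideal.compl_one[OF P] by (intro exI[of _ 1]) simp
        next
          case False
          \<comment> \<open>With f outside p_B, the prime P lies in p_B, strictly by assumption, so
            p_B has elements outside P.\<close>
          have "P \<subseteq> ?p B"
          proof
            fix r assume r: "r \<in> P"
            then have rf: "r \<in> carrier ?R" "r \<otimes>\<^bsub>?R\<^esub> f \<in> ?p B" using B unfolding Pf colon_ideal_def by auto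
            from primeideal.I_prime[OF var_ideal_prime[OF \<B>(2)[OF B]] rf(1) f rf(2)] show "r \<in> ?p B"
              using False by blast
          qed
          then have "\<not> ?p B \<subseteq> P" using np B by blast
          then obtain g where g: "g \<in> ?p B" "g \<notin> P" by blast
          show ?thesis using g pcl(4,5)[OF \<B>(2)[OF B] g(1)] f by blast
        qed
        then have "\<forall>B\<in>\<B>. \<exists>g. g \<in> carrier ?R \<and> g \<notin> P \<and> g * f \<in> ?p B" by blast
        then obtain g where "\<forall>B\<in>\<B>. g B \<in> carrier ?R \<and> g B \<notin> P \<and> g B * f \<in> ?p B"
          by (rule exE[OF bchoice])
        then have g: "g B \<in> carrier ?R \<and> g B \<notin> P \<and> g B * f \<in> ?p B" if "B \<in> \<B>" for B using that by (rule bspec)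
        have "prod g \<B> \<notin> P" using g by (intro finite_prod_notin_prime[OF P \<B>(1)]) blast
        moreover have gc: "prod g \<B> \<in> carrier ?R" using g by (intro mvpoly_prod_closed) blast
        have "prod g \<B> * f \<in> ?p B" if B: "B \<in> \<B>" for B
        proof -
          have eq: "prod g \<B> * f = prod g (\<B> - {B}) * (g B * f)"
            unfolding prod.remove[OF \<B>(1) B, of g] by (simp only: mult_ac)
          have "prod g (\<B> - {B}) \<in> carrier ?R" using g by (intro mvpoly_prod_closed) blast
          then show ?thesis unfolding eq using pcl(3)[OF \<B>(2)[OF B]] g[OF B] by blast
        qed
        then have "prod g \<B> \<in> P" unfolding Pf colon_ideal_def using gc f by auto
        ultimately show False by blast
      qed
    qed
    show "?p ` \<B> \<subseteq> Ass_quotient ?R ?J"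
    proof
      fix P assume "P \<in> ?p ` \<B>"
      then obtain B where B: "B \<in> \<B>" "P = ?p B" by blast
      define w :: monom_exp where "w = (\<Sum>i\<in>{1..n} - B. single i 1)"
      have w: "lookup w i = (if i \<in> {1..n} - B then 1 else 0)" for i
        unfolding w_def lookup_sum lookup_single when_def by simp
      have wc: "keys w \<subseteq> {1..n}" by (auto simp: in_keys_iff w split: if_splits)
      have "(\<forall>A\<in>\<B>. \<exists>i\<in>A. lookup (m + w) i \<ge> 1) \<longleftrightarrow> (\<exists>i\<in>B. lookup m i \<ge> 1)" for m
      proof
        assume "\<forall>A\<in>\<B>. \<exists>i\<in>A. lookup (m + w) i \<ge> 1"
        then obtain i where "i \<in> B" "lookup (m + w) i \<ge> 1" using B(1) by blast
        then show "\<exists>i\<in>B. lookup m i \<ge> 1" by (intro bexI[of _ i]) (simp_all add: lookup_add w)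
      next
        assume ex: "\<exists>i\<in>B. lookup m i \<ge> 1"
        show "\<forall>A\<in>\<B>. \<exists>i\<in>A. lookup (m + w) i \<ge> 1"
        proof
          fix A assume A: "A \<in> \<B>"
          show "\<exists>i\<in>A. lookup (m + w) i \<ge> 1"
          proof (cases "A = B")
            case True
            then show ?thesis using ex_exponent_add[OF ex] by simp
          next
            case False
            then obtain i where "i \<in> A" "i \<notin> B" using antichain[OF A B(1)] by blast
            then show ?thesis using \<B>(2)[OF A] by (intro bexI[of _ i]) (auto simp: lookup_add w)
          qed
        qed
      qed
      then have "colon_ideal ?R ?J (single w 1) = P"
        unfolding J_eq colon_monomial_ideal[OF wc] B(2) var_ideal_eq[OF \<B>(2)[OF B(1)]] by simp
      moreover have "single w 1 \<in> carrier ?R" using wc by simp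
      moreover have "primeideal P ?R" unfolding B(2) by (rule var_ideal_prime[OF \<B>(2)[OF B(1)]])
      ultimately show "P \<in> Ass_quotient ?R ?J" unfolding Ass_quotient_def by blast
    qed
  qed
qed

lemma colon_symbolic_power:
  assumes \<B>: "matroid_bases {1..n} \<B>"
    and s: "keys s \<subseteq> {1..n}" "\<And>i. lookup s i \<le> 1"
  shows "colon_ideal (mvpoly_ring n)
      (symbolic_power (mvpoly_ring n) (carrier (mvpoly_ring n) \<inter> \<Inter> (var_ideal n ` \<B>)) l) (single s (1::'k::field)) =
    monomial_ideal n (minor_exponent \<B> {} (keys s) l)"
proof -
  let ?R = "mvpoly_ring n :: 'k mvpoly ring"
  have Bsub: "B \<subseteq> {1..n}" if "B \<in> \<B>" for B using matroid_bases_finite(2)[OF \<B> _ that] by simp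
  have finB: "finite B" if "B \<in> \<B>" for B using Bsub[OF that] finite_subset by blast
  have fin: "finite \<B>" using \<B> finite_subset[of \<B> "Pow {1..n}"] unfolding matroid_bases_def by simp
  have anti: "A = B" if "A \<in> \<B>" "B \<in> \<B>" "A \<subseteq> B" for A B
    using card_subset_eq[OF finB[OF that(2)] that(3)] matroid_bases_card[OF \<B> _ that(1,2)] by simp
  have Ass: "Ass_quotient ?R (carrier ?R \<inter> \<Inter> (var_ideal n ` \<B>)) = var_ideal n ` \<B>"
    by (rule Ass_inter_var_ideals[OF fin]) (fact Bsub anti)+
  have "symbolic_power ?R (carrier ?R \<inter> \<Inter> (var_ideal n ` \<B>)) l =
      carrier ?R \<inter> \<Inter> {ideal_power ?R P l | P. P \<in> var_ideal n ` \<B>}"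
    unfolding symbolic_power_def Ass ..
  also have "\<dots> = carrier ?R \<inter> (\<Inter>B\<in>\<B>. ideal_power ?R (var_ideal n B) l)" by blast
  also have "\<dots> = carrier ?R \<inter> (\<Inter>B\<in>\<B>. monomial_ideal n (\<lambda>m. l \<le> (\<Sum>i\<in>B. lookup m i)))"
    using ideal_power_var_ideal[OF Bsub, where 'k='k] by simp
  also have "\<dots> = monomial_ideal n (\<lambda>m. \<forall>B\<in>\<B>. l \<le> (\<Sum>i\<in>B. lookup m i))"
    unfolding monomial_ideal_def by blast
  finally have eq: "symbolic_power ?R (carrier ?R \<inter> \<Inter> (var_ideal n ` \<B>)) l =
    monomial_ideal n (\<lambda>m. \<forall>B\<in>\<B>. l \<le> (\<Sum>i\<in>B. lookup m i))" .
  \<comment> \<open>Squarefreeness of s turns its degree on B into a cardinality, the shape that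
    \<open>minor_exponent\<close> tracks.\<close>
  have "(\<Sum>i\<in>B. lookup (m + s) i) = (\<Sum>i\<in>B. lookup m i) + card (B \<inter> keys s)"
    if "B \<in> \<B>" for B m
  proof -
    have "lookup s i = (if i \<in> keys s then 1 else 0)" for i
      using s(2)[of i] by (auto simp: in_keys_iff)
    then have "(\<Sum>i\<in>B. lookup s i) = (\<Sum>i\<in>B. if i \<in> keys s then 1 else 0)" by simp
    also have "\<dots> = card (B \<inter> keys s)" using finB[OF that] by (simp add: sum.inter_restrict[symmetric])
    finally show ?thesis by (simp add: lookup_add sum.distrib)
  qed
  then show ?thesis
    unfolding eq colon_monomial_ideal[OF s(1)] by (intro monomial_ideal_cong) (simp add: minor_exponent_def)
qed

section \<open>Facets and matroid duality\<close>

lemma facets_independence_complex: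
  assumes \<B>: "matroid_bases V \<B>" and V: "finite V"
  shows "facets (independence_complex \<B>) = \<B>"
proof -
  have anti: "A = B" if "A \<in> \<B>" "B \<in> \<B>" "A \<subseteq> B" for A B
    using card_subset_eq[OF matroid_bases_finite(1)[OF \<B> V that(2)] that(3)] matroid_bases_card[OF \<B> V that(1,2)] by simp
  show ?thesis
  proof
    show "facets (independence_complex \<B>) \<subseteq> \<B>"
    proof
      fix F assume F: "F \<in> facets (independence_complex \<B>)"
      then obtain B where B: "B \<in> \<B>" "F \<subseteq> B" unfolding facets_def independence_complex_def by blast
      then have "B \<in> independence_complex \<B>" unfolding independence_complex_def by blast
      then have "B = F" using F B(2) unfolding facets_def by blast
      then show "F \<in> \<B>" using B(1) by simp
    qed
    show "\<B> \<subseteq> facets (independence_complex \<B>)"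
    proof
      fix B assume B: "B \<in> \<B>"
      have "G = B" if G: "G \<in> independence_complex \<B>" "B \<subseteq> G" for G
      proof -
        obtain A where "A \<in> \<B>" "G \<subseteq> A" using G(1) unfolding independence_complex_def by blast
        then show ?thesis using anti[OF B, of A] G(2) by blast
      qed
      then show "B \<in> facets (independence_complex \<B>)"
        using B unfolding facets_def independence_complex_def by blast
    qed
  qed
qed

text \<open>An element leaves a complement when it enters the basis itself, so the exchange axiom
  becomes \<open>matroid_bases_dual_exchange\<close>.\<close>

lemma matroid_bases_dual:
  assumes \<B>: "matroid_bases V \<B>" and V: "finite V"
  shows "matroid_bases V ((\<lambda>B. V - B) ` \<B>)"
proof -
  have sub: "B \<subseteq> V" if "B \<in> \<B>" for B by (rule matroid_bases_finite(2)[OF \<B> V that])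
  have "\<exists>w\<in>(V - B) - (V - A). ((V - A) - {v}) \<union> {w} \<in> (\<lambda>B. V - B) ` \<B>"
    if A: "A \<in> \<B>" and B: "B \<in> \<B>" and v: "v \<in> (V - A) - (V - B)" for A B v
  proof -
    have "v \<in> B - A" using v by blast
    then obtain y where y: "y \<in> A - B" "(A - {y}) \<union> {v} \<in> \<B>" using matroid_bases_dual_exchange[OF \<B> V B A] by blast
    have "((V - A) - {v}) \<union> {y} = V - ((A - {y}) \<union> {v})" using y(1) sub[OF A] v by blast
    then show ?thesis using y sub[OF A] by (intro bexI[of _ y]) auto
  qed
  moreover have "\<B> \<noteq> {}" using \<B> unfolding matroid_bases_def by blast
  ultimately show ?thesis unfolding matroid_bases_def by auto
qed

text \<open>The Stanley-Reisner ideal of a matroid is the cover ideal of its dual.\<close>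

lemma C_matroidal_imp:
  assumes "C_matroidal n (J :: ('k::field) mvpoly set)"
  obtains \<B> where "matroid_bases {1..n} \<B>" "J = carrier (mvpoly_ring n) \<inter> \<Inter> (var_ideal n ` \<B>)"
proof -
  obtain \<B> where \<B>: "matroid_bases {1..n} \<B>"
    and J: "J = stanley_reisner_ideal n (independence_complex \<B>) \<or> J = cover_ideal n (independence_complex \<B>)"
    using assms unfolding C_matroidal_def by blast
  have fac: "facets (independence_complex \<B>) = \<B>" by (rule facets_independence_complex[OF \<B>]) simp
  from J show ?thesis
  proof
    assume J: "J = cover_ideal n (independence_complex \<B>)"
    have "{var_ideal n F | F. F \<in> \<B>} = (var_ideal n ` \<B> :: 'k mvpoly set set)" by blast
    then show ?thesis using that[OF \<B>] J unfolding cover_ideal_def fac by simp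
  next
    assume J: "J = stanley_reisner_ideal n (independence_complex \<B>)"
    have sub: "B \<subseteq> {1..n}" if "B \<in> \<B>" for B using matroid_bases_finite(2)[OF \<B> _ that] by simp
    have "(F \<subseteq> {1..n} \<and> {1..n} - F \<in> \<B>) \<longleftrightarrow> F \<in> (\<lambda>B. {1..n} - B) ` \<B>" for F
    proof
      assume F: "F \<subseteq> {1..n} \<and> {1..n} - F \<in> \<B>"
      then have "F = {1..n} - ({1..n} - F)" by blast
      then show "F \<in> (\<lambda>B. {1..n} - B) ` \<B>" using F by (rule_tac image_eqI) auto
    next
      assume "F \<in> (\<lambda>B. {1..n} - B) ` \<B>"
      then obtain B where B: "B \<in> \<B>" "F = {1..n} - B" by blast
      then have "{1..n} - F = B" using sub[OF B(1)] by blast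
      then show "F \<subseteq> {1..n} \<and> {1..n} - F \<in> \<B>" using B by blast
    qed
    then have "{var_ideal n F | F. F \<subseteq> {1..n} \<and> {1..n} - F \<in> \<B>} = (var_ideal n ` ((\<lambda>B. {1..n} - B) ` \<B>) :: 'k mvpoly set set)"
      by (simp only: conj_assoc[symmetric]) blast
    then show ?thesis
      using that[OF matroid_bases_dual[OF \<B>]] J unfolding stanley_reisner_ideal_def fac by simp
  qed
qed

theorem theorem1p2:
  fixes n l :: nat
    and J :: "('k::field) mvpoly set"
    and N :: "'k mvpoly"
  assumes "C_matroidal n J"
    and "l \<ge> 1"
    and "squarefree_monomial n N"
  shows "cohen_macaulay_ideal (mvpoly_ring n) (colon_ideal (mvpoly_ring n) (symbolic_power (mvpoly_ring n) J l) N)"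
proof -
  obtain \<B> where \<B>: "matroid_bases {1..n} \<B>" and J: "J = carrier (mvpoly_ring n) \<inter> \<Inter> (var_ideal n ` \<B>)"
    using C_matroidal_imp[OF assms(1)] .
  obtain s where s: "keys s \<subseteq> {1..n}" "\<And>i. lookup s i \<le> 1" "N = single s 1"
    using assms(3) unfolding squarefree_monomial_def by blast
  let ?U = "minor_exponent \<B> {} (keys s) l"
  let ?I = "monomial_ideal n ?U :: 'k mvpoly set"
  have I_eq: "colon_ideal (mvpoly_ring n) (symbolic_power (mvpoly_ring n) J l) N = ?I"
    unfolding J s(3) by (rule colon_symbolic_power[OF \<B> s(1,2)])
  obtain B\<^sub>0 where B\<^sub>0: "B\<^sub>0 \<in> \<B>" using \<B> unfolding matroid_bases_def by blast
  define r where "r = card B\<^sub>0"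
  have Bsub: "B \<subseteq> {1..n}" if "B \<in> \<B>" for B using matroid_bases_finite(2)[OF \<B> _ that] by simp
  have finB: "finite B" if "B \<in> \<B>" for B using Bsub[OF that] finite_subset by blast
  have r: "card B = r" if "B \<in> \<B>" for B unfolding r_def using matroid_bases_card[OF \<B> _ that B\<^sub>0] by simp
  have fin: "finite \<B>" using \<B> finite_subset[of \<B> "Pow {1..n}"] unfolding matroid_bases_def by simp
  have I: "ideal ?I (mvpoly_ring n)" by (rule monomial_ideal_ideal[of ?U, OF minor_exponent_add])
  have "cohen_macaulay_ideal (mvpoly_ring n) ?I"
  proof (rule cohen_macaulay_idealI[OF cring_mvpoly noetherian_mvpoly I])
    fix k and Q :: "nat \<Rightarrow> 'k mvpoly set"
    assume Q: "\<forall>i\<le>k. primeideal (Q i) (mvpoly_ring n)" "\<forall>i<k. Q i \<subset> Q (Suc i)" "?I \<subseteq> Q 0"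
    show "k \<le> n - r"
    proof (rule prime_chain_length_le[OF fin _ _ Q, of r l])
      show "B \<subseteq> {1..n} \<and> card B = r" if "B \<in> \<B>" for B using Bsub r that by blast
      fix m assume "\<not> ?U m"
      then obtain B where B: "B \<in> \<B>" "\<not> l \<le> (\<Sum>i\<in>B. lookup m i) + card (B \<inter> keys s)"
        unfolding minor_exponent_def by blast
      \<comment> \<open>Discarding the contribution of s leaves a bound on each single exponent over
        B, which is what the counting of monomials uses.\<close>
      have "lookup m i < l" if "i \<in> B" for i
        using member_le_sum[OF that _ finB[OF B(1)], of "lookup m"] B(2) by simp
      then show "\<exists>B\<in>\<B>. \<forall>i\<in>B. lookup m i < l" using B(1) by blast
    qed
  next
    fix M assume M: "maximalideal M (mvpoly_ring n :: 'k mvpoly ring)"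
    interpret M: maximalideal M "mvpoly_ring n" by fact
    note cl = mvpoly_ideal_closed[OF M.is_ideal]
    have "\<forall>j\<in>{1..n}. \<exists>f. f \<in> M \<and> f \<noteq> 0 \<and> keys f \<subseteq> range (single j)"
    proof
      fix j assume "j \<in> {1..n}"
      from maximalideal_meets_univariate[OF M this]
      show "\<exists>f. f \<in> M \<and> f \<noteq> 0 \<and> keys f \<subseteq> range (single j)" by blast
    qed
    then obtain f where "\<forall>j\<in>{1..n}. f j \<in> M \<and> f j \<noteq> 0 \<and> keys (f j) \<subseteq> range (single j)"
      by (rule exE[OF bchoice])
    then have f: "f j \<in> M \<and> f j \<noteq> 0 \<and> keys (f j) \<subseteq> range (single j)" if "j \<in> {1..n}" for j
      using that by (rule bspec)
    \<comment> \<open>The factor x_j removes the constant term; \<open>z j\<close> stays in M and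
      nonzero.\<close>
    define z where "z j = f j * single (single j 1) 1" for j
    have z: "univariate j (z j)" if j: "j \<in> {1..n}" for j
    proof -
      have k: "keys (z j) = (\<lambda>m. m + single j 1) ` keys (f j)"
        unfolding z_def by (rule keys_times_monomial)
      have "keys (z j) \<subseteq> range (single j)"
      proof
        fix m assume "m \<in> keys (z j)"
        then obtain t where t: "t \<in> keys (f j)" "m = t + single j 1" unfolding k by blast
        then obtain i where "t = single j i" using f[OF j] by blast
        then have "m = single j (i + 1)" using t(2) by (simp only: single_add)
        then show "m \<in> range (single j)" by blast
      qed
      moreover have "keys (z j) \<noteq> {}" unfolding k using f[OF j] by simp
      then have "z j \<noteq> 0" by auto
      moreover have "0 \<notin> keys (z j)"
        unfolding k
      proof
        assume "0 \<in> (\<lambda>m. m + single j 1) ` keys (f j)"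
        then obtain m where "0 = m + single j (1::nat)" by blast
        then have "lookup (0 :: monom_exp) j = lookup m j + 1" by (metis lookup_add lookup_single_eq)
        then show False by simp
      qed
      ultimately show ?thesis unfolding univariate_def by (simp add: in_keys_iff)
    qed
    have zM: "z j \<in> M" if "j \<in> {1..n}" for j
      unfolding z_def using f[OF that] that by (intro cl(4)) auto
    have zc: "z j \<in> carrier (mvpoly_ring n)" if "j \<in> {1..n}" for j using cl(5)[OF zM[OF that]] .
    let ?ts = "map (esym {1..n} z) (rev [1..<n - r + 1])"
    \<comment> \<open>In degree 0 the symmetric polynomial is the empty product 1, so the sequence
      has to stop at degree 1.\<close>
    have "esym {1..n} z k \<in> M" if k: "k \<ge> 1" for k
      unfolding esym_def
    proof (rule cl(8))
      fix S assume S: "S \<in> {S. S \<subseteq> {1..n} \<and> card S = k}"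
      then have finS: "finite S" and "S \<noteq> {}" using k finite_subset by auto
      then obtain j where j: "j \<in> S" by blast
      have "(\<Prod>i\<in>S. z i) = z j * (\<Prod>i\<in>S - {j}. z i)" by (rule prod.remove[OF finS j])
      also have "\<dots> \<in> M"
      proof (rule cl(4))
        show "z j \<in> M" using zM S j by blast
        show "(\<Prod>i\<in>S - {j}. z i) \<in> carrier (mvpoly_ring n)" using zc S by (intro mvpoly_prod_closed) blast
      qed
      finally show "(\<Prod>i\<in>S. z i) \<in> M" .
    qed
    then have "set ?ts \<subseteq> M" by auto
    moreover have "length ?ts = n - r" unfolding length_map length_rev length_upt by simp
    moreover have "weakly_regular (mvpoly_ring n) ?I ?ts"
      by (rule matroid_minor_regular[OF \<B> r z s(1) _ B\<^sub>0]) auto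
    ultimately show "\<exists>xs. set xs \<subseteq> M \<and> length xs = n - r \<and> weakly_regular (mvpoly_ring n) ?I xs" by blast
  qed
  then show ?thesis unfolding I_eq .
qed

end
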